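(* Consider the naming game on the complete graph with $n$ vertices, started with all vocabularies empty, and let $V_t$ be the set of words in existence at time $t$. For any $\epsilon>0$ let $a=a_n=(\tfrac12+\epsilon)\log n$ and $b=b_n=n^{1/2-\epsilon}$. Then as $n\to\infty$ $$\mathbb{P}\Big(\sup_{a\le t\le b}\big||V_t|-\tfrac n2\big|=o(n)\Big)=1-o(1),$$ i.e. for every $\delta>0$, $\lim_{n\to\infty}\mathbb{P}\big(\sup_{a_n\le t\le b_n}\big||V_t|-\tfrac n2\big|\le\delta n\big)=1$ (the supremum over an empty set being $0$).
   Context: Naming game on the complete graph: let $V=\{1,\dots,n\}$, $n\ge2$. The state at time $t\ge0$ is a map $W_t$ from $V$ to the finite subsets of $V$, where $W_t(v)$ is the vocabulary of $v$ (words are labelled by the vertex that invents them). Initially $W_0(v)=\varnothing$ for all $v$. For each $v\in V$, at the times of an independent rate-one Poisson process, $v$ chooses a listener $w$ uniformly at random from $V\setminus\{v\}$; if this occurs at time $t$, then: (i) if $W_{t^-}(v)=\varnothing$, then $W_t(v)=\{v\}$ and $W_t(w)=W_{t^-}(w)\cup\{v\}$; (ii) if $W_{t^-}(v)\neq\varnothing$, then $v$ chooses $u$ uniformly at random from $W_{t^-}(v)$; if $u\in W_{t^-}(w)$ then $W_t(v)=W_t(w)=\{u\}$, and if $u\notin W_{t^-}(w)$ then $W_t(v)=W_{t^-}(v)$ and $W_t(w)=W_{t^-}(w)\cup\{u\}$. All other vocabularies are unchanged. The set of words in existence at time $t$ is $V_t=\bigcup_{v\in V}W_t(v)$. *)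

theory Defs
  imports "HOL-Probability.Probability"
begin

type_synonym vocabularies = "nat \<Rightarrow> nat set"

text \<open>
  Effect of speaker \<open>v\<close> addressing listener \<open>w\<close>. The word uttered from a non-empty
  vocabulary \<open>A\<close> is \<open>c A\<close>, where \<open>c\<close> is a choice function.
\<close>

definition interact :: "nat \<Rightarrow> nat \<Rightarrow> (nat set \<Rightarrow> nat) \<Rightarrow> vocabularies \<Rightarrow> vocabularies" where
  "interact v w c W =
    (if W v = {} then W(v := {v}, w := W w \<union> {v})
     else let u = c (W v) in
       if u \<in> W w then W(v := {u}, w := {u})
       else W(w := W w \<union> {u}))"

text \<open>
  An outcome \<open>\<omega>\<close> assigns to each vertex \<open>v\<close> and each \<open>k\<close> the waiting time between the
  \<open>k\<close>-th and the next ring of the clock of \<open>v\<close> (counting time 0 as ring 0), the listener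
  chosen at that next ring, and a choice function used to select the word.
\<close>

type_synonym outcome = "nat \<times> nat \<Rightarrow> real \<times> nat \<times> (nat set \<Rightarrow> nat)"

text \<open>
  The choice function is uniform among all choice functions on the non-empty subsets of
  \<open>{1..n}\<close>, so its value at each such set \<open>A\<close> is uniform on \<open>A\<close>. It is independent of
  the vocabularies just before the ring, so the word uttered is, given the past, uniform
  on the current vocabulary of the speaker.
\<close>

definition ring_measure :: "nat \<Rightarrow> nat \<Rightarrow> (real \<times> nat \<times> (nat set \<Rightarrow> nat)) measure" where
  "ring_measure n v =
     density lborel (\<lambda>x. ennreal (exponential_density 1 x)) \<Otimes>\<^sub>M
     (measure_pmf (pmf_of_set ({1..n} - {v})) \<Otimes>\<^sub>M
      measure_pmf (pmf_of_set (\<Pi>\<^sub>E A \<in> Pow {1..n} - {{}}. A)))"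

text \<open>
  The space is completed so that the null set of outcomes where two clocks ring
  simultaneously, or where rings accumulate, cannot affect measurability of events.
\<close>

definition game_space :: "nat \<Rightarrow> outcome measure" where
  "game_space n = completion (\<Pi>\<^sub>M (v, k) \<in> {1..n} \<times> UNIV. ring_measure n v)"

definition ring_time :: "outcome \<Rightarrow> nat \<Rightarrow> nat \<Rightarrow> real" where
  "ring_time \<omega> v k = (\<Sum>j\<le>k. fst (\<omega> (v, j)))"

definition ring_times_upto :: "nat \<Rightarrow> outcome \<Rightarrow> real \<Rightarrow> real set" where
  "ring_times_upto n \<omega> t = {ring_time \<omega> v k | v k. v \<in> {1..n} \<and> ring_time \<omega> v k \<le> t}"

text \<open>
  Almost surely, exactly one pair \<open>(v, k)\<close> satisfies the condition below at each ring time \<open>s\<close>.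
\<close>

definition ring_at :: "nat \<Rightarrow> outcome \<Rightarrow> real \<Rightarrow> nat \<times> nat" where
  "ring_at n \<omega> s = (SOME (v, k). v \<in> {1..n} \<and> ring_time \<omega> v k = s)"

definition ring_update :: "nat \<Rightarrow> outcome \<Rightarrow> real \<Rightarrow> vocabularies \<Rightarrow> vocabularies" where
  "ring_update n \<omega> s =
     (let (v, k) = ring_at n \<omega> s; (_, w, c) = \<omega> (v, k) in interact v w c)"

text \<open>
  The vocabularies \<open>W\<^sub>t\<close>: the updates at all rings up to and including time \<open>t\<close>, applied in
  chronological order to the empty initial vocabularies. Almost surely, the set of ring
  times up to \<open>t\<close> is finite for every \<open>t\<close>.
\<close>

definition vocab :: "nat \<Rightarrow> outcome \<Rightarrow> real \<Rightarrow> vocabularies" where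
  "vocab n \<omega> t =
     fold (ring_update n \<omega>) (sorted_list_of_set (ring_times_upto n \<omega> t)) (\<lambda>_. {})"

definition words :: "nat \<Rightarrow> outcome \<Rightarrow> real \<Rightarrow> nat set" where
  "words n \<omega> t = (\<Union>v\<in>{1..n}. vocab n \<omega> t v)"

end

theory Submission
  imports Defs "HOL-Real_Asymp.Real_Asymp"
begin

text \<open>
  Why the theorem holds. A vertex invents its word exactly if it takes part in the game for the
  first time as a speaker. At every ring the speaker and the listener are both uniformly
  distributed, so the number of vertices that enter as speakers minus the number of those that
  enter as listeners is a martingale, and it moves at most \<open>n\<close> times: it stays \<open>o(n)\<close>. After
  \<open>n * sqrt (ln n)\<close> rings, hence before time \<open>a\<close>, only \<open>o(n)\<close> vertices have not entered. So
  \<open>n/2 + o(n)\<close> words are invented (lemma \<open>inventions_concentration\<close>), and there are never more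
  words than inventions.

  Conversely, call an interaction an agreement if the listener knows the word spoken. The
  inventor of a word keeps this word until it takes part in an agreement, and an agreement
  involves two vertices. Therefore at most two inventors per agreement lose their word
  (\<open>inventions_le_words\<close>), and it suffices that only \<open>o(n)\<close> agreements occur during the
  roughly \<open>n powr (3/2 - \<epsilon>)\<close> rings before time \<open>b\<close>.

  The probability that a ring is an agreement is at most the number \<open>N\<close> of holders of the most
  widespread word, divided by \<open>n - 1\<close>. At time \<open>t\<close> a typical vocabulary has size about \<open>t\<close>. The
  quantity to control for a word \<open>u\<close> is its rate \<open>R\<close>, the sum of \<open>1 / L\<close> over the sizes \<open>L\<close> of
  the vocabularies that contain \<open>u\<close>. The word is passed to a new vertex at rate \<open>R\<close>, which adds
  about \<open>1 / t\<close> to \<open>R\<close>; but a holder of \<open>u\<close> learns other words at rate about \<open>1\<close> and then loses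
  \<open>1 / L - 1 / (L + 1)\<close>, which removes about \<open>R / t\<close> per unit of time. The two effects almost cancel. High moments of \<open>R\<close>
  show that no rate ever exceeds a small power of \<open>n\<close> (\<open>popular_word_unlikely\<close>), so that
  \<open>N\<close> is at most that power times \<open>t\<close>, and \<open>o(n)\<close> agreements are expected.

  The cancellation is made precise with three supermartingales, on histories stopped when one of
  the estimates fails. Vocabularies are not much larger than \<open>t\<close>, by an exponential moment
  (\<open>drift_vsize\<close>). The growth of \<open>R\<close> is driven by the average of \<open>1 / (L + 1)\<close> over all
  vertices, accumulated over time (the exposure); this is close to \<open>ln t\<close>, because a harmonic
  number of a vocabulary size grows by exactly \<open>1 / (L + 1)\<close> when a word is learnt
  (\<open>drift_exposure\<close>), and it cannot be smaller, by convexity. Finally a power of \<open>R + c\<close>,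
  discounted by the accumulated growth, is a supermartingale (\<open>drift_discounted_potential\<close>).

  The passage from continuous time to a sequence of independent uniform interactions uses that
  exponential waiting times have no memory: after the first ring of all clocks, the remaining
  waiting times have their original law and are independent of the first ring
  (\<open>first_ring_decomposition\<close>). Iterating gives the law of the interactions
  (\<open>event_list_sets\<close>) and of the time of the \<open>m\<close>-th ring.
\<close>

section \<open>Conditioning a product measure on finitely many coordinates\<close>

text \<open>
  Conditioning finitely many coordinates on events, moving the coordinates along an injection and
  transforming them one by one yields a product measure again. It equals the original measure up
  to a factor as soon as this is true in each coordinate. It suffices to compare cylinder sets.
  The factor \<open>p i\<close> below is the conditional weight of coordinate \<open>i\<close>.
\<close>

lemma PiM_condition_reindex:
  fixes M :: "'i \<Rightarrow> 'a measure"
  assumes prob: "\<And>i. i \<in> I \<Longrightarrow> prob_space (M i)"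
    and inj: "inj_on f I" and fI: "f \<in> I \<rightarrow> I"
    and J0: "finite J0" "J0 \<subseteq> I"
    and g[measurable]: "\<And>i. i \<in> I \<Longrightarrow> g i \<in> M (f i) \<rightarrow>\<^sub>M M i"
    and A: "\<And>i. i \<in> I \<Longrightarrow> A i \<in> sets (M (f i))"
    and p: "\<And>i B. i \<in> I \<Longrightarrow> B \<in> sets (M i) \<Longrightarrow>
        emeasure (M (f i)) (A i \<inter> (g i -` B \<inter> space (M (f i)))) = p i * emeasure (M i) B"
    and triv: "\<And>i. i \<in> I - J0 \<Longrightarrow> A i = space (M (f i)) \<and> p i = 1"
    and G: "G \<in> borel_measurable (PiM I M)"
  shows "(\<integral>\<^sup>+\<omega>. indicator {\<omega>. \<forall>i\<in>J0. \<omega> (f i) \<in> A i} \<omega> * G (\<lambda>i\<in>I. g i (\<omega> (f i))) \<partial>PiM I M)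
          = (\<Prod>i\<in>J0. p i) * (\<integral>\<^sup>+\<omega>. G \<omega> \<partial>PiM I M)"
proof -
  let ?P = "PiM I M"
  interpret P: prob_space ?P using prob by (rule prob_space_PiM)
  define t where "t = (\<lambda>\<omega>. \<lambda>i\<in>I. g i (\<omega> (f i)))"
  define D where "D = {\<omega> \<in> space ?P. \<forall>i\<in>J0. \<omega> (f i) \<in> A i}"
  have fI': "i \<in> I \<Longrightarrow> f i \<in> I" for i using fI by auto
  have t[measurable]: "t \<in> ?P \<rightarrow>\<^sub>M ?P" unfolding t_def
  proof (rule measurable_restrict)
    fix i assume i: "i \<in> I"
    show "(\<lambda>x. g i (x (f i))) \<in> ?P \<rightarrow>\<^sub>M M i"
      by (rule measurable_compose[where f="\<lambda>x. x (f i)" and g="g i" and N="M (f i)"])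
         (auto intro: measurable_component_singleton fI' i g)
  qed
  have D[measurable]: "D \<in> sets ?P" unfolding D_def
    using J0 fI' A by (intro sets.sets_Collect_finite_All) (auto intro!: measurable_sets_Collect[OF measurable_component_singleton])
  let ?N = "distr (density ?P (indicator D)) ?P t"
  have N_em: "emeasure ?N X = emeasure ?P {\<omega>\<in>space ?P. \<omega> \<in> D \<and> t \<omega> \<in> X}" if "X \<in> sets ?P" for X
  proof -
    have "emeasure ?N X = emeasure (density ?P (indicator D)) (t -` X \<inter> space ?P)"
      using that by (subst emeasure_distr) auto
    also have "\<dots> = emeasure ?P (D \<inter> (t -` X \<inter> space ?P))"
      using that by (subst emeasure_density) (auto simp: nn_integral_cmult_indicator indicator_inter_arith[symmetric] nn_integral_indicator)
    also have "D \<inter> (t -` X \<inter> space ?P) = {\<omega>\<in>space ?P. \<omega> \<in> D \<and> t \<omega> \<in> X}" by auto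
    finally show ?thesis .
  qed
  \<comment> \<open>Both sides agree on cylinder sets; there, only the coordinates in \<open>J0 \<union> J\<close> matter.\<close>
  have "?N = scale_measure (\<Prod>i\<in>J0. p i) ?P"
  proof (rule measure_eqI_PiM_infinite)
    show "finite_measure ?N"
    proof
      have "emeasure ?N (space ?N) \<le> emeasure ?P (space ?P)"
        using N_em[of "space ?P"] by (auto intro!: emeasure_mono)
      then show "emeasure ?N (space ?N) \<noteq> \<infinity>" by (auto simp: P.emeasure_space_1 top_unique)
    qed
    fix B J assume J: "finite J" "J \<subseteq> I" and B: "\<And>i. i \<in> J \<Longrightarrow> B i \<in> sets (M i)"
    let ?X = "prod_emb I M J (Pi\<^sub>E J B)"
    define C where "C i = A i \<inter> (g i -` (if i \<in> J then B i else space (M i)) \<inter> space (M (f i)))" for i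
    have Cs: "C i \<in> sets (M (f i))" if "i \<in> I" for i
      unfolding C_def using A[OF that] g[OF that] B by (auto intro!: sets.Int measurable_sets)
    let ?K = "J0 \<union> J"
    have fK: "?K \<subseteq> I" "finite ?K" using J J0 by auto
    have invf: "the_inv_into I f (f i) = i" if "i \<in> I" for i
      using inj that by (rule the_inv_into_f_f)
    have Csp: "C i = A i \<inter> space (M (f i))" if "i \<in> I - J" for i
      using measurable_space[OF g[of i]] that unfolding C_def by auto
    have X: "?X \<in> sets ?P" using J B by (intro sets_PiM_I) auto
    have "emeasure ?N ?X = emeasure ?P {\<omega>\<in>space ?P. \<omega> \<in> D \<and> t \<omega> \<in> ?X}"
      using X by (rule N_em)
    also have "{\<omega>\<in>space ?P. \<omega> \<in> D \<and> t \<omega> \<in> ?X} = prod_emb I M (f ` ?K) (\<Pi>\<^sub>E j\<in>f`?K. C (the_inv_into I f j))"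
      (is "?L = ?R")
    proof -
      have "\<omega> \<in> ?L \<longleftrightarrow> \<omega> \<in> space ?P \<and> (\<forall>i\<in>?K. \<omega> (f i) \<in> C i)" for \<omega>
      proof (cases "\<omega> \<in> space ?P")
        case True
        have sp: "\<omega> (f i) \<in> space (M (f i))" if "i \<in> I" for i
          using True fI'[OF that] by (auto simp: space_PiM PiE_iff)
        have tsp: "t \<omega> \<in> space ?P" using measurable_space[OF t True] .
        have "t \<omega> \<in> ?X \<longleftrightarrow> (\<forall>i\<in>J. g i (\<omega> (f i)) \<in> B i)"
          using tsp J by (auto simp: prod_emb_def space_PiM PiE_iff t_def subset_iff)
        moreover have "\<omega> \<in> D \<longleftrightarrow> (\<forall>i\<in>J0. \<omega> (f i) \<in> A i)" using True by (simp add: D_def)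
        moreover have "\<omega> (f i) \<in> A i" if "i \<in> J" "i \<notin> J0" for i
          using triv[of i] that J sp[of i] by auto
        moreover have "g i (\<omega> (f i)) \<in> space (M i)" if "i \<in> I" for i
          using measurable_space[OF g[OF that] sp[OF that]] .
        ultimately show ?thesis using True sp J0 J unfolding C_def by auto
      qed auto
      moreover have "\<omega> \<in> ?R \<longleftrightarrow> \<omega> \<in> space ?P \<and> (\<forall>i\<in>?K. \<omega> (f i) \<in> C i)" for \<omega>
      proof -
        have "(\<forall>i\<in>f ` ?K. \<omega> i \<in> C (the_inv_into I f i)) \<longleftrightarrow> (\<forall>i\<in>?K. \<omega> (f i) \<in> C i)"
        proof -
          have e: "C (the_inv_into I f (f i)) = C i" if "i \<in> ?K" for i
            using fK invf that by (auto simp: subset_iff)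
          show ?thesis unfolding Set.ball_simps(9) by (rule ball_cong) (simp_all only: e)
        qed
        then show ?thesis using fK fI' by (auto simp: prod_emb_def space_PiM PiE_iff)
      qed
      ultimately show ?thesis by blast
    qed
    also have "emeasure ?P ?R = (\<Prod>j\<in>f`?K. emeasure (M j) (C (the_inv_into I f j)))"
      using fK fI' Cs invf prob by (intro emeasure_PiM_emb) (auto simp: subset_iff)
    also have "\<dots> = (\<Prod>i\<in>?K. emeasure (M (f i)) (C i))"
      using inj fK invf by (subst prod.reindex) (auto simp: inj_on_subset subset_iff intro!: prod.cong)
    also have "\<dots> = (\<Prod>i\<in>?K. p i * emeasure (M i) (if i \<in> J then B i else space (M i)))"
      using fK B by (intro prod.cong refl) (auto simp: C_def p subset_iff)
    also have "\<dots> = (\<Prod>i\<in>?K. p i) * (\<Prod>i\<in>?K. emeasure (M i) (if i \<in> J then B i else space (M i)))"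
      by (rule prod.distrib)
    also have "(\<Prod>i\<in>?K. p i) = (\<Prod>i\<in>J0. p i)"
      using fK triv by (intro prod.mono_neutral_right) auto
    also have "(\<Prod>i\<in>?K. emeasure (M i) (if i \<in> J then B i else space (M i))) = (\<Prod>i\<in>J. emeasure (M i) (B i))"
      using fK prob by (intro prod.mono_neutral_cong_right) (auto simp: prob_space.emeasure_space_1 subset_iff)
    also have "(\<Prod>i\<in>J. emeasure (M i) (B i)) = emeasure ?P ?X"
      using J B prob by (intro emeasure_PiM_emb[symmetric]) auto
    finally show "emeasure ?N ?X = emeasure (scale_measure (\<Prod>i\<in>J0. p i) ?P) ?X" by simp
  qed auto
  then have "(\<integral>\<^sup>+\<omega>. G \<omega> \<partial>?N) = (\<Prod>i\<in>J0. p i) * (\<integral>\<^sup>+\<omega>. G \<omega> \<partial>?P)"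
    using G by (simp add: nn_integral_scale_measure)
  moreover have "(\<integral>\<^sup>+\<omega>. G \<omega> \<partial>?N) = (\<integral>\<^sup>+\<omega>. indicator D \<omega> * G (t \<omega>) \<partial>?P)"
    using G by (subst nn_integral_distr) (auto simp: nn_integral_density)
  moreover have "\<dots> = (\<integral>\<^sup>+\<omega>. indicator {\<omega>. \<forall>i\<in>J0. \<omega> (f i) \<in> A i} \<omega> * G (\<lambda>i\<in>I. g i (\<omega> (f i))) \<partial>?P)"
    by (intro nn_integral_cong) (auto simp: D_def t_def indicator_def)
  ultimately show ?thesis by simp
qed


section \<open>The first ring and the clocks after it\<close>

text \<open>
  The outcome space before completion: measurability of maps and iterated integrals are treated
  here, and the completion enters only at the very end.
\<close>

definition clocks :: "nat \<Rightarrow> outcome measure" where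
  "clocks n = (\<Pi>\<^sub>M (v, k) \<in> {1..n} \<times> UNIV. ring_measure n v)"

definition mark_measure :: "nat \<Rightarrow> nat \<Rightarrow> (nat \<times> (nat set \<Rightarrow> nat)) measure" where
  "mark_measure n v = measure_pmf (pmf_of_set ({1..n} - {v})) \<Otimes>\<^sub>M
     measure_pmf (pmf_of_set (\<Pi>\<^sub>E A \<in> Pow {1..n} - {{}}. A))"

lemma ring_measure_eq:
  "ring_measure n v = density lborel (\<lambda>x. ennreal (exponential_density 1 x)) \<Otimes>\<^sub>M mark_measure n v"
  by (simp add: ring_measure_def mark_measure_def)

lemma prob_space_mark_measure: "prob_space (mark_measure n v)"
  unfolding mark_measure_def by (intro prob_space_pair prob_space_measure_pmf)

lemma space_mark_measure [simp]: "space (mark_measure n v) = UNIV"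
  by (simp add: mark_measure_def space_pair_measure)

lemma sets_mark_measure [measurable_cong]:
  "sets (mark_measure n v) = sets (count_space UNIV \<Otimes>\<^sub>M count_space UNIV)"
  unfolding mark_measure_def by (intro sets_pair_measure_cong) auto

lemma clocks_eq: "clocks n = PiM ({1..n} \<times> UNIV) (\<lambda>i. ring_measure n (fst i))"
  by (simp add: clocks_def case_prod_unfold)

lemma space_ring_measure [simp]: "space (ring_measure n v) = UNIV"
  by (simp add: ring_measure_def space_pair_measure)

lemma prob_space_ring_measure: "prob_space (ring_measure n v)"
  unfolding ring_measure_eq
  by (intro prob_space_pair prob_space_exponential_density prob_space_mark_measure) auto

lemma prob_space_clocks: "prob_space (clocks n)"
  unfolding clocks_eq by (intro prob_space_PiM prob_space_ring_measure)

lemma measurable_fst_ring [measurable]: "fst \<in> borel_measurable (ring_measure n v)"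
  by (simp add: ring_measure_def)

lemma sets_ring_measure [measurable_cong]:
  "sets (ring_measure n v) = sets (borel \<Otimes>\<^sub>M (count_space UNIV \<Otimes>\<^sub>M count_space UNIV))"
  unfolding ring_measure_def by (intro sets_pair_measure_cong) auto

lemma nn_integral_ring_measure:
  assumes f[measurable]: "f \<in> borel_measurable (ring_measure n v)"
  shows "(\<integral>\<^sup>+y. f y \<partial>ring_measure n v) =
    (\<integral>\<^sup>+s. ennreal (exponential_density 1 s) *
      (\<integral>\<^sup>+m. f (s, m) \<partial>mark_measure n v) \<partial>lborel)"
proof -
  let ?K = "mark_measure n v"
  interpret K: prob_space ?K by (rule prob_space_mark_measure)
  have f'[measurable]: "f \<in> borel_measurable (density lborel (\<lambda>x. ennreal (exponential_density 1 x)) \<Otimes>\<^sub>M ?K)"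
    using f by (simp add: ring_measure_eq)
  have f''[measurable]: "f \<in> borel_measurable (borel \<Otimes>\<^sub>M ?K)"
    using f' by (simp cong: measurable_cong_sets sets_pair_measure_cong)
  show ?thesis unfolding ring_measure_eq
    by (subst K.nn_integral_fst[symmetric, OF f'], subst nn_integral_density)
       (use K.borel_measurable_nn_integral_fst[OF f''] in auto)
qed

text \<open>
  The memoryless property of the exponential law, in the presence of the mark that a ring carries.
\<close>

lemma clock_memoryless:
  assumes \<tau>: "\<tau> \<ge> 0" and B[measurable]: "B \<in> sets (ring_measure n v)"
  shows "emeasure (ring_measure n v)
      ({y. \<tau> < fst y} \<inter> ((\<lambda>y. (fst y - \<tau>, snd y)) -` B \<inter> space (ring_measure n v)))
    = ennreal (exp (- \<tau>)) * emeasure (ring_measure n v) B"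
proof -
  let ?K = "mark_measure n v"
  interpret K: prob_space ?K by (rule prob_space_mark_measure)
  let ?S = "{y. \<tau> < fst y} \<inter> ((\<lambda>y. (fst y - \<tau>, snd y)) -` B \<inter> space (ring_measure n v))"
  have [measurable]: "B \<in> sets (borel \<Otimes>\<^sub>M (count_space UNIV \<Otimes>\<^sub>M count_space UNIV))"
    using B sets_ring_measure by simp
  have [measurable]: "B \<in> sets (borel \<Otimes>\<^sub>M ?K)"
    using B by (simp add: sets_ring_measure cong: sets_pair_measure_cong)
  define h where "h s = (\<integral>\<^sup>+m. indicator B (s, m) \<partial>?K)" for s :: real
  have h[measurable]: "h \<in> borel_measurable borel"
    unfolding h_def by (intro K.borel_measurable_nn_integral) simp
  have S: "?S \<in> sets (ring_measure n v)"
  proof -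
    have "?S = {y\<in>space (ring_measure n v). \<tau> < fst y \<and> (fst y - \<tau>, snd y) \<in> B}" by auto
    also have "\<dots> \<in> sets (ring_measure n v)" by measurable
    finally show ?thesis .
  qed
  have "emeasure (ring_measure n v) ?S = (\<integral>\<^sup>+y. indicator ?S y \<partial>ring_measure n v)"
    using S by simp
  also have "\<dots> = (\<integral>\<^sup>+s. ennreal (exponential_density 1 s) * (indicator {\<tau><..} s * h (s - \<tau>)) \<partial>lborel)"
  proof (subst nn_integral_ring_measure)
    show "indicator ?S \<in> borel_measurable (ring_measure n v)" using S by simp
    have [measurable]: "(\<lambda>m. indicator B (s, m) :: ennreal) \<in> borel_measurable ?K" for s :: real
      by simp
    show "(\<integral>\<^sup>+s. ennreal (exponential_density 1 s) * (\<integral>\<^sup>+m. indicator ?S (s, m) \<partial>?K) \<partial>lborel) =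
      (\<integral>\<^sup>+s. ennreal (exponential_density 1 s) * (indicator {\<tau><..} s * h (s - \<tau>)) \<partial>lborel)"
      unfolding h_def
      by (intro nn_integral_cong arg_cong2[where f="(*)"] refl, subst nn_integral_cmult[symmetric])
         (auto intro!: nn_integral_cong simp: indicator_def)
  qed
  also have "\<dots> = (\<integral>\<^sup>+r. ennreal (exponential_density 1 (\<tau> + r)) * (indicator {\<tau><..} (\<tau> + r) * h r) \<partial>lborel)"
    by (subst nn_integral_real_affine[where c=1 and t=\<tau>]) (auto simp: algebra_simps)
  also have "\<dots> = (\<integral>\<^sup>+r. ennreal (exp (- \<tau>)) * (ennreal (exponential_density 1 r) * h r) \<partial>lborel)"
  proof (rule nn_integral_cong_AE)
    show "AE r in lborel. ennreal (exponential_density 1 (\<tau> + r)) * (indicator {\<tau><..} (\<tau> + r) * h r)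
        = ennreal (exp (- \<tau>)) * (ennreal (exponential_density 1 r) * h r)"
      using AE_lborel_singleton[of 0]
    proof eventually_elim
      case (elim r)
      show ?case
      proof (cases "r > 0")
        case True
        have "ennreal (exponential_density 1 (\<tau> + r)) = ennreal (exp (- \<tau>)) * ennreal (exponential_density 1 r)"
          using True \<tau> by (simp add: exponential_density_def exp_add[symmetric] ennreal_mult'[symmetric])
        then show ?thesis using True by (simp add: mult_ac)
      next
        case False
        then show ?thesis using elim by (simp add: exponential_density_def)
      qed
    qed
  qed
  also have "\<dots> = ennreal (exp (- \<tau>)) * (\<integral>\<^sup>+r. ennreal (exponential_density 1 r) * h r \<partial>lborel)"
    by (rule nn_integral_cmult) simp
  also have "(\<integral>\<^sup>+r. ennreal (exponential_density 1 r) * h r \<partial>lborel) = (\<integral>\<^sup>+y. indicator B y \<partial>ring_measure n v)"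
    unfolding h_def by (subst nn_integral_ring_measure) auto
  finally show ?thesis by simp
qed

definition rings_first :: "nat \<Rightarrow> outcome \<Rightarrow> nat \<Rightarrow> bool" where
  "rings_first n \<omega> v \<longleftrightarrow> v \<in> {1..n} \<and> (\<forall>x\<in>{1..n} - {v}. fst (\<omega> (v, 0)) < fst (\<omega> (x, 0)))"

text \<open>
  The outcome seen from time \<open>\<tau>\<close>, the first ring of \<open>v\<close>: the clock of \<open>v\<close> drops its first
  waiting time, every other clock has already waited for \<open>\<tau>\<close>.
\<close>

definition advance :: "nat \<Rightarrow> nat \<Rightarrow> real \<Rightarrow> outcome \<Rightarrow> outcome" where
  "advance n v \<tau> \<omega> = (\<lambda>(x, k)\<in>{1..n} \<times> UNIV.
     if x = v then \<omega> (v, Suc k)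
     else if k = 0 then (fst (\<omega> (x, 0)) - \<tau>, snd (\<omega> (x, 0))) else \<omega> (x, k))"

lemma measurable_clock:
  "i \<in> {1..n} \<times> UNIV \<Longrightarrow> (\<lambda>\<omega>. \<omega> i) \<in> clocks n \<rightarrow>\<^sub>M ring_measure n v"
proof -
  assume "i \<in> {1..n} \<times> UNIV"
  then have "(\<lambda>\<omega>. \<omega> i) \<in> clocks n \<rightarrow>\<^sub>M ring_measure n (fst i)"
    unfolding clocks_eq by (rule measurable_component_singleton)
  then show ?thesis by (simp cong: measurable_cong_sets add: sets_ring_measure)
qed

lemma measurable_clock':
  "f \<in> N \<rightarrow>\<^sub>M clocks n \<Longrightarrow> i \<in> {1..n} \<times> UNIV \<Longrightarrow> (\<lambda>x. f x i) \<in> N \<rightarrow>\<^sub>M borel \<Otimes>\<^sub>M (count_space UNIV \<Otimes>\<^sub>M count_space UNIV)"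
  using measurable_compose[OF _ measurable_clock[of i n 0]] by (simp cong: measurable_cong_sets add: sets_ring_measure)

lemma measurable_advance:
  assumes [measurable]: "t \<in> borel_measurable N" "f \<in> N \<rightarrow>\<^sub>M clocks n" and v: "v \<in> {1..n}"
  shows "(\<lambda>x. advance n v (t x) (f x)) \<in> N \<rightarrow>\<^sub>M clocks n"
  unfolding advance_def clocks_eq
proof (rule measurable_restrict)
  fix i assume "i \<in> {1..n} \<times> (UNIV :: nat set)"
  then obtain x k where i: "i = (x, k)" "x \<in> {1..n}" by auto
  have m: "(\<lambda>y. f y (x', k)) \<in> N \<rightarrow>\<^sub>M borel \<Otimes>\<^sub>M (count_space UNIV \<Otimes>\<^sub>M count_space UNIV)"
    if "x' \<in> {1..n}" for x' k
    using that by (intro measurable_clock'[OF assms(2)]) auto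
  have [measurable]: "(\<lambda>y. f y (x, 0)) \<in> N \<rightarrow>\<^sub>M borel \<Otimes>\<^sub>M (count_space UNIV \<Otimes>\<^sub>M count_space UNIV)"
    using i by (intro m)
  have "(\<lambda>y. (fst (f y (x, 0)) - t y, snd (f y (x, 0)))) \<in> N \<rightarrow>\<^sub>M borel \<Otimes>\<^sub>M (count_space UNIV \<Otimes>\<^sub>M count_space UNIV)"
    by measurable
  then have "(\<lambda>y. if x = v then f y (v, Suc k) else if k = 0 then (fst (f y (x, 0)) - t y, snd (f y (x, 0))) else f y (x, k))
    \<in> N \<rightarrow>\<^sub>M borel \<Otimes>\<^sub>M (count_space UNIV \<Otimes>\<^sub>M count_space UNIV)"
    using m[OF i(2)] m[OF v] by (cases "x = v"; cases "k = 0") simp_all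
  then show "(\<lambda>y. case i of (x, k) \<Rightarrow> if x = v then f y (v, Suc k) else if k = 0 then (fst (f y (x, 0)) - t y, snd (f y (x, 0))) else f y (x, k))
    \<in> N \<rightarrow>\<^sub>M ring_measure n (fst i)"
    by (simp add: i cong: measurable_cong_sets add: sets_ring_measure)
qed

lemma pred_rings_first [measurable]: "Measurable.pred (clocks n) (\<lambda>\<omega>. rings_first n \<omega> v)"
proof (cases "v \<in> {1..n}")
  case True
  have m: "(\<lambda>\<omega>. fst (\<omega> (x, 0))) \<in> borel_measurable (clocks n)" if "x \<in> {1..n}" for x
  proof (rule measurable_compose[OF measurable_clock measurable_fst_ring])
    show "(x, 0) \<in> {1..n} \<times> UNIV" using that by blast
  qed
  have less: "Measurable.pred (clocks n) (\<lambda>\<omega>. fst (\<omega> (v, 0)) < fst (\<omega> (x, 0)))" if "x \<in> {1..n} - {v}" for x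
  proof (rule borel_measurable_pred_less[OF m[OF True] m])
    show "x \<in> {1..n}" using that by blast
  qed
  have "Measurable.pred (clocks n) (\<lambda>\<omega>. \<forall>x\<in>{1..n} - {v}. fst (\<omega> (v, 0)) < fst (\<omega> (x, 0)))"
    by (rule pred_intros_finite(3)[OF _ less]) auto
  moreover have "rings_first n \<omega> v \<longleftrightarrow> (\<forall>x\<in>{1..n} - {v}. fst (\<omega> (v, 0)) < fst (\<omega> (x, 0)))" for \<omega>
    using True unfolding rings_first_def by blast
  ultimately show ?thesis by presburger
next
  case False
  then have "rings_first n \<omega> v \<longleftrightarrow> False" for \<omega> unfolding rings_first_def by blast
  then show ?thesis by simp
qed

text \<open>
  Given that all other clocks ring after time \<open>\<tau>\<close>, the outcome seen from \<open>\<tau>\<close> has the original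
  law; each of the \<open>n - 1\<close> other clocks contributes the probability \<open>exp (- \<tau>)\<close> of a waiting time
  longer than \<open>\<tau>\<close>. The first waiting time of \<open>v\<close> does not occur in the integrand, so it may be
  integrated afterwards.
\<close>

lemma condition_on_first_ring:
  assumes v: "v \<in> {1..n}" and \<tau>: "0 \<le> \<tau>" and G: "G \<in> borel_measurable (clocks n)"
  shows "(\<integral>\<^sup>+\<omega>. indicator {\<omega>. \<forall>x\<in>{1..n} - {v}. \<tau> < fst (\<omega> (x, 0))} \<omega> * G (advance n v \<tau> \<omega>) \<partial>clocks n)
    = ennreal (exp (- (real n - 1) * \<tau>)) * (\<integral>\<^sup>+\<omega>. G \<omega> \<partial>clocks n)"
proof -
  let ?I = "{1..n} \<times> (UNIV :: nat set)" and ?M = "\<lambda>i. ring_measure n (fst i)"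
  define J0 where "J0 = ({1..n} - {v}) \<times> {0 :: nat}"
  define f where "f = (\<lambda>(x, k). if x = v then (v, Suc k) else (x, k :: nat))"
  define A :: "nat \<times> nat \<Rightarrow> (real \<times> nat \<times> (nat set \<Rightarrow> nat)) set"
    where "A i = (if i \<in> J0 then {z. \<tau> < fst z} else UNIV)" for i
  define g :: "nat \<times> nat \<Rightarrow> real \<times> nat \<times> (nat set \<Rightarrow> nat) \<Rightarrow> real \<times> nat \<times> (nat set \<Rightarrow> nat)"
    where "g i = (if i \<in> J0 then (\<lambda>z. (fst z - \<tau>, snd z)) else (\<lambda>z. z))" for i
  define p where "p i = (if i \<in> J0 then ennreal (exp (- \<tau>)) else 1)" for i
  have adv: "advance n v \<tau> \<omega> = (\<lambda>i\<in>?I. g i (\<omega> (f i)))" for \<omega>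
    unfolding advance_def
  proof (rule restrict_ext)
    fix i assume "i \<in> ?I"
    then obtain x k where i: "i = (x, k)" "x \<in> {1..n}" by auto
    show "(case i of (x, k) \<Rightarrow> if x = v then \<omega> (v, Suc k)
        else if k = 0 then (fst (\<omega> (x, 0)) - \<tau>, snd (\<omega> (x, 0)))
        else \<omega> (x, k)) = g i (\<omega> (f i))"
      using i by (cases "x = v"; cases "k = 0") (simp_all add: g_def f_def J0_def)
  qed
  have ev: "(\<forall>x\<in>{1..n} - {v}. \<tau> < fst (\<omega> (x, 0))) \<longleftrightarrow> (\<forall>i\<in>J0. \<omega> (f i) \<in> A i)" for \<omega>
    by (auto simp: J0_def f_def A_def)
  have ff: "fst (f i) = fst i" for i by (auto simp: f_def split: prod.splits)
  have "(\<integral>\<^sup>+\<omega>. indicator {\<omega>. \<forall>i\<in>J0. \<omega> (f i) \<in> A i} \<omega> * G (\<lambda>i\<in>?I. g i (\<omega> (f i))) \<partial>PiM ?I ?M)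
    = (\<Prod>i\<in>J0. p i) * (\<integral>\<^sup>+\<omega>. G \<omega> \<partial>PiM ?I ?M)"
  proof (rule PiM_condition_reindex)
    show "inj_on f ?I" by (auto simp: inj_on_def f_def split: if_splits)
    show "f \<in> ?I \<rightarrow> ?I" by (auto simp: f_def)
    show "finite J0" "J0 \<subseteq> ?I" by (auto simp: J0_def)
    show "g i \<in> ?M (f i) \<rightarrow>\<^sub>M ?M i" for i
      unfolding g_def by (cases "i \<in> J0") (auto simp: ff)
    show "A i \<in> sets (?M (f i))" for i
    proof -
      have "{z\<in>space (?M (f i)). \<tau> < fst z} \<in> sets (?M (f i))"
        by measurable
      then show ?thesis using sets.top[of "?M (f i)"] by (simp add: A_def)
    qed
    show "emeasure (?M (f i)) (A i \<inter> (g i -` B \<inter> space (?M (f i))))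
        = p i * emeasure (?M i) B" if "B \<in> sets (?M i)" for i B
    proof (cases "i \<in> J0")
      case True
      from clock_memoryless[OF \<tau> that] True show ?thesis by (simp only: A_def g_def p_def ff if_True)
    next
      case False
      then show ?thesis by (simp add: A_def g_def p_def ff)
    qed
    show "G \<in> borel_measurable (PiM ?I ?M)"
      using G by (simp add: clocks_eq)
    show "prob_space (?M i)" for i by (rule prob_space_ring_measure)
    show "A i = space (?M (f i)) \<and> p i = 1" if "i \<in> ?I - J0" for i
      using that by (simp add: A_def p_def)
  qed
  moreover have "(\<Prod>i\<in>J0. p i) = ennreal (exp (- (real n - 1) * \<tau>))"
  proof -
    have a: "card J0 = n - 1" using v by (simp add: J0_def card_cartesian_product)
    have b: "(\<Prod>i\<in>J0. p i) = ennreal (exp (- \<tau>)) ^ card J0" by (simp add: p_def)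
    have c: "ennreal (exp (- \<tau>)) ^ k = ennreal (exp (real k * - \<tau>))" for k
      by (subst exp_of_nat_mult) (simp add: ennreal_power)
    have d: "real (n - 1) * - \<tau> = - (real n - 1) * \<tau>"
      using v by (simp add: of_nat_diff left_diff_distrib)
    show ?thesis unfolding b a c d by (rule refl)
  qed
  ultimately show ?thesis by (simp only: adv ev clocks_eq)
qed

lemma AE_ring_measure_pos: "AE y in ring_measure n v. 0 < fst y"
proof -
  let ?R = "ring_measure n v"
  interpret R: prob_space ?R by (rule prob_space_ring_measure)
  have pos_sets: "{y\<in>space ?R. 0 < fst y} \<in> sets ?R" by measurable
  have "emeasure ?R {y\<in>space ?R. 0 < fst y} = (\<integral>\<^sup>+y. indicator {y\<in>space ?R. 0 < fst y} y \<partial>?R)"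
    by (rule nn_integral_indicator[symmetric]) measurable
  also have "\<dots> = (\<integral>\<^sup>+y. 1 \<partial>?R)"
    by (subst (1 2) nn_integral_ring_measure)
       (use AE_lborel_singleton[of 0] in \<open>auto intro!: nn_integral_cong_AE simp: indicator_def exponential_density_def\<close>)
  finally show ?thesis
    using R.emeasure_space_1 pos_sets by (intro R.AE_I_eq_1) simp_all
qed

text \<open>
  Obtained from the previous lemma by integrating over the first waiting time of \<open>v\<close>, which is
  independent of all other coordinates: replacing this coordinate by an independent copy
  preserves the product measure.
\<close>

lemma first_ring_integral:
  assumes v: "v \<in> {1..n}" and F[measurable]: "F \<in> borel_measurable (ring_measure n v \<Otimes>\<^sub>M clocks n)"
  shows "(\<integral>\<^sup>+\<omega>. indicator {\<omega>. rings_first n \<omega> v} \<omega> * F (\<omega> (v, 0), advance n v (fst (\<omega> (v, 0))) \<omega>) \<partial>clocks n)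
    = (\<integral>\<^sup>+y. ennreal (exp (- (real n - 1) * fst y)) * (\<integral>\<^sup>+\<omega>. F (y, \<omega>) \<partial>clocks n) \<partial>ring_measure n v)"
proof -
  let ?I = "{1..n} \<times> (UNIV :: nat set)" and ?R = "ring_measure n v"
  interpret C: prob_space "clocks n" by (rule prob_space_clocks)
  define H where "H \<omega> = indicator {\<omega>. rings_first n \<omega> v} \<omega> * F (\<omega> (v, 0), advance n v (fst (\<omega> (v, 0))) \<omega>)" for \<omega>
  have [measurable]: "(\<lambda>\<omega>. \<omega> (v, 0)) \<in> clocks n \<rightarrow>\<^sub>M ?R"
    using v by (intro measurable_clock) auto
  have H[measurable]: "H \<in> borel_measurable (clocks n)"
  proof -
    have [measurable]: "(\<lambda>\<omega>. fst (\<omega> (v, 0))) \<in> borel_measurable (clocks n)"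
      by (rule measurable_compose[OF _ measurable_fst_ring]) measurable
    have [measurable]: "(\<lambda>\<omega>. advance n v (fst (\<omega> (v, 0))) \<omega>) \<in> clocks n \<rightarrow>\<^sub>M clocks n"
      by (intro measurable_advance v) measurable
    show ?thesis unfolding H_def by measurable
  qed
  have ins: "insert (v, 0) ?I = ?I" using v by auto
  \<comment> \<open>Resampling one coordinate preserves the product measure.\<close>
  have upd: "distr (?R \<Otimes>\<^sub>M clocks n) (clocks n) (\<lambda>(y, \<omega>). fun_upd \<omega> (v, 0) y) = clocks n"
    using distr_pair_PiM_eq_PiM[of ?I "\<lambda>i. ring_measure n (fst i)" "(v, 0)"] prob_space_ring_measure
    unfolding ins clocks_eq[symmetric] by simp
  have upd_m[measurable]: "(\<lambda>(y, \<omega>). fun_upd \<omega> (v, 0) y) \<in> (?R \<Otimes>\<^sub>M clocks n) \<rightarrow>\<^sub>M clocks n"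
    unfolding clocks_eq using v
    by (simp add: case_prod_unfold) (rule measurable_fun_upd[where J="?I"], auto)
  have "(\<integral>\<^sup>+\<omega>. H \<omega> \<partial>clocks n) = (\<integral>\<^sup>+p. H (case p of (y, \<omega>) \<Rightarrow> fun_upd \<omega> (v, 0) y) \<partial>(?R \<Otimes>\<^sub>M clocks n))"
    by (subst upd[symmetric], subst nn_integral_distr) auto
  also have "\<dots> = (\<integral>\<^sup>+y. \<integral>\<^sup>+\<omega>. H (fun_upd \<omega> (v, 0) y) \<partial>clocks n \<partial>?R)"
    by (subst C.nn_integral_fst[symmetric]) (auto intro: measurable_compose[OF upd_m H])
  also have "\<dots> = (\<integral>\<^sup>+y. ennreal (exp (- (real n - 1) * fst y)) * (\<integral>\<^sup>+\<omega>. F (y, \<omega>) \<partial>clocks n) \<partial>?R)"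
  proof (rule nn_integral_cong_AE, use AE_ring_measure_pos in eventually_elim)
    case (elim y)
    have "H (fun_upd \<omega> (v, 0) y) =
        indicator {\<omega>. \<forall>x\<in>{1..n} - {v}. fst y < fst (\<omega> (x, 0))} \<omega> * F (y, advance n v (fst y) \<omega>)" for \<omega>
    proof -
      have "advance n v \<tau> (fun_upd \<omega> (v, 0) y) = advance n v \<tau> \<omega>" for \<tau>
        unfolding advance_def by (rule restrict_ext) (auto split: prod.splits)
      moreover have "rings_first n (fun_upd \<omega> (v, 0) y) v \<longleftrightarrow> (\<forall>x\<in>{1..n} - {v}. fst y < fst (\<omega> (x, 0)))"
        using v by (auto simp: rings_first_def)
      ultimately show ?thesis by (simp add: H_def indicator_def)
    qed
    then show ?case using condition_on_first_ring[OF v, of "fst y" "\<lambda>\<omega>. F (y, \<omega>)"] elim by simp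
  qed
  finally show ?thesis by (simp add: H_def)
qed

lemma measurable_marked_ring:
  assumes "v \<in> {1..n}"
  shows "(\<lambda>\<omega>. (\<omega> (v, 0), advance n v (fst (\<omega> (v, 0))) \<omega>)) \<in> clocks n \<rightarrow>\<^sub>M ring_measure n v \<Otimes>\<^sub>M clocks n"
proof -
  have m[measurable]: "(\<lambda>\<omega>. \<omega> (v, 0)) \<in> clocks n \<rightarrow>\<^sub>M ring_measure n v"
    using assms by (intro measurable_clock) blast
  have [measurable]: "(\<lambda>\<omega>. advance n v (fst (\<omega> (v, 0))) \<omega>) \<in> clocks n \<rightarrow>\<^sub>M clocks n"
    by (intro measurable_advance assms measurable_compose[OF m measurable_fst_ring]) simp
  show ?thesis by measurable
qed

text \<open>
  The default value \<open>1\<close> matters only on a null set; it keeps the shifted outcome in the outcome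
  space everywhere.
\<close>

definition first_ringer :: "nat \<Rightarrow> outcome \<Rightarrow> nat" where
  "first_ringer n \<omega> = (if \<exists>v\<in>{1..n}. rings_first n \<omega> v then LEAST v. rings_first n \<omega> v else 1)"

definition gap :: "nat \<Rightarrow> outcome \<Rightarrow> real" where
  "gap n \<omega> = fst (\<omega> (first_ringer n \<omega>, 0))"

definition first_event :: "nat \<Rightarrow> outcome \<Rightarrow> nat \<times> nat \<times> (nat set \<Rightarrow> nat)" where
  "first_event n \<omega> = (first_ringer n \<omega>, snd (\<omega> (first_ringer n \<omega>, 0)))"

definition later :: "nat \<Rightarrow> outcome \<Rightarrow> outcome" where
  "later n \<omega> = advance n (first_ringer n \<omega>) (gap n \<omega>) \<omega>"

lemma rings_first_unique: "rings_first n \<omega> v \<Longrightarrow> rings_first n \<omega> x \<Longrightarrow> v = x"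
  unfolding rings_first_def by (metis DiffI less_asym' singletonD)

lemma first_ringer_eq: "rings_first n \<omega> v \<Longrightarrow> first_ringer n \<omega> = v"
proof -
  assume v: "rings_first n \<omega> v"
  then have "(LEAST v. rings_first n \<omega> v) = v"
    using rings_first_unique by (metis LeastI)
  moreover have "\<exists>v\<in>{1..n}. rings_first n \<omega> v" using v unfolding rings_first_def by blast
  ultimately show ?thesis by (simp only: first_ringer_def if_True)
qed

lemma first_ringer_in: "1 \<le> n \<Longrightarrow> first_ringer n \<omega> \<in> {1..n}"
proof (cases "\<exists>v\<in>{1..n}. rings_first n \<omega> v")
  case True
  then show ?thesis using first_ringer_eq by blast
qed (simp add: first_ringer_def)

lemma measurable_first_ringer [measurable]: "first_ringer n \<in> clocks n \<rightarrow>\<^sub>M count_space UNIV"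
proof -
  have "Measurable.pred (clocks n) (\<lambda>\<omega>. \<exists>v\<in>{1..n}. rings_first n \<omega> v)"
    by (rule pred_intros_finite(4)) simp_all
  then show ?thesis unfolding first_ringer_def
    by (intro measurable_If measurable_Least pred_rings_first) (simp_all add: pred_def)
qed

text \<open>
  Measurability for each fixed vertex suffices, because there are countably many vertices.
\<close>

lemma measurable_by_first_ringer:
  assumes "1 \<le> n" "\<And>v. v \<in> {1..n} \<Longrightarrow> (\<lambda>\<omega>. f v \<omega>) \<in> clocks n \<rightarrow>\<^sub>M N"
  shows "(\<lambda>\<omega>. f (first_ringer n \<omega>) \<omega>) \<in> clocks n \<rightarrow>\<^sub>M N"
proof -
  define g where "g v = f (if v \<in> {1..n} then v else 1)" for v
  have "(\<lambda>\<omega>. g (first_ringer n \<omega>) \<omega>) \<in> clocks n \<rightarrow>\<^sub>M N"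
  proof (rule measurable_compose_countable[OF _ measurable_first_ringer])
    fix v show "g v \<in> clocks n \<rightarrow>\<^sub>M N"
      unfolding g_def using assms(2)[of v] assms(2)[of 1] assms(1) by (cases "v \<in> {1..n}") simp_all
  qed
  moreover have "g (first_ringer n \<omega>) = f (first_ringer n \<omega>)" for \<omega>
    using first_ringer_in[OF assms(1)] by (simp add: g_def)
  ultimately show ?thesis by simp
qed

lemma measurable_gap [measurable]: "1 \<le> n \<Longrightarrow> gap n \<in> borel_measurable (clocks n)"
  unfolding gap_def
  by (rule measurable_by_first_ringer[where f="\<lambda>v \<omega>. fst (\<omega> (v, 0))"])
     (auto intro!: measurable_compose[OF measurable_clock measurable_fst_ring])

lemma measurable_later: "1 \<le> n \<Longrightarrow> later n \<in> clocks n \<rightarrow>\<^sub>M clocks n"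
  unfolding later_def gap_def
proof (rule measurable_by_first_ringer[where f="\<lambda>v \<omega>. advance n v (fst (\<omega> (v, 0))) \<omega>"])
  fix v assume "v \<in> {1..n}"
  from measurable_compose[OF measurable_marked_ring[OF this] measurable_snd]
  show "(\<lambda>\<omega>. advance n v (fst (\<omega> (v, 0))) \<omega>) \<in> clocks n \<rightarrow>\<^sub>M clocks n" by simp
qed

lemma nn_integral_ring_split:
  assumes [measurable]: "h \<in> borel_measurable borel"
    and Z[measurable]: "Z \<in> sets (count_space UNIV \<Otimes>\<^sub>M count_space UNIV)"
  shows "(\<integral>\<^sup>+y. h (fst y) * indicator Z (snd y) \<partial>ring_measure n v)
    = (\<integral>\<^sup>+s. ennreal (exponential_density 1 s) * h s \<partial>lborel)
      * (\<integral>\<^sup>+m. indicator Z m \<partial>mark_measure n v)"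
proof -
  let ?K = "mark_measure n v"
  have [measurable]: "Z \<in> sets ?K" using Z by (simp cong: sets_pair_measure_cong)
  have m: "(\<lambda>y. h (fst y) * indicator Z (snd y)) \<in> borel_measurable (ring_measure n v)"
    by measurable
  show ?thesis
    by (subst nn_integral_ring_measure[OF m])
       (simp add: nn_integral_cmult nn_integral_multc mult.assoc[symmetric])
qed

text \<open>
  The product of the two exponentials is a multiple of the density with rate \<open>u + 1\<close>.
\<close>

lemma scaled_exponential:
  assumes "0 < l" "0 \<le> u" "l = u + 1"
  shows "(\<integral>\<^sup>+s. ennreal (exponential_density 1 s) * ennreal (exp (- u * s)) \<partial>lborel) = ennreal (1 / l)"
proof -
  have "(\<integral>\<^sup>+s. ennreal (exponential_density 1 s) * ennreal (exp (- u * s)) \<partial>lborel)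
      = (\<integral>\<^sup>+s. ennreal (1 / l) * ennreal (exponential_density l s) \<partial>lborel)"
  proof (rule nn_integral_cong)
    fix s
    show "ennreal (exponential_density 1 s) * ennreal (exp (- u * s)) = ennreal (1 / l) * ennreal (exponential_density l s)"
    proof (cases "s < 0")
      case False
      have "exp (- s) * exp (- u * s) = 1 / l * (l * exp (- s * l))"
      proof -
        have "- s + - u * s = - s * l" using assms(3) by algebra
        then have "exp (- s) * exp (- u * s) = exp (- s * l)" by (metis exp_add)
        then show ?thesis using assms(1) by simp
      qed
      moreover have "exponential_density 1 s = exp (- s)" "exponential_density l s = l * exp (- s * l)"
        using False by (simp_all add: exponential_density_def)
      moreover have "ennreal (exp (- s)) * ennreal (exp (- u * s)) = ennreal (exp (- s) * exp (- u * s))"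
        "ennreal (1 / l) * ennreal (l * exp (- s * l)) = ennreal (1 / l * (l * exp (- s * l)))"
        using assms(1) by (simp_all only: ennreal_mult exp_ge_zero mult_nonneg_nonneg less_imp_le divide_nonneg_nonneg zero_le_one)
      ultimately show ?thesis by metis
    next
      case True
      then have "exponential_density 1 s = 0" "exponential_density l s = 0"
        by (simp_all add: exponential_density_def)
      then show ?thesis by (simp only: ennreal_0 mult_zero_left mult_zero_right)
    qed
  qed
  also have "\<dots> = ennreal (1 / l) * (\<integral>\<^sup>+s. ennreal (exponential_density l s) \<partial>lborel)"
    by (rule nn_integral_cmult) simp
  also have "(\<integral>\<^sup>+s. ennreal (exponential_density l s) \<partial>lborel) = 1"
    using nn_integral_erlang_ith_moment[of l 0 0] assms by simp
  finally show ?thesis by simp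
qed

lemma nn_integral_discount:
  assumes n: "1 \<le> n"
  shows "(\<integral>\<^sup>+s. ennreal (exponential_density 1 s) * ennreal (exp (- (real n - 1) * s)) \<partial>lborel) = ennreal (1 / real n)"
  using n by (intro scaled_exponential) auto

lemma borel_measurable_discount: "(\<lambda>s::real. ennreal (exp (- (real n - 1) * s))) \<in> borel_measurable borel"
  by measurable

lemma emeasure_rings_first:
  assumes v: "v \<in> {1..n}"
  shows "emeasure (clocks n) {\<omega>\<in>space (clocks n). rings_first n \<omega> v} = ennreal (1 / real n)"
proof -
  interpret C: prob_space "clocks n" by (rule prob_space_clocks)
  let ?K = "mark_measure n v"
  interpret K: prob_space ?K
    by (rule prob_space_mark_measure)
  have UN: "UNIV \<in> sets (count_space (UNIV :: nat set) \<Otimes>\<^sub>M count_space (UNIV :: (nat set \<Rightarrow> nat) set))"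
    using sets.top[of "count_space (UNIV :: nat set) \<Otimes>\<^sub>M count_space (UNIV :: (nat set \<Rightarrow> nat) set)"]
    by (simp add: space_pair_measure)
  have "emeasure (clocks n) {\<omega>\<in>space (clocks n). rings_first n \<omega> v} =
      (\<integral>\<^sup>+\<omega>. indicator {\<omega>\<in>space (clocks n). rings_first n \<omega> v} \<omega> \<partial>clocks n)"
    by (rule nn_integral_indicator[symmetric]) measurable
  also have "\<dots> = (\<integral>\<^sup>+\<omega>. indicator {\<omega>. rings_first n \<omega> v} \<omega> * 1 \<partial>clocks n)"
    by (rule nn_integral_cong) (simp add: indicator_def)
  also have "\<dots> = (\<integral>\<^sup>+y. ennreal (exp (- (real n - 1) * fst y)) * indicator UNIV (snd y) \<partial>ring_measure n v)"
    by (subst first_ring_integral[OF v, of "\<lambda>_. 1"]) (simp_all add: C.emeasure_space_1)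
  also have "\<dots> = ennreal (1 / real n) * (\<integral>\<^sup>+m. indicator UNIV m \<partial>?K)"
    unfolding nn_integral_ring_split[OF borel_measurable_discount UN]
    using v by (subst nn_integral_discount) auto
  also have "(\<integral>\<^sup>+m. indicator UNIV m \<partial>?K) = 1"
    using K.emeasure_space_1 by simp
  finally show ?thesis by simp
qed

text \<open>
  The events that a given vertex rings first are disjoint and have probability \<open>1 / n\<close> each. This
  also shows that simultaneous first rings have probability \<open>0\<close>.
\<close>

lemma AE_rings_first:
  assumes n: "1 \<le> n"
  shows "AE \<omega> in clocks n. \<exists>v\<in>{1..n}. rings_first n \<omega> v"
proof -
  interpret C: prob_space "clocks n" by (rule prob_space_clocks)
  let ?E = "\<lambda>v. {\<omega>\<in>space (clocks n). rings_first n \<omega> v}"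
  have E: "?E v \<in> sets (clocks n)" for v by measurable
  have "emeasure (clocks n) (\<Union>v\<in>{1..n}. ?E v) = (\<Sum>v\<in>{1..n}. emeasure (clocks n) (?E v))"
    using E rings_first_unique by (intro sum_emeasure[symmetric]) (auto simp: disjoint_family_on_def)
  also have "\<dots> = (\<Sum>v\<in>{1..n}. ennreal (1 / real n))"
    by (intro sum.cong refl emeasure_rings_first)
  also have "\<dots> = 1" using n
    by (simp add: ennreal_of_nat_eq_real_of_nat ennreal_mult[symmetric])
  also have "(\<Union>v\<in>{1..n}. ?E v) = {\<omega>\<in>space (clocks n). \<exists>v\<in>{1..n}. rings_first n \<omega> v}" by blast
  finally show ?thesis
    using E by (intro C.AE_I_eq_1) auto
qed

text \<open>
  The strong Markov property at the first ring: who rings first, the waiting time and mark of this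
  ring, and the shifted outcome are independent, and the shifted outcome has the original law.
\<close>

lemma first_ring_decomposition:
  assumes n: "1 \<le> n" and F: "\<And>v. v \<in> {1..n} \<Longrightarrow> F v \<in> borel_measurable (ring_measure n v \<Otimes>\<^sub>M clocks n)"
  shows "(\<integral>\<^sup>+\<omega>. F (first_ringer n \<omega>) (\<omega> (first_ringer n \<omega>, 0), later n \<omega>) \<partial>clocks n)
    = (\<Sum>v\<in>{1..n}. \<integral>\<^sup>+y. ennreal (exp (- (real n - 1) * fst y)) * (\<integral>\<^sup>+\<omega>. F v (y, \<omega>) \<partial>clocks n) \<partial>ring_measure n v)"
proof -
  let ?G = "\<lambda>v \<omega>. indicator {\<omega>. rings_first n \<omega> v} \<omega> * F v (\<omega> (v, 0), advance n v (fst (\<omega> (v, 0))) \<omega>) :: ennreal"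
  have G: "?G v \<in> borel_measurable (clocks n)" if "v \<in> {1..n}" for v
  proof (intro borel_measurable_times_ennreal borel_measurable_indicator')
    show "(\<lambda>\<omega>. F v (\<omega> (v, 0), advance n v (fst (\<omega> (v, 0))) \<omega>)) \<in> borel_measurable (clocks n)"
      by (rule measurable_compose[OF measurable_marked_ring[OF that] F[OF that]])
    show "{x \<in> space (clocks n). x \<in> {\<omega>. rings_first n \<omega> v}} \<in> sets (clocks n)" by simp
  qed
  \<comment> \<open>The cases of the first ringer partition the space up to a null set.\<close>
  have "(\<integral>\<^sup>+\<omega>. F (first_ringer n \<omega>) (\<omega> (first_ringer n \<omega>, 0), later n \<omega>) \<partial>clocks n)
    = (\<integral>\<^sup>+\<omega>. (\<Sum>v\<in>{1..n}. ?G v \<omega>) \<partial>clocks n)"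
  proof (rule nn_integral_cong_AE, use AE_rings_first[OF n] in eventually_elim)
    case (elim \<omega>)
    then obtain v where v: "v \<in> {1..n}" "rings_first n \<omega> v" by blast
    have "(\<Sum>x\<in>{1..n}. ?G x \<omega>) = (\<Sum>x\<in>{1..n}. if x = v then ?G v \<omega> else 0)"
      using v rings_first_unique by (intro sum.cong) (auto simp: indicator_def)
    also have "\<dots> = ?G v \<omega>" using v by simp
    finally show ?case using v first_ringer_eq[OF v(2)] by (simp add: later_def gap_def)
  qed
  also have "\<dots> = (\<Sum>v\<in>{1..n}. \<integral>\<^sup>+\<omega>. ?G v \<omega> \<partial>clocks n)"
    using G by (intro nn_integral_sum)
  also have "\<dots> = (\<Sum>v\<in>{1..n}. \<integral>\<^sup>+y. ennreal (exp (- (real n - 1) * fst y)) * (\<integral>\<^sup>+\<omega>. F v (y, \<omega>) \<partial>clocks n) \<partial>ring_measure n v)"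
    by (intro sum.cong refl first_ring_integral F)
  finally show ?thesis .
qed

definition event_pmf :: "nat \<Rightarrow> (nat \<times> nat \<times> (nat set \<Rightarrow> nat)) pmf" where
  "event_pmf n = bind_pmf (pmf_of_set {1..n}) (\<lambda>v. map_pmf (Pair v)
     (pair_pmf (pmf_of_set ({1..n} - {v})) (pmf_of_set (\<Pi>\<^sub>E A \<in> Pow {1..n} - {{}}. A))))"

lemma pmf_bind_Pair:
  "pmf (bind_pmf p (\<lambda>x. map_pmf (Pair x) (q x))) (v, y) = pmf p v * pmf (q v) y"
proof -
  have "pmf (map_pmf (Pair x) (q x)) (v, y) = indicat_real {v} x * pmf (q v) y" for x
  proof (cases "x = v")
    case True
    then show ?thesis using pmf_map_inj'[of "Pair v" "q v" y] by (simp add: inj_on_def)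
  next
    case False
    then have "(v, y) \<notin> set_pmf (map_pmf (Pair x) (q x))" by auto
    then have "pmf (map_pmf (Pair x) (q x)) (v, y) = 0" unfolding set_pmf_iff by blast
    then show ?thesis using False by simp
  qed
  then show ?thesis unfolding pmf_bind by (simp add: pmf.rep_eq)
qed

lemma
  assumes n: "1 \<le> n" and X: "X \<in> sets (clocks n)"
  shows first_event_sets: "{\<omega>\<in>space (clocks n). first_event n \<omega> = e \<and> later n \<omega> \<in> X} \<in> sets (clocks n)" (is "?S \<in> _")
    and first_event_law: "emeasure (clocks n) {\<omega>\<in>space (clocks n). first_event n \<omega> = e \<and> later n \<omega> \<in> X}
    = ennreal (pmf (event_pmf n) e) * emeasure (clocks n) X"
proof -
  obtain v w c where e: "e = (v, w, c)" by (cases e) auto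
  have wc: "{(w, c)} \<in> sets (count_space UNIV \<Otimes>\<^sub>M count_space UNIV)"
  proof -
    have "{w} \<times> {c} \<in> sets (count_space UNIV \<Otimes>\<^sub>M count_space UNIV)" by (rule pair_measureI) auto
    then show ?thesis by simp
  qed
  have snd_ring: "snd \<in> ring_measure n v \<rightarrow>\<^sub>M count_space UNIV \<Otimes>\<^sub>M count_space UNIV"
    by (simp cong: measurable_cong_sets add: sets_ring_measure)
  \<comment> \<open>The indicator of the event, with the first ringer as a parameter.\<close>
  define F :: "nat \<Rightarrow> (real \<times> nat \<times> (nat set \<Rightarrow> nat)) \<times> outcome \<Rightarrow> ennreal"
    where "F x p = (if x = v then indicator {(w, c)} (snd (fst p)) * indicator X (snd p) else 0)" for x p
  have F: "F x \<in> borel_measurable (ring_measure n x \<Otimes>\<^sub>M clocks n)" for x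
  proof (cases "x = v")
    case True
    have "(\<lambda>p. indicator {(w, c)} (snd (fst p)) * indicator X (snd p) :: ennreal) \<in> borel_measurable (ring_measure n v \<Otimes>\<^sub>M clocks n)"
    proof (intro borel_measurable_times_ennreal)
      show "(\<lambda>p. indicator X (snd p) :: ennreal) \<in> borel_measurable (ring_measure n v \<Otimes>\<^sub>M clocks n)"
        by (rule measurable_compose[OF measurable_snd borel_measurable_indicator[OF X]])
      from measurable_compose[OF measurable_compose[OF measurable_fst snd_ring] borel_measurable_indicator[OF wc]]
      show "(\<lambda>p. indicator {(w, c)} (snd (fst p)) :: ennreal) \<in> borel_measurable (ring_measure n v \<Otimes>\<^sub>M clocks n)" .
    qed
    then show ?thesis using True by (simp add: F_def[abs_def])
  qed (simp add: F_def[abs_def])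
  have Fe: "F (first_ringer n \<omega>) (\<omega> (first_ringer n \<omega>, 0), later n \<omega>) = indicator ?S \<omega>"
    if "\<omega> \<in> space (clocks n)" for \<omega>
    using that by (auto simp: F_def first_event_def e indicator_def)
  have Fm: "(\<lambda>\<omega>. F (first_ringer n \<omega>) (\<omega> (first_ringer n \<omega>, 0), later n \<omega>)) \<in> borel_measurable (clocks n)"
    unfolding later_def gap_def
    by (rule measurable_by_first_ringer[OF n, where f="\<lambda>v \<omega>. F v (\<omega> (v, 0), advance n v (fst (\<omega> (v, 0))) \<omega>)"])
       (rule measurable_compose[OF measurable_marked_ring F])
  then have "(indicator ?S :: _ \<Rightarrow> ennreal) \<in> borel_measurable (clocks n)"
    using Fe by (simp cong: measurable_cong)
  then have "?S \<inter> space (clocks n) \<in> sets (clocks n)"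
    by (simp only: borel_measurable_indicator_iff)
  moreover have "?S \<inter> space (clocks n) = ?S" by blast
  ultimately show S: "?S \<in> sets (clocks n)" by simp
  have "emeasure (clocks n) ?S = (\<integral>\<^sup>+\<omega>. F (first_ringer n \<omega>) (\<omega> (first_ringer n \<omega>, 0), later n \<omega>) \<partial>clocks n)"
    using Fe by (subst nn_integral_indicator[OF S, symmetric]) (intro nn_integral_cong, simp)
  also have "\<dots> = (\<Sum>x\<in>{1..n}. \<integral>\<^sup>+y. ennreal (exp (- (real n - 1) * fst y)) * (\<integral>\<^sup>+\<omega>. F x (y, \<omega>) \<partial>clocks n) \<partial>ring_measure n x)"
    by (rule first_ring_decomposition[OF n F])
  also have "\<dots> = (\<Sum>x\<in>{1..n}. if x = v then ennreal (pmf (event_pmf n) e * real n) * ennreal (1 / real n) * emeasure (clocks n) X else 0)"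
  proof (intro sum.cong refl)
    fix x assume x: "x \<in> {1..n}"
    show "(\<integral>\<^sup>+y. ennreal (exp (- (real n - 1) * fst y)) * (\<integral>\<^sup>+\<omega>. F x (y, \<omega>) \<partial>clocks n) \<partial>ring_measure n x)
      = (if x = v then ennreal (pmf (event_pmf n) e * real n) * ennreal (1 / real n) * emeasure (clocks n) X else 0)"
    proof (cases "x = v")
      case True
      have inner: "(\<integral>\<^sup>+\<omega>. F v (y, \<omega>) \<partial>clocks n) = indicator {(w, c)} (snd y) * emeasure (clocks n) X" for y
        using X by (simp add: F_def nn_integral_cmult)
      have "(\<integral>\<^sup>+y. ennreal (exp (- (real n - 1) * fst y)) * (\<integral>\<^sup>+\<omega>. F x (y, \<omega>) \<partial>clocks n) \<partial>ring_measure n x)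
        = (\<integral>\<^sup>+y. (ennreal (exp (- (real n - 1) * fst y)) * indicator {(w, c)} (snd y)) * emeasure (clocks n) X \<partial>ring_measure n v)"
        unfolding True inner mult.assoc by (rule refl)
      also have "\<dots> = (\<integral>\<^sup>+y. ennreal (exp (- (real n - 1) * fst y)) * indicator {(w, c)} (snd y) \<partial>ring_measure n v) * emeasure (clocks n) X"
      proof (rule nn_integral_multc)
        show "(\<lambda>y. ennreal (exp (- (real n - 1) * fst y)) * indicator {(w, c)} (snd y)) \<in> borel_measurable (ring_measure n v)"
          by (intro borel_measurable_times_ennreal measurable_compose[OF measurable_fst_ring borel_measurable_discount]
                measurable_compose[OF snd_ring borel_measurable_indicator[OF wc]])
      qed
      also have "(\<integral>\<^sup>+y. ennreal (exp (- (real n - 1) * fst y)) * indicator {(w, c)} (snd y) \<partial>ring_measure n v)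
        = ennreal (1 / real n) * (\<integral>\<^sup>+m. indicator {(w, c)} m \<partial>mark_measure n v)"
        unfolding nn_integral_ring_split[OF borel_measurable_discount wc] nn_integral_discount[OF n] by (rule refl)
      also have "(\<integral>\<^sup>+m. indicator {(w, c)} m \<partial>mark_measure n v) = ennreal (pmf (event_pmf n) e * real n)"
      proof -
        have "{(w, c)} \<in> sets (mark_measure n v)" using wc sets_mark_measure by simp
        then have "(\<integral>\<^sup>+m. indicator {(w, c)} m \<partial>mark_measure n v) = emeasure (mark_measure n v) ({w} \<times> {c})"
          by (subst nn_integral_indicator) simp_all
        also have "\<dots> = ennreal (pmf (pmf_of_set ({1..n} - {v})) w) * ennreal (pmf (pmf_of_set (\<Pi>\<^sub>E A \<in> Pow {1..n} - {{}}. A)) c)"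
          unfolding mark_measure_def
          by (subst measure_pmf.emeasure_pair_measure_Times) (simp_all add: emeasure_pmf_single)
        also have "\<dots> = ennreal (pmf (event_pmf n) e * real n)"
        proof -
          have "pmf (event_pmf n) e = 1 / real n * (pmf (pmf_of_set ({1..n} - {v})) w * pmf (pmf_of_set (\<Pi>\<^sub>E A \<in> Pow {1..n} - {{}}. A)) c)"
            unfolding event_pmf_def e pmf_bind_Pair using n x True by (simp add: pmf_pair)
          then show ?thesis using n by (simp add: ennreal_mult')
        qed
        finally show ?thesis .
      qed
      finally show ?thesis using True by (simp add: mult_ac)
    next
      case False
      then show ?thesis by (simp add: F_def)
    qed
  qed
  also have "\<dots> = (if v \<in> {1..n} then ennreal (pmf (event_pmf n) e * real n) * ennreal (1 / real n) * emeasure (clocks n) X else 0)"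
    by simp
  also have "\<dots> = ennreal (pmf (event_pmf n) e) * emeasure (clocks n) X"
  proof (cases "v \<in> {1..n}")
    case True
    have "ennreal (pmf (event_pmf n) e * real n) * ennreal (1 / real n) = ennreal (pmf (event_pmf n) e)"
      using n by (subst ennreal_mult[symmetric]) simp_all
    then show ?thesis using True by simp
  next
    case False
    have "pmf (event_pmf n) e = 0"
      unfolding event_pmf_def e pmf_bind_Pair using n False by simp
    then show ?thesis using False by simp
  qed
  finally show "emeasure (clocks n) ?S = ennreal (pmf (event_pmf n) e) * emeasure (clocks n) X" .
qed

section \<open>The sequence of rings and its law\<close>

text \<open>
  The special case of functions of the first ring time and of the shifted outcome.
\<close>

lemma nn_integral_gap_later:
  assumes n: "1 \<le> n" and h[measurable]: "h \<in> borel_measurable borel" and G: "G \<in> borel_measurable (clocks n)"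
  shows "(\<integral>\<^sup>+\<omega>. h (gap n \<omega>) * G (later n \<omega>) \<partial>clocks n)
    = of_nat n * (\<integral>\<^sup>+s. ennreal (exponential_density 1 s) * (ennreal (exp (- (real n - 1) * s)) * h s) \<partial>lborel)
        * (\<integral>\<^sup>+\<omega>. G \<omega> \<partial>clocks n)"
proof -
  have UN: "UNIV \<in> sets (count_space (UNIV :: nat set) \<Otimes>\<^sub>M count_space (UNIV :: (nat set \<Rightarrow> nat) set))"
    using sets.top[of "count_space (UNIV :: nat set) \<Otimes>\<^sub>M count_space (UNIV :: (nat set \<Rightarrow> nat) set)"]
    by (simp add: space_pair_measure)
  define k where "k s = ennreal (exp (- (real n - 1) * s)) * h s" for s
  have k: "k \<in> borel_measurable borel"
    unfolding k_def by (intro borel_measurable_times_ennreal borel_measurable_discount h)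
  have Fm: "(\<lambda>p. h (fst (fst p)) * G (snd p)) \<in> borel_measurable (ring_measure n v \<Otimes>\<^sub>M clocks n)" for v
    by (intro borel_measurable_times_ennreal measurable_compose[OF measurable_snd G]
         measurable_compose[OF measurable_compose[OF measurable_fst measurable_fst_ring] h])
  have "(\<integral>\<^sup>+\<omega>. h (gap n \<omega>) * G (later n \<omega>) \<partial>clocks n)
    = (\<Sum>v\<in>{1..n}. \<integral>\<^sup>+y. ennreal (exp (- (real n - 1) * fst y)) * (\<integral>\<^sup>+\<omega>. h (fst y) * G \<omega> \<partial>clocks n) \<partial>ring_measure n v)"
    using first_ring_decomposition[OF n Fm] by (simp only: fst_conv snd_conv gap_def)
  also have "\<dots> = (\<Sum>v\<in>{1..n}. (\<integral>\<^sup>+s. ennreal (exponential_density 1 s) * k s \<partial>lborel) * (\<integral>\<^sup>+\<omega>. G \<omega> \<partial>clocks n))"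
  proof (intro sum.cong refl)
    fix v
    interpret K: prob_space "mark_measure n v" by (rule prob_space_mark_measure)
    have m: "(\<lambda>y. k (fst y)) \<in> borel_measurable (ring_measure n v)"
      by (rule measurable_compose[OF measurable_fst_ring k])
    have "(\<integral>\<^sup>+y. ennreal (exp (- (real n - 1) * fst y)) * (\<integral>\<^sup>+\<omega>. h (fst y) * G \<omega> \<partial>clocks n) \<partial>ring_measure n v)
      = (\<integral>\<^sup>+y. k (fst y) * (\<integral>\<^sup>+\<omega>. G \<omega> \<partial>clocks n) \<partial>ring_measure n v)"
      unfolding k_def using G by (simp only: nn_integral_cmult mult.assoc)
    also have "\<dots> = (\<integral>\<^sup>+y. k (fst y) \<partial>ring_measure n v) * (\<integral>\<^sup>+\<omega>. G \<omega> \<partial>clocks n)"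
      by (rule nn_integral_multc[OF m])
    also have "(\<integral>\<^sup>+y. k (fst y) \<partial>ring_measure n v) = (\<integral>\<^sup>+y. k (fst y) * indicator UNIV (snd y) \<partial>ring_measure n v)"
      by (simp only: indicator_UNIV mult_1_right)
    also have "\<dots> = (\<integral>\<^sup>+s. ennreal (exponential_density 1 s) * k s \<partial>lborel) * (\<integral>\<^sup>+m. indicator UNIV m \<partial>mark_measure n v)"
      by (rule nn_integral_ring_split[OF k UN])
    also have "(\<integral>\<^sup>+m. indicator UNIV m \<partial>mark_measure n v) = 1"
      using K.emeasure_space_1 by simp
    finally show "(\<integral>\<^sup>+y. ennreal (exp (- (real n - 1) * fst y)) * (\<integral>\<^sup>+\<omega>. h (fst y) * G \<omega> \<partial>clocks n) \<partial>ring_measure n v)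
      = (\<integral>\<^sup>+s. ennreal (exponential_density 1 s) * k s \<partial>lborel) * (\<integral>\<^sup>+\<omega>. G \<omega> \<partial>clocks n)" by simp
  qed
  finally show ?thesis by (simp add: k_def mult.assoc)
qed

lemma nn_integral_later:
  assumes n: "1 \<le> n" and G: "G \<in> borel_measurable (clocks n)"
  shows "(\<integral>\<^sup>+\<omega>. G (later n \<omega>) \<partial>clocks n) = (\<integral>\<^sup>+\<omega>. G \<omega> \<partial>clocks n)"
proof -
  have "of_nat n * ennreal (1 / real n) = 1"
    using n by (simp add: ennreal_of_nat_eq_real_of_nat ennreal_mult[symmetric])
  then show ?thesis
    using nn_integral_gap_later[OF n borel_measurable_const G, of 1] nn_integral_discount[OF n] by simp
qed

lemma distr_later: "1 \<le> n \<Longrightarrow> distr (clocks n) (clocks n) (later n) = clocks n"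
proof (rule measure_eqI)
  fix A assume n: "1 \<le> n" and "A \<in> sets (distr (clocks n) (clocks n) (later n))"
  then have A: "A \<in> sets (clocks n)" by simp
  have "emeasure (distr (clocks n) (clocks n) (later n)) A = (\<integral>\<^sup>+\<omega>. indicator A \<omega> \<partial>distr (clocks n) (clocks n) (later n))"
    using A by simp
  also have "\<dots> = (\<integral>\<^sup>+\<omega>. indicator A (later n \<omega>) \<partial>clocks n)"
    using A measurable_later[OF n] by (intro nn_integral_distr) auto
  also have "\<dots> = emeasure (clocks n) A" using A nn_integral_later[OF n, of "indicator A"] by simp
  finally show "emeasure (distr (clocks n) (clocks n) (later n)) A = emeasure (clocks n) A" .
qed simp

lemma AE_later:
  assumes n: "1 \<le> n" and "AE \<omega> in clocks n. P \<omega>"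
  shows "AE \<omega> in clocks n. P (later n \<omega>)"
  by (rule AE_distrD[OF measurable_later[OF n]]) (unfold distr_later[OF n], rule assms)

lemma AE_later_funpow:
  assumes n: "1 \<le> n" and "AE \<omega> in clocks n. P \<omega>"
  shows "AE \<omega> in clocks n. P ((later n ^^ m) \<omega>)"
proof (induction m)
  case (Suc m)
  from AE_later[OF n this] show ?case by (simp only: funpow_Suc_right o_apply)
qed (use assms in simp)

primrec event_list :: "nat \<Rightarrow> nat \<Rightarrow> outcome \<Rightarrow> (nat \<times> nat \<times> (nat set \<Rightarrow> nat)) list" where
  "event_list n 0 \<omega> = []"
| "event_list n (Suc m) \<omega> = first_event n \<omega> # event_list n m (later n \<omega>)"

primrec arrival :: "nat \<Rightarrow> nat \<Rightarrow> outcome \<Rightarrow> real" where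
  "arrival n 0 \<omega> = 0"
| "arrival n (Suc m) \<omega> = gap n \<omega> + arrival n m (later n \<omega>)"

lemma pmf_replicate_Cons:
  "pmf (replicate_pmf (Suc m) p) (x # xs) = pmf p x * pmf (replicate_pmf m p) xs"
proof -
  have "replicate_pmf (Suc m) p = map_pmf (\<lambda>(x, xs). x # xs) (pair_pmf p (replicate_pmf m p))"
    by (simp add: pair_pmf_def map_bind_pmf)
  moreover have "pmf (map_pmf (\<lambda>(x, xs). x # xs) (pair_pmf p (replicate_pmf m p))) ((\<lambda>(x, xs). x # xs) (x, xs))
      = pmf (pair_pmf p (replicate_pmf m p)) (x, xs)"
    by (rule pmf_map_inj') (auto simp: inj_on_def)
  ultimately show ?thesis by (simp add: pmf_pair)
qed

lemma event_list_point:
  assumes n: "1 \<le> n"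
  shows "{\<omega>\<in>space (clocks n). event_list n (length es) \<omega> = es} \<in> sets (clocks n) \<and>
    emeasure (clocks n) {\<omega>\<in>space (clocks n). event_list n (length es) \<omega> = es}
      = ennreal (pmf (replicate_pmf (length es) (event_pmf n)) es)"
proof (induction es)
  case Nil
  interpret C: prob_space "clocks n" by (rule prob_space_clocks)
  show ?case by (simp add: C.emeasure_space_1)
next
  case (Cons e es)
  let ?X = "{\<omega>\<in>space (clocks n). event_list n (length es) \<omega> = es}"
  have "{\<omega>\<in>space (clocks n). event_list n (length (e # es)) \<omega> = e # es}
      = {\<omega>\<in>space (clocks n). first_event n \<omega> = e \<and> later n \<omega> \<in> ?X}"
    using measurable_space[OF measurable_later[OF n]] by auto
  then show ?case
    using first_event_sets[OF n, of ?X e] first_event_law[OF n, of ?X e] Cons.IH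
    by (simp only: length_Cons pmf_replicate_Cons) (simp add: ennreal_mult')
qed

lemma finite_choices: fixes n :: nat shows "finite (\<Pi>\<^sub>E A \<in> Pow {1..n} - {{}}. A)"
proof (rule finite_PiE)
  show "finite (Pow {1..n} - {{}})" by simp
  fix A assume "A \<in> Pow {1..n} - {{}}"
  then show "finite A" using finite_subset[of A "{1..n}"] finite_atLeastAtMost by blast
qed

lemma choices_nonempty: fixes n :: nat shows "(\<Pi>\<^sub>E A \<in> Pow {1..n} - {{}}. A) \<noteq> {}"
  by (simp add: PiE_eq_empty_iff)

lemma set_event_pmf:
  assumes "2 \<le> n"
  shows "set_pmf (event_pmf n) = (SIGMA v:{1..n}. ({1..n} - {v}) \<times> (\<Pi>\<^sub>E A \<in> Pow {1..n} - {{}}. A))"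
proof -
  have ne: "{1..n} - {v} \<noteq> {}" for v
  proof -
    have "card {v} < card {1..n}" using assms by simp
    then show ?thesis using card_mono[of "{v}" "{1..n}"] by (meson Diff_eq_empty_iff finite.emptyI finite_insert not_less)
  qed
  have s1: "set_pmf (pmf_of_set ({1..n} - {v})) = {1..n} - {v}" for v
    by (rule set_pmf_of_set[OF ne]) simp
  have s2: "set_pmf (pmf_of_set {1..n}) = {1..n}" using assms by (intro set_pmf_of_set) simp_all
  show ?thesis
    unfolding event_pmf_def set_bind_pmf set_map_pmf set_pair_pmf s1 s2 set_pmf_of_set[OF choices_nonempty finite_choices]
    by blast
qed

lemma finite_set_event_pmf: "2 \<le> n \<Longrightarrow> finite (set_pmf (event_pmf n))"
  by (simp only: set_event_pmf) (intro finite_SigmaI finite_cartesian_product finite_choices, simp_all)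

lemma finite_set_replicate_event_pmf: "2 \<le> n \<Longrightarrow> finite (set_pmf (replicate_pmf m (event_pmf n)))"
  unfolding set_replicate_pmf using finite_lists_length_eq[OF finite_set_event_pmf, of n m]
  by (auto elim!: rev_finite_subset simp: lists_eq_set)

lemma event_list_sets:
  assumes "2 \<le> n"
  shows "{\<omega>\<in>space (clocks n). event_list n m \<omega> \<in> X \<inter> set_pmf (replicate_pmf m (event_pmf n))} \<in> sets (clocks n)" (is "?A \<in> _")
    and "emeasure (clocks n) {\<omega>\<in>space (clocks n). event_list n m \<omega> \<in> X \<inter> set_pmf (replicate_pmf m (event_pmf n))}
      = ennreal (measure_pmf.prob (replicate_pmf m (event_pmf n)) X)"
proof -
  let ?R = "replicate_pmf m (event_pmf n)"
  let ?F = "X \<inter> set_pmf ?R"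
  let ?E = "\<lambda>es. {\<omega>\<in>space (clocks n). event_list n m \<omega> = es}"
  have n: "1 \<le> n" using assms by simp
  have fin: "finite ?F" using finite_set_replicate_event_pmf[OF assms] by blast
  have len: "length es = m" if "es \<in> ?F" for es using that by (simp add: set_replicate_pmf)
  have A: "?A = (\<Union>es\<in>?F. ?E es)" by blast
  have E: "?E es \<in> sets (clocks n)" "emeasure (clocks n) (?E es) = ennreal (pmf ?R es)" if "es \<in> ?F" for es
    using event_list_point[OF n, of es] len[OF that] by simp_all
  show "?A \<in> sets (clocks n)" unfolding A by (rule sets.finite_UN[OF fin E(1)])
  have "emeasure (clocks n) ?A = (\<Sum>es\<in>?F. emeasure (clocks n) (?E es))"
    unfolding A using fin E by (intro sum_emeasure[symmetric]) (auto simp: disjoint_family_on_def)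
  also have "\<dots> = (\<Sum>es\<in>?F. ennreal (pmf ?R es))" using E by (intro sum.cong) auto
  also have "\<dots> = ennreal (\<Sum>es\<in>?F. pmf ?R es)" by (rule sum_ennreal) simp
  also have "(\<Sum>es\<in>?F. pmf ?R es) = measure_pmf.prob ?R ?F"
    by (rule measure_measure_pmf_finite[OF fin, symmetric])
  also have "\<dots> = measure_pmf.prob ?R X"
    by (rule measure_Int_set_pmf)
  finally show "emeasure (clocks n) ?A = ennreal (measure_pmf.prob ?R X)" .
qed

lemma AE_event_list_possible:
  assumes "2 \<le> n"
  shows "AE \<omega> in clocks n. event_list n m \<omega> \<in> set_pmf (replicate_pmf m (event_pmf n))"
proof -
  interpret C: prob_space "clocks n" by (rule prob_space_clocks)
  show ?thesis
    using event_list_sets[OF assms, of m UNIV] by (intro C.AE_I_eq_1) auto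
qed

lemma measurable_arrival: "1 \<le> n \<Longrightarrow> arrival n m \<in> borel_measurable (clocks n)"
proof (induction m)
  case (Suc m)
  then have "(\<lambda>\<omega>. arrival n m (later n \<omega>)) \<in> borel_measurable (clocks n)"
    by (intro measurable_compose[OF measurable_later])
  then have "(\<lambda>\<omega>. gap n \<omega> + arrival n m (later n \<omega>)) \<in> borel_measurable (clocks n)"
    using Suc.prems by (intro borel_measurable_add measurable_gap)
  moreover have "arrival n (Suc m) = (\<lambda>\<omega>. gap n \<omega> + arrival n m (later n \<omega>))"
    by (rule ext) simp
  ultimately show ?case by simp
next
  case 0
  have "arrival n 0 = (\<lambda>_. 0)" by (rule ext) simp
  then show ?case by simp
qed

text \<open>
  The gaps between consecutive rings are independent and exponential with rate \<open>n\<close>, and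
  \<open>E (exp (- n * gap)) = 1 / 2\<close>.
\<close>

lemma nn_integral_exp_arrival:
  assumes n: "1 \<le> n"
  shows "(\<integral>\<^sup>+\<omega>. ennreal (exp (- real n * arrival n m \<omega>)) \<partial>clocks n) = ennreal ((1 / 2) ^ m)"
proof (induction m)
  case 0
  interpret C: prob_space "clocks n" by (rule prob_space_clocks)
  show ?case by (simp add: C.emeasure_space_1)
next
  case (Suc m)
  let ?h = "\<lambda>s. ennreal (exp (- real n * s))"
  have h: "?h \<in> borel_measurable borel" by measurable
  have G: "(\<lambda>\<omega>. ?h (arrival n m \<omega>)) \<in> borel_measurable (clocks n)"
    by (rule measurable_compose[OF measurable_arrival[OF n] h])
  have "(\<integral>\<^sup>+\<omega>. ?h (arrival n (Suc m) \<omega>) \<partial>clocks n) = (\<integral>\<^sup>+\<omega>. ?h (gap n \<omega>) * ?h (arrival n m (later n \<omega>)) \<partial>clocks n)"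
    by (simp only: arrival.simps distrib_left exp_add ennreal_mult exp_ge_zero)
  also have "\<dots> = of_nat n * (\<integral>\<^sup>+s. ennreal (exponential_density 1 s) * (ennreal (exp (- (real n - 1) * s)) * ?h s) \<partial>lborel)
        * (\<integral>\<^sup>+\<omega>. ?h (arrival n m \<omega>) \<partial>clocks n)"
    by (rule nn_integral_gap_later[OF n h G])
  also have "(\<integral>\<^sup>+s. ennreal (exponential_density 1 s) * (ennreal (exp (- (real n - 1) * s)) * ?h s) \<partial>lborel)
      = (\<integral>\<^sup>+s. ennreal (exponential_density 1 s) * ennreal (exp (- (2 * real n - 1) * s)) \<partial>lborel)"
  proof -
    have "- (real n - 1) * s + - real n * s = - (2 * real n - 1) * s" for s by algebra
    then have "ennreal (exp (- (real n - 1) * s)) * ?h s = ennreal (exp (- (2 * real n - 1) * s))" for s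
      by (metis ennreal_mult exp_add exp_ge_zero)
    then show ?thesis by presburger
  qed
  also have "\<dots> = ennreal (1 / (2 * real n))"
    using n by (intro scaled_exponential) auto
  also have "of_nat n * ennreal (1 / (2 * real n)) = ennreal (1 / 2)"
    using n by (simp add: ennreal_of_nat_eq_real_of_nat ennreal_mult[symmetric])
  also have "(\<integral>\<^sup>+\<omega>. ?h (arrival n m \<omega>) \<partial>clocks n) = ennreal ((1 / 2) ^ m)" by (rule Suc.IH)
  also have "ennreal (1 / 2) * ennreal ((1 / 2) ^ m) = ennreal ((1 / 2) ^ Suc m)"
    by (subst ennreal_mult[symmetric]) simp_all
  finally show ?case .
qed

text \<open>
  Each gap has expectation \<open>1 / n\<close>. The inequality is enough below, and it avoids a separate
  treatment of the null set where gaps are negative.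
\<close>

lemma nn_integral_arrival_le:
  assumes n: "1 \<le> n"
  shows "(\<integral>\<^sup>+\<omega>. ennreal (arrival n m \<omega>) \<partial>clocks n) \<le> ennreal (real m / real n)"
proof (induction m)
  case (Suc m)
  have m1: "(\<lambda>\<omega>. ennreal (gap n \<omega>)) \<in> borel_measurable (clocks n)"
    using measurable_gap[OF n] by simp
  have m2: "(\<lambda>\<omega>. ennreal (arrival n m \<omega>)) \<in> borel_measurable (clocks n)"
    using measurable_arrival[OF n] by simp
  have m3: "(\<lambda>\<omega>. ennreal (arrival n m (later n \<omega>))) \<in> borel_measurable (clocks n)"
    by (rule measurable_compose[OF measurable_later[OF n] m2])
  interpret C: prob_space "clocks n" by (rule prob_space_clocks)
  have "(\<integral>\<^sup>+\<omega>. ennreal (gap n \<omega>) \<partial>clocks n) = (\<integral>\<^sup>+\<omega>. ennreal (gap n \<omega>) * 1 \<partial>clocks n)" by simp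
  also have "\<dots> = of_nat n * (\<integral>\<^sup>+s. ennreal (exponential_density 1 s) * (ennreal (exp (- (real n - 1) * s)) * ennreal s) \<partial>lborel)"
    using nn_integral_gap_later[OF n measurable_ennreal, of "\<lambda>_. 1"] C.emeasure_space_1 by simp
  also have "(\<integral>\<^sup>+s. ennreal (exponential_density 1 s) * (ennreal (exp (- (real n - 1) * s)) * ennreal s) \<partial>lborel)
      = (\<integral>\<^sup>+s. ennreal (1 / real n) * ennreal (exponential_density n s * s ^ 1) \<partial>lborel)"
  proof (rule nn_integral_cong)
    fix s
    show "ennreal (exponential_density 1 s) * (ennreal (exp (- (real n - 1) * s)) * ennreal s)
        = ennreal (1 / real n) * ennreal (exponential_density n s * s ^ 1)"
    proof (cases "s < 0")
      case True
      then have "exponential_density 1 s = 0" "exponential_density n s = 0"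
        by (simp_all add: exponential_density_def)
      then show ?thesis by (simp only: ennreal_0 mult_zero_left mult_zero_right)
    next
      case False
      have "- s + - (real n - 1) * s = - s * real n" by algebra
      then have "exp (- s) * exp (- (real n - 1) * s) = exp (- s * real n)" by (metis exp_add)
      then have e: "exp (- s) * (exp (- (real n - 1) * s) * s) = 1 / real n * (real n * exp (- s * real n) * s ^ 1)"
        using n by (simp only: mult.assoc[symmetric]) simp
      have d: "exponential_density 1 s = exp (- s)" "exponential_density n s = real n * exp (- s * real n)"
        using False by (simp_all add: exponential_density_def)
      have "ennreal (exp (- s)) * (ennreal (exp (- (real n - 1) * s)) * ennreal s) = ennreal (exp (- s) * (exp (- (real n - 1) * s) * s))"
        using False by (simp only: ennreal_mult exp_ge_zero mult_nonneg_nonneg not_less)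
      also have "\<dots> = ennreal (1 / real n) * ennreal (real n * exp (- s * real n) * s ^ 1)"
        unfolding e using False by (intro ennreal_mult) simp_all
      finally show ?thesis unfolding d .
    qed
  qed
  also have "\<dots> = ennreal (1 / real n) * (\<integral>\<^sup>+s. ennreal (exponential_density n s * s ^ 1) \<partial>lborel)"
    by (rule nn_integral_cmult) simp
  also have "(\<integral>\<^sup>+s. ennreal (exponential_density n s * s ^ 1) \<partial>lborel) = ennreal (1 / real n)"
    using nn_integral_erlang_ith_moment[of "real n" 0 1] n by simp
  also have "of_nat n * (ennreal (1 / real n) * ennreal (1 / real n)) = ennreal (1 / real n)"
    using n by (simp add: ennreal_of_nat_eq_real_of_nat ennreal_mult[symmetric])
  finally have gap: "(\<integral>\<^sup>+\<omega>. ennreal (gap n \<omega>) \<partial>clocks n) = ennreal (1 / real n)" .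
  have "(\<integral>\<^sup>+\<omega>. ennreal (arrival n (Suc m) \<omega>) \<partial>clocks n)
      \<le> (\<integral>\<^sup>+\<omega>. ennreal (gap n \<omega>) + ennreal (arrival n m (later n \<omega>)) \<partial>clocks n)"
  proof (rule nn_integral_mono)
    fix \<omega>
    have "ennreal (x + y) \<le> ennreal x + ennreal y" for x y :: real
    proof -
      have "ennreal (x + y) \<le> ennreal (max 0 x + max 0 y)" by (rule ennreal_leI) simp
      also have "\<dots> = ennreal x + ennreal y" by (subst ennreal_plus) simp_all
      finally show ?thesis .
    qed
    then show "ennreal (arrival n (Suc m) \<omega>) \<le> ennreal (gap n \<omega>) + ennreal (arrival n m (later n \<omega>))" by simp
  qed
  also have "\<dots> = (\<integral>\<^sup>+\<omega>. ennreal (gap n \<omega>) \<partial>clocks n) + (\<integral>\<^sup>+\<omega>. ennreal (arrival n m (later n \<omega>)) \<partial>clocks n)"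
    by (rule nn_integral_add[OF m1 m3])
  also have "\<dots> = ennreal (1 / real n) + (\<integral>\<^sup>+\<omega>. ennreal (arrival n m \<omega>) \<partial>clocks n)"
    unfolding gap nn_integral_later[OF n m2] by (rule refl)
  also have "\<dots> \<le> ennreal (1 / real n) + ennreal (real m / real n)"
    by (rule add_left_mono[OF Suc.IH])
  also have "\<dots> = ennreal (real (Suc m) / real n)"
    by (subst ennreal_plus[symmetric]) (simp_all add: add_divide_distrib)
  finally show ?case .
qed simp

text \<open>
  A Chernoff bound.
\<close>

lemma emeasure_arrival_le:
  assumes n: "1 \<le> n"
  shows "emeasure (clocks n) {\<omega>\<in>space (clocks n). arrival n m \<omega> \<le> t} \<le> ennreal (exp (real n * t) * (1 / 2) ^ m)"
proof -
  let ?A = "{\<omega>\<in>space (clocks n). arrival n m \<omega> \<le> t}"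
  have A: "?A \<in> sets (clocks n)" using measurable_arrival[OF n, of m] by simp
  have "emeasure (clocks n) ?A = (\<integral>\<^sup>+\<omega>. indicator ?A \<omega> \<partial>clocks n)" using A by simp
  also have "\<dots> \<le> (\<integral>\<^sup>+\<omega>. ennreal (exp (real n * t)) * ennreal (exp (- real n * arrival n m \<omega>)) \<partial>clocks n)"
  proof (rule nn_integral_mono)
    fix \<omega>
    show "indicator ?A \<omega> \<le> ennreal (exp (real n * t)) * ennreal (exp (- real n * arrival n m \<omega>))"
    proof (cases "\<omega> \<in> ?A")
      case True
      then have "real n * arrival n m \<omega> \<le> real n * t" by (intro mult_left_mono) auto
      then have "1 \<le> exp (real n * t + - real n * arrival n m \<omega>)" by (subst one_le_exp_iff) linarith
      then have "1 \<le> ennreal (exp (real n * t) * exp (- real n * arrival n m \<omega>))"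
        unfolding exp_add by (metis ennreal_1 ennreal_leI)
      then show ?thesis using True by (simp only: ennreal_mult exp_ge_zero indicator_simps)
    qed simp
  qed
  also have "\<dots> = ennreal (exp (real n * t)) * ennreal ((1 / 2) ^ m)"
    using measurable_arrival[OF n, of m]
    by (subst nn_integral_cmult) (simp_all only: nn_integral_exp_arrival[OF n], measurable)
  also have "\<dots> = ennreal (exp (real n * t) * (1 / 2) ^ m)" by (rule ennreal_mult[symmetric]) simp_all
  finally show ?thesis .
qed

lemma emeasure_arrival_gt:
  assumes n: "1 \<le> n" and t: "0 < t"
  shows "emeasure (clocks n) {\<omega>\<in>space (clocks n). t < arrival n m \<omega>} \<le> ennreal (real m / (real n * t))"
proof -
  let ?A = "{\<omega>\<in>space (clocks n). t < arrival n m \<omega>}"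
  have A: "?A \<in> sets (clocks n)" using measurable_arrival[OF n, of m] by simp
  have m: "(\<lambda>\<omega>. ennreal (arrival n m \<omega>)) \<in> borel_measurable (clocks n)"
    using measurable_arrival[OF n] by simp
  have "emeasure (clocks n) ?A = (\<integral>\<^sup>+\<omega>. indicator ?A \<omega> \<partial>clocks n)" using A by simp
  also have "\<dots> \<le> (\<integral>\<^sup>+\<omega>. ennreal (1 / t) * ennreal (arrival n m \<omega>) \<partial>clocks n)"
  proof (rule nn_integral_mono)
    fix \<omega>
    show "indicator ?A \<omega> \<le> ennreal (1 / t) * ennreal (arrival n m \<omega>)"
    proof (cases "\<omega> \<in> ?A")
      case True
      then have "1 \<le> 1 / t * arrival n m \<omega>" using t by (simp add: field_simps)
      then have "1 \<le> ennreal (1 / t * arrival n m \<omega>)" by (metis ennreal_1 ennreal_leI)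
      moreover have "ennreal (1 / t * arrival n m \<omega>) = ennreal (1 / t) * ennreal (arrival n m \<omega>)"
        using t by (intro ennreal_mult') simp
      ultimately show ?thesis using True by (simp only: indicator_simps)
    qed simp
  qed
  also have "\<dots> = ennreal (1 / t) * (\<integral>\<^sup>+\<omega>. ennreal (arrival n m \<omega>) \<partial>clocks n)"
    by (rule nn_integral_cmult[OF m])
  also have "\<dots> \<le> ennreal (1 / t) * ennreal (real m / real n)"
    by (rule mult_left_mono[OF nn_integral_arrival_le[OF n]]) simp
  also have "\<dots> = ennreal (real m / (real n * t))"
    using t by (subst ennreal_mult[symmetric]) simp_all
  finally show ?thesis .
qed

text \<open>
  Almost all outcomes satisfy this (\<open>AE_regular\<close>): all waiting times are positive, at each stage a
  single clock rings first, and the rings do not accumulate.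
\<close>

definition regular :: "nat \<Rightarrow> outcome \<Rightarrow> bool" where
  "regular n \<omega> \<longleftrightarrow> (\<forall>i\<in>{1..n} \<times> UNIV. 0 < fst (\<omega> i))
     \<and> (\<forall>m. \<exists>v\<in>{1..n}. rings_first n ((later n ^^ m) \<omega>) v)
     \<and> (\<forall>t. \<exists>m. t < arrival n m \<omega>)"

lemma AE_regular:
  assumes n: "1 \<le> n"
  shows "AE \<omega> in clocks n. regular n \<omega>"
proof -
  interpret C: prob_space "clocks n" by (rule prob_space_clocks)
  have "AE \<omega> in clocks n. \<forall>i\<in>{1..n} \<times> UNIV. 0 < fst (\<omega> i)"
  proof (subst AE_ball_countable)
    show "\<forall>i\<in>{1..n} \<times> UNIV. AE \<omega> in clocks n. 0 < fst (\<omega> i)"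
      unfolding clocks_eq
      by (intro ballI AE_PiM_component[of _ "\<lambda>i. ring_measure n (fst i)"] prob_space_ring_measure AE_ring_measure_pos)
  qed simp
  moreover have "AE \<omega> in clocks n. \<forall>m. \<exists>v\<in>{1..n}. rings_first n ((later n ^^ m) \<omega>) v"
    unfolding AE_all_countable by (intro allI AE_later_funpow[OF n] AE_rings_first[OF n])
  moreover have "AE \<omega> in clocks n. \<forall>k. \<exists>m. real k < arrival n m \<omega>"
    unfolding AE_all_countable
  proof
    fix k
    let ?N = "{\<omega>\<in>space (clocks n). \<forall>m. arrival n m \<omega> \<le> real k}"
    have N: "?N \<in> sets (clocks n)"
      using measurable_arrival[OF n] by (intro sets.sets_Collect_countable_All) simp
    have le: "emeasure (clocks n) ?N \<le> ennreal (exp (real n * real k) * (1 / 2) ^ m)" for m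
    proof -
      have "emeasure (clocks n) ?N \<le> emeasure (clocks n) {\<omega>\<in>space (clocks n). arrival n m \<omega> \<le> real k}"
        using measurable_arrival[OF n, of m] by (intro emeasure_mono) auto
      then show ?thesis using emeasure_arrival_le[OF n, of m "real k"] by (rule order_trans)
    qed
    have "(\<lambda>m. ennreal (exp (real n * real k) * (1 / 2) ^ m)) \<longlonglongrightarrow> ennreal (exp (real n * real k) * 0)"
      by (intro tendsto_ennrealI tendsto_mult tendsto_const LIMSEQ_power_zero) simp
    then have "emeasure (clocks n) ?N \<le> ennreal (exp (real n * real k) * 0)"
      by (rule LIMSEQ_le_const) (use le in blast)
    then have "emeasure (clocks n) ?N = 0" by simp
    then have "?N \<in> null_sets (clocks n)" using N by blast
    then show "AE \<omega> in clocks n. \<exists>m. real k < arrival n m \<omega>"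
      by (rule AE_I'[of ?N]) (auto simp: not_less)
  qed
  ultimately show ?thesis
  proof eventually_elim
    case (elim \<omega>)
    have "\<exists>m. t < arrival n m \<omega>" for t
    proof -
      obtain k where "t < real k" using reals_Archimedean2 by blast
      then show ?thesis using elim(3) by (meson less_trans)
    qed
    then show ?case using elim unfolding regular_def by blast
  qed
qed

section \<open>The vocabularies between two rings\<close>

abbreviation play :: "(nat \<times> nat \<times> (nat set \<Rightarrow> nat)) list \<Rightarrow> vocabularies \<Rightarrow> vocabularies" where
  "play es W \<equiv> fold (\<lambda>(v, w, c). interact v w c) es W"

definition unique_rings :: "nat \<Rightarrow> outcome \<Rightarrow> real \<Rightarrow> bool" where
  "unique_rings n \<omega> t \<longleftrightarrow> (\<forall>v\<in>{1..n}. \<forall>v'\<in>{1..n}. \<forall>k k'.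
     ring_time \<omega> v k = ring_time \<omega> v' k' \<longrightarrow> ring_time \<omega> v k \<le> t \<longrightarrow> v = v' \<and> k = k')"

lemma ring_times_upto_iff:
  "s \<in> ring_times_upto n \<omega> t \<longleftrightarrow> s \<le> t \<and> (\<exists>x\<in>{1..n}. \<exists>k. s = ring_time \<omega> x k)"
  unfolding ring_times_upto_def mem_Collect_eq by blast

lemma ring_at_eq:
  assumes "unique_rings n \<omega> t" "v \<in> {1..n}" "ring_time \<omega> v k = s" "s \<le> t"
  shows "ring_at n \<omega> s = (v, k)"
  unfolding ring_at_def
proof (rule some_equality)
  show "case (v, k) of (v, k) \<Rightarrow> v \<in> {1..n} \<and> ring_time \<omega> v k = s" using assms by simp
  fix p assume "case p of (v, k) \<Rightarrow> v \<in> {1..n} \<and> ring_time \<omega> v k = s"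
  then obtain v' k' where "p = (v', k')" "v' \<in> {1..n}" "ring_time \<omega> v' k' = s" by (cases p) auto
  moreover from this have "v' = v \<and> k' = k"
    using assms unfolding unique_rings_def by (metis (no_types))
  ultimately show "p = (v, k)" by simp
qed

text \<open>
  Ring times of the shifted outcome: the first ring of \<open>v\<close> is dropped, so the indices of the rings
  of \<open>v\<close> move by one.
\<close>

lemma ring_time_advance:
  assumes "x \<in> {1..n}"
  shows "ring_time (advance n v (fst (\<omega> (v, 0))) \<omega>) x k
    = ring_time \<omega> x (if x = v then Suc k else k) - fst (\<omega> (v, 0))"
proof (cases "x = v")
  case True
  then have "ring_time (advance n v (fst (\<omega> (v, 0))) \<omega>) x k = (\<Sum>j\<le>k. fst (\<omega> (v, Suc j)))"
    using assms unfolding ring_time_def advance_def by (intro sum.cong) simp_all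
  also have "\<dots> = ring_time \<omega> v (Suc k) - fst (\<omega> (v, 0))"
    unfolding ring_time_def by (subst sum.atMost_Suc_shift) simp
  finally show ?thesis using True by simp
next
  case False
  then have "ring_time (advance n v (fst (\<omega> (v, 0))) \<omega>) x k = ring_time \<omega> x k - fst (\<omega> (v, 0))"
    using assms by (induction k) (simp_all add: ring_time_def advance_def)
  then show ?thesis using False by simp
qed

definition positive_waits :: "nat \<Rightarrow> outcome \<Rightarrow> bool" where
  "positive_waits n \<omega> \<longleftrightarrow> (\<forall>i\<in>{1..n} \<times> UNIV. 0 < fst (\<omega> i))"

lemma positive_waits_later:
  assumes "positive_waits n \<omega>" "rings_first n \<omega> v"
  shows "positive_waits n (later n \<omega>)"
proof -
  have v: "v \<in> {1..n}" using assms(2) by (simp add: rings_first_def)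
  show ?thesis
    using assms v unfolding positive_waits_def later_def gap_def first_ringer_eq[OF assms(2)]
    by (auto simp: advance_def rings_first_def)
qed

lemma ring_time_ge_first:
  assumes "positive_waits n \<omega>" "x \<in> {1..n}"
  shows "fst (\<omega> (x, 0)) \<le> ring_time \<omega> x k" and "0 < k \<Longrightarrow> fst (\<omega> (x, 0)) < ring_time \<omega> x k"
proof -
  have p: "0 < fst (\<omega> (x, j))" for j using assms by (auto simp: positive_waits_def)
  have lt: "fst (\<omega> (x, 0)) < ring_time \<omega> x (Suc j)" for j
  proof -
    have "0 < (\<Sum>i\<le>j. fst (\<omega> (x, Suc i)))" using p by (intro sum_pos) auto
    then show ?thesis unfolding ring_time_def by (subst sum.atMost_Suc_shift) simp
  qed
  show "0 < k \<Longrightarrow> fst (\<omega> (x, 0)) < ring_time \<omega> x k" using lt by (cases k) simp_all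
  show "fst (\<omega> (x, 0)) \<le> ring_time \<omega> x k"
  proof (cases k)
    case 0
    then show ?thesis by (simp add: ring_time_def)
  next
    case (Suc j)
    then show ?thesis using lt[of j] by simp
  qed
qed

lemma gap_less_other_rings:
  assumes "positive_waits n \<omega>" "rings_first n \<omega> v" "x \<in> {1..n}" "(x, k) \<noteq> (v, 0)"
  shows "gap n \<omega> < ring_time \<omega> x k"
proof (cases "x = v")
  case True
  then have "0 < k" using assms(4) by simp
  then show ?thesis using ring_time_ge_first(2)[OF assms(1,3)] True
    unfolding gap_def first_ringer_eq[OF assms(2)] by simp
next
  case False
  then have "fst (\<omega> (v, 0)) < fst (\<omega> (x, 0))" using assms(2,3) unfolding rings_first_def by blast
  then show ?thesis using ring_time_ge_first(1)[OF assms(1,3), of k]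
    unfolding gap_def first_ringer_eq[OF assms(2)] by linarith
qed

lemma gap_eq_ring_time: "rings_first n \<omega> v \<Longrightarrow> ring_time \<omega> v 0 = gap n \<omega>"
  unfolding gap_def by (simp add: first_ringer_eq ring_time_def)

lemma ring_time_later:
  assumes "rings_first n \<omega> v" "x \<in> {1..n}"
  shows "ring_time \<omega> x (if x = v then Suc k else k) = gap n \<omega> + ring_time (later n \<omega>) x k"
  unfolding later_def gap_def first_ringer_eq[OF assms(1)] ring_time_advance[OF assms(2)] by simp

lemma later_mark:
  assumes "rings_first n \<omega> v" "x \<in> {1..n}"
  shows "snd (later n \<omega> (x, k)) = snd (\<omega> (x, if x = v then Suc k else k))"
  using assms(2) unfolding later_def gap_def first_ringer_eq[OF assms(1)] advance_def by simp

lemma ring_cases: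
  assumes "rings_first n \<omega> v"
  obtains "(x, k) = (v, 0)" | k' where "k = (if x = v then Suc k' else k')"
  by (cases k; cases "x = v"; fastforce)

definition good_upto :: "nat \<Rightarrow> nat \<Rightarrow> outcome \<Rightarrow> bool" where
  "good_upto n m \<omega> \<longleftrightarrow> positive_waits n \<omega> \<and> (\<forall>j\<le>m. \<exists>v\<in>{1..n}. rings_first n ((later n ^^ j) \<omega>) v)"

lemma good_upto_later:
  assumes "good_upto n (Suc m) \<omega>"
  shows "good_upto n m (later n \<omega>)"
proof -
  obtain v where v: "rings_first n \<omega> v" using assms unfolding good_upto_def by (metis funpow_0 le0)
  have "\<exists>v\<in>{1..n}. rings_first n ((later n ^^ j) (later n \<omega>)) v" if "j \<le> m" for j
  proof -
    have "(later n ^^ j) (later n \<omega>) = (later n ^^ Suc j) \<omega>" by (simp only: funpow_Suc_right o_apply)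
    then show ?thesis using assms that unfolding good_upto_def by (metis Suc_le_mono)
  qed
  then show ?thesis using positive_waits_later v assms unfolding good_upto_def by blast
qed

lemma good_upto_first:
  assumes "good_upto n m \<omega>"
  obtains v where "v \<in> {1..n}" "rings_first n \<omega> v" "0 < gap n \<omega>" "positive_waits n \<omega>"
proof -
  obtain v where v: "v \<in> {1..n}" "rings_first n \<omega> v" using assms unfolding good_upto_def by (metis funpow_0 le0)
  moreover have "0 < gap n \<omega>"
    using assms v unfolding gap_def first_ringer_eq[OF v(2)] good_upto_def positive_waits_def by blast
  ultimately show ?thesis using that assms unfolding good_upto_def by blast
qed

lemma arrival_nonneg: "good_upto n m \<omega> \<Longrightarrow> 0 \<le> arrival n m \<omega>"
proof (induction m arbitrary: \<omega>)
  case (Suc m)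
  then show ?case using good_upto_later[OF Suc.prems] good_upto_first[OF Suc.prems]
    by (metis add_nonneg_nonneg arrival.simps(2) less_imp_le)
qed simp

lemma ring_times_upto_later:
  assumes v: "v \<in> {1..n}" "rings_first n \<omega> v" and t: "gap n \<omega> \<le> t"
  shows "ring_times_upto n \<omega> t = insert (gap n \<omega>) ((+) (gap n \<omega>) ` ring_times_upto n (later n \<omega>) (t - gap n \<omega>))"
    (is "?L = ?R")
proof
  show "?L \<subseteq> ?R"
  proof
    fix s assume "s \<in> ?L"
    then obtain x k where s: "s = ring_time \<omega> x k" "x \<in> {1..n}" "s \<le> t" unfolding ring_times_upto_iff by blast
    show "s \<in> ?R"
    proof (cases rule: ring_cases[OF v(2), of x k])
      case 1
      then show ?thesis using s gap_eq_ring_time[OF v(2)] by simp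
    next
      case (2 k')
      then have "s = gap n \<omega> + ring_time (later n \<omega>) x k'" using s ring_time_later[OF v(2) s(2)] by simp
      moreover from this have "ring_time (later n \<omega>) x k' \<in> ring_times_upto n (later n \<omega>) (t - gap n \<omega>)"
        using s unfolding ring_times_upto_iff by (metis add_le_cancel_left add_diff_cancel_left' diff_add_cancel add.commute)
      ultimately show ?thesis by blast
    qed
  qed
  show "?R \<subseteq> ?L"
  proof
    fix s assume "s \<in> ?R"
    then consider "s = gap n \<omega>" | r where "r \<in> ring_times_upto n (later n \<omega>) (t - gap n \<omega>)" "s = gap n \<omega> + r" by blast
    then show "s \<in> ?L"
    proof cases
      case 1
      then show ?thesis using v(1) t gap_eq_ring_time[OF v(2)] unfolding ring_times_upto_iff by metis
    next
      case 2
      then obtain x k where x: "x \<in> {1..n}" "r = ring_time (later n \<omega>) x k" "r \<le> t - gap n \<omega>"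
        unfolding ring_times_upto_iff by blast
      then have "s = ring_time \<omega> x (if x = v then Suc k else k)" "s \<le> t"
        using ring_time_later[OF v(2) x(1)] 2 by simp_all
      then show ?thesis using x(1) unfolding ring_times_upto_iff by blast
    qed
  qed
qed

lemma sorted_list_of_insert_translate:
  fixes \<tau> :: real
  assumes "finite A" "\<And>s. s \<in> A \<Longrightarrow> 0 < s"
  shows "sorted_list_of_set (insert \<tau> ((+) \<tau> ` A)) = \<tau> # map ((+) \<tau>) (sorted_list_of_set A)"
proof -
  have fin: "finite (insert \<tau> ((+) \<tau> ` A))" using assms by simp
  have "sorted_wrt (<) (map ((+) \<tau>) (sorted_list_of_set A))"
    using strict_sorted_list_of_set[of A] by (simp add: sorted_wrt_map)
  moreover have "distinct (map ((+) \<tau>) (sorted_list_of_set A))" by (simp add: distinct_map)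
  moreover have "\<tau> \<notin> (+) \<tau> ` A" using assms by fastforce
  ultimately have "sorted_wrt (<) (\<tau> # map ((+) \<tau>) (sorted_list_of_set A)) \<and>
      set (\<tau> # map ((+) \<tau>) (sorted_list_of_set A)) = insert \<tau> ((+) \<tau> ` A) \<and>
      length (\<tau> # map ((+) \<tau>) (sorted_list_of_set A)) = card (insert \<tau> ((+) \<tau> ` A))"
    using assms by (auto simp: card_image)
  then show ?thesis using sorted_list_of_set_unique[OF fin] by blast
qed

text \<open>
  By induction on the number of rings: the rings up to \<open>t\<close> are the first ring and the translated
  rings of the shifted outcome. Uniqueness of ring times has to be carried along, since it
  guarantees that the ring selected at a given time is the intended one.
\<close>

lemma vocab_between_arrivals:
  assumes "good_upto n m \<omega>" "arrival n m \<omega> \<le> t" "t < arrival n (Suc m) \<omega>"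
  shows "finite (ring_times_upto n \<omega> t) \<and> unique_rings n \<omega> t \<and>
    fold (ring_update n \<omega>) (sorted_list_of_set (ring_times_upto n \<omega> t)) W = play (event_list n m \<omega>) W"
  using assms
proof (induction m arbitrary: \<omega> t W)
  case 0
  obtain v where v: "v \<in> {1..n}" "rings_first n \<omega> v" "positive_waits n \<omega>"
    using good_upto_first[OF "0.prems"(1)] by blast
  have gt: "t < ring_time \<omega> x k" if "x \<in> {1..n}" for x k
  proof (cases "(x, k) = (v, 0)")
    case True
    then show ?thesis using gap_eq_ring_time[OF v(2)] 0 by simp
  next
    case False
    then show ?thesis using gap_less_other_rings[OF v(3,2) that, of k] 0 by simp
  qed
  then have "ring_times_upto n \<omega> t = {}" using ring_times_upto_iff[of _ n \<omega> t] by (metis equals0I not_less)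
  moreover have "unique_rings n \<omega> t" using gt unfolding unique_rings_def by (meson not_less)
  ultimately show ?case by simp
next
  case (Suc m)
  let ?\<omega> = "later n \<omega>" and ?\<tau> = "gap n \<omega>"
  obtain v where v: "v \<in> {1..n}" "rings_first n \<omega> v" "0 < ?\<tau>" "positive_waits n \<omega>"
    using good_upto_first[OF Suc.prems(1)] by blast
  have good: "good_upto n m ?\<omega>" by (rule good_upto_later[OF Suc.prems(1)])
  have t: "arrival n m ?\<omega> \<le> t - ?\<tau>" "t - ?\<tau> < arrival n (Suc m) ?\<omega>" "?\<tau> \<le> t"
    using Suc.prems arrival_nonneg[OF good] by simp_all
  note IH = Suc.IH[OF good t(1,2)]
  let ?A = "ring_times_upto n ?\<omega> (t - ?\<tau>)"
  have A: "ring_times_upto n \<omega> t = insert ?\<tau> ((+) ?\<tau> ` ?A)" by (rule ring_times_upto_later[OF v(1,2) t(3)])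
  have posw: "positive_waits n ?\<omega>" using good unfolding good_upto_def by blast
  have Apos: "0 < s" if s: "s \<in> ?A" for s
  proof -
    obtain x k where x: "x \<in> {1..n}" "s = ring_time ?\<omega> x k" using s unfolding ring_times_upto_iff by blast
    have "0 < fst (?\<omega> (x, 0))" using posw x unfolding positive_waits_def by blast
    then show ?thesis using ring_time_ge_first(1)[OF posw x(1), of k] x by linarith
  qed
  have uniq: "unique_rings n \<omega> t"
    unfolding unique_rings_def
  proof (intro ballI allI impI)
    fix x x' k k' assume x: "x \<in> {1..n}" "x' \<in> {1..n}" and e: "ring_time \<omega> x k = ring_time \<omega> x' k'" "ring_time \<omega> x k \<le> t"
    show "x = x' \<and> k = k'"
    proof (cases "(x, k) = (v, 0) \<or> (x', k') = (v, 0)")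
      case True
      then show ?thesis
        using e gap_eq_ring_time[OF v(2)] gap_less_other_rings[OF v(4,2) x(1), of k]
          gap_less_other_rings[OF v(4,2) x(2), of k'] by (metis less_irrefl prod.inject)
    next
      case False
      obtain j where j: "k = (if x = v then Suc j else j)" using ring_cases[OF v(2), of x k] False by blast
      obtain j' where j': "k' = (if x' = v then Suc j' else j')" using ring_cases[OF v(2), of x' k'] False by blast
      have "ring_time ?\<omega> x j = ring_time ?\<omega> x' j'" "ring_time ?\<omega> x j \<le> t - ?\<tau>"
        using e ring_time_later[OF v(2) x(1), of j] ring_time_later[OF v(2) x(2), of j'] j j' by simp_all
      then have "x = x' \<and> j = j'" using IH x unfolding unique_rings_def by blast
      then show ?thesis using j j' by simp
    qed
  qed
  have upd0: "ring_update n \<omega> ?\<tau> W = (case first_event n \<omega> of (v, w, c) \<Rightarrow> interact v w c W)" for W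
    using ring_at_eq[OF uniq v(1) gap_eq_ring_time[OF v(2)] t(3)] first_ringer_eq[OF v(2)]
    unfolding ring_update_def first_event_def by (simp add: case_prod_unfold Let_def)
  have upd: "ring_update n \<omega> (?\<tau> + s) = ring_update n ?\<omega> s" if s: "s \<in> ?A" for s
  proof -
    obtain x k where x: "x \<in> {1..n}" "s = ring_time ?\<omega> x k" "s \<le> t - ?\<tau>" using s unfolding ring_times_upto_iff by blast
    have a: "ring_at n ?\<omega> s = (x, k)" using ring_at_eq[OF _ x(1) x(2)[symmetric] x(3)] IH by blast
    have b: "ring_at n \<omega> (?\<tau> + s) = (x, if x = v then Suc k else k)"
      using ring_at_eq[OF uniq x(1) ring_time_later[OF v(2) x(1)]] x by simp
    show ?thesis unfolding ring_update_def a b using later_mark[OF v(2) x(1), of k]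
      by (auto simp: case_prod_unfold Let_def fun_eq_iff)
  qed
  have "fold (ring_update n \<omega>) (sorted_list_of_set (ring_times_upto n \<omega> t)) W
      = fold (ring_update n \<omega>) (map ((+) ?\<tau>) (sorted_list_of_set ?A)) (case first_event n \<omega> of (v, w, c) \<Rightarrow> interact v w c W)"
    unfolding A using sorted_list_of_insert_translate[of ?A ?\<tau>] Apos IH upd0 by simp
  also have "\<dots> = fold (ring_update n ?\<omega>) (sorted_list_of_set ?A) (case first_event n \<omega> of (v, w, c) \<Rightarrow> interact v w c W)"
    unfolding fold_map by (rule fold_cong) (use upd IH in auto)
  also have "\<dots> = play (event_list n m ?\<omega>) (case first_event n \<omega> of (v, w, c) \<Rightarrow> interact v w c W)"
    using IH by blast
  also have "\<dots> = play (event_list n (Suc m) \<omega>) W" by (simp add: case_prod_unfold)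
  finally show ?case using uniq A IH by simp
qed

section \<open>From the event in continuous time to the sequence of interactions\<close>

text \<open>
  Changing a measurable set within a null set keeps it measurable for the completed measure.
\<close>

lemma completion_AE_eq:
  assumes S: "S \<in> sets M" and E: "E \<subseteq> space M" and ae: "AE x in M. x \<in> E \<longleftrightarrow> x \<in> S"
  shows "E \<in> sets (completion M)" and "measure (completion M) E = measure M S"
proof -
  \<comment> \<open>A measurable null set that contains the difference of the two sets.\<close>
  obtain N where N: "{x\<in>space M. \<not> (x \<in> E \<longleftrightarrow> x \<in> S)} \<subseteq> N" "N \<in> null_sets M"
    using AE_E[OF ae] by (metis null_setsI)
  have "E = (S - N) \<union> (E \<inter> N)"
    using N(1) E sets.sets_into_space[OF S] by blast
  then show Em: "E \<in> sets (completion M)"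
    by (rule sets_completionI[of _ _ "E \<inter> N" N]) (use N S in auto)
  have "emeasure (completion M) E = emeasure (completion M) S"
    using Em S by (intro emeasure_eq_AE[OF AE_mp[OF AE_completion[OF ae]]]) auto
  then show "measure (completion M) E = measure M S"
    using S by (simp add: measure_def)
qed

definition word_count :: "nat \<Rightarrow> (nat \<times> nat \<times> (nat set \<Rightarrow> nat)) list \<Rightarrow> nat" where
  "word_count n es = card (\<Union>v\<in>{1..n}. play es (\<lambda>_. {}) v)"

lemma length_event_list [simp]: "length (event_list n m \<omega>) = m"
  by (induction m arbitrary: \<omega>) simp_all

lemma take_event_list: "k \<le> m \<Longrightarrow> take k (event_list n m \<omega>) = event_list n k \<omega>"
proof (induction m arbitrary: \<omega> k)
  case (Suc m)
  then show ?case by (cases k) simp_all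
qed simp

lemma regular_good_upto: "regular n \<omega> \<Longrightarrow> good_upto n m \<omega>"
  unfolding regular_def good_upto_def positive_waits_def by blast

lemma arrival_less_Suc: "good_upto n m \<omega> \<Longrightarrow> arrival n m \<omega> < arrival n (Suc m) \<omega>"
proof (induction m arbitrary: \<omega>)
  case 0
  then show ?case using good_upto_first by force
next
  case (Suc m)
  from Suc.IH[OF good_upto_later[OF Suc.prems]] show ?case by simp
qed

lemma regular_arrival_mono:
  assumes "regular n \<omega>" shows "strict_mono (\<lambda>m. arrival n m \<omega>)"
  unfolding strict_mono_Suc_iff using arrival_less_Suc[OF regular_good_upto[OF assms]] by blast

lemma regular_interval:
  assumes "regular n \<omega>" "0 \<le> t"
  obtains m where "arrival n m \<omega> \<le> t" "t < arrival n (Suc m) \<omega>"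
proof -
  have ex: "\<exists>m. t < arrival n m \<omega>" using assms unfolding regular_def by blast
  define k where "k = (LEAST m. t < arrival n m \<omega>)"
  have k: "t < arrival n k \<omega>" unfolding k_def using ex by (rule LeastI_ex)
  then have "k \<noteq> 0" using assms(2) by (cases k) simp_all
  then obtain m where m: "k = Suc m" by (cases k) simp_all
  have "\<not> t < arrival n m \<omega>"
  proof
    assume "t < arrival n m \<omega>"
    then have "k \<le> m" unfolding k_def by (rule Least_le)
    then show False using m by simp
  qed
  then show ?thesis using that[of m] k m by simp
qed

lemma card_words:
  assumes "regular n \<omega>" "arrival n m \<omega> \<le> t" "t < arrival n (Suc m) \<omega>"
  shows "card (words n \<omega> t) = word_count n (event_list n m \<omega>)"
  using vocab_between_arrivals[OF regular_good_upto[OF assms(1)] assms(2,3), of "\<lambda>_. {}"]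
  unfolding words_def vocab_def word_count_def by simp

definition close_event :: "nat \<Rightarrow> real \<Rightarrow> real \<Rightarrow> real \<Rightarrow> outcome set" where
  "close_event n a b D = {\<omega> \<in> space (game_space n).
     (SUP t \<in> {a..b}. ennreal \<bar>real (card (words n \<omega> t)) - real n / 2\<bar>) \<le> ennreal D}"

lemma close_event_iff:
  assumes "0 \<le> D"
  shows "\<omega> \<in> close_event n a b D \<longleftrightarrow> \<omega> \<in> space (clocks n) \<and>
    (\<forall>t\<in>{a..b}. \<bar>real (card (words n \<omega> t)) - real n / 2\<bar> \<le> D)"
proof -
  have sp: "space (game_space n) = space (clocks n)"
    by (simp add: game_space_def clocks_def)
  show ?thesis unfolding close_event_def mem_Collect_eq SUP_le_iff sp using assms by simp
qed

definition close_lists :: "nat \<Rightarrow> real \<Rightarrow> (nat \<times> nat \<times> (nat set \<Rightarrow> nat)) list set" where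
  "close_lists n D = {es. \<bar>real (word_count n es) - real n / 2\<bar> \<le> D}"

text \<open>
  The supremum over an interval of times reduces to the finitely many histories that are current
  at some time of the interval. The time \<open>max a (arrival n m \<omega>)\<close> witnesses that the \<open>m\<close>-th
  history is one of them.
\<close>

lemma close_event_regular:
  assumes D: "0 \<le> D" and a: "0 \<le> a" and reg: "regular n \<omega>" and sp: "\<omega> \<in> space (clocks n)"
  shows "\<omega> \<in> close_event n a b D \<longleftrightarrow> b < a \<or>
    (\<forall>m. arrival n m \<omega> \<le> b \<longrightarrow> a < arrival n (Suc m) \<omega> \<longrightarrow> event_list n m \<omega> \<in> close_lists n D)"
proof (cases "b < a")
  case True
  then show ?thesis using sp by (simp add: close_event_iff[OF D])
next
  case False
  show ?thesis unfolding close_event_iff[OF D]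
  proof (intro iffI conjI disjI2 allI impI ballI)
    fix m assume all: "\<omega> \<in> space (clocks n) \<and> (\<forall>t\<in>{a..b}. \<bar>real (card (words n \<omega> t)) - real n / 2\<bar> \<le> D)"
      and m: "arrival n m \<omega> \<le> b" "a < arrival n (Suc m) \<omega>"
    let ?t = "max a (arrival n m \<omega>)"
    have "?t \<in> {a..b}" using m False by auto
    then have "\<bar>real (card (words n \<omega> ?t)) - real n / 2\<bar> \<le> D" using all by blast
    moreover have "card (words n \<omega> ?t) = word_count n (event_list n m \<omega>)"
      using m arrival_less_Suc[OF regular_good_upto[OF reg], of m] by (intro card_words[OF reg]) auto
    ultimately show "event_list n m \<omega> \<in> close_lists n D" by (simp add: close_lists_def)
  next
    fix t assume *: "b < a \<or> (\<forall>m. arrival n m \<omega> \<le> b \<longrightarrow> a < arrival n (Suc m) \<omega> \<longrightarrow> event_list n m \<omega> \<in> close_lists n D)"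
      and t: "t \<in> {a..b}"
    obtain m where m: "arrival n m \<omega> \<le> t" "t < arrival n (Suc m) \<omega>"
      using regular_interval[OF reg, of t] t a by force
    then have "event_list n m \<omega> \<in> close_lists n D" using * t False by auto
    then show "\<bar>real (card (words n \<omega> t)) - real n / 2\<bar> \<le> D"
      by (simp add: close_lists_def card_words[OF reg m])
  qed (rule sp)
qed

lemma close_event_sets:
  assumes n: "2 \<le> n" and D: "0 \<le> D" and a: "0 \<le> a"
  obtains S where "S \<in> sets (clocks n)" "AE \<omega> in clocks n. \<omega> \<in> close_event n a b D \<longleftrightarrow> \<omega> \<in> S"
    "close_event n a b D \<in> sets (game_space n)" "measure (game_space n) (close_event n a b D) = measure (clocks n) S"
proof (cases "b < a")
  case True
  have "AE \<omega> in clocks n. \<omega> \<in> close_event n a b D \<longleftrightarrow> \<omega> \<in> space (clocks n)"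
    using True by (simp add: close_event_iff[OF D])
  moreover have "close_event n a b D = space (clocks n)"
    using True by (auto simp: close_event_iff[OF D])
  ultimately show ?thesis
    using that[of "space (clocks n)"] completion_AE_eq[of "space (clocks n)" "clocks n" "close_event n a b D"]
    by (simp add: game_space_def clocks_def)
next
  case False
  have n1: "1 \<le> n" using n by simp
  let ?L = "\<lambda>m. set_pmf (replicate_pmf m (event_pmf n))"
  define S where "S = {\<omega>\<in>space (clocks n). \<forall>m. \<not> arrival n m \<omega> \<le> b \<or> \<not> a < arrival n (Suc m) \<omega> \<or>
    event_list n m \<omega> \<in> close_lists n D \<inter> ?L m}"
  have S: "S \<in> sets (clocks n)"
    unfolding S_def
  proof (intro sets.sets_Collect_countable_All sets.sets_Collect_disj)
    fix m
    show "{\<omega> \<in> space (clocks n). \<not> arrival n m \<omega> \<le> b} \<in> sets (clocks n)"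
      using measurable_arrival[OF n1, of m] by simp
    show "{\<omega> \<in> space (clocks n). \<not> a < arrival n (Suc m) \<omega>} \<in> sets (clocks n)"
      using measurable_arrival[OF n1, of "Suc m"] by (simp del: arrival.simps)
    show "{\<omega> \<in> space (clocks n). event_list n m \<omega> \<in> close_lists n D \<inter> ?L m} \<in> sets (clocks n)"
      by (rule event_list_sets[OF n])
  qed
  have pos: "AE \<omega> in clocks n. \<forall>m. event_list n m \<omega> \<in> ?L m"
    unfolding AE_all_countable using AE_event_list_possible[OF n] by blast
  have ae: "AE \<omega> in clocks n. \<omega> \<in> close_event n a b D \<longleftrightarrow> \<omega> \<in> S"
    using AE_regular[OF n1] pos AE_space
  proof eventually_elim
    case (elim \<omega>)
    show ?case unfolding close_event_regular[OF D a elim(1,3)] S_def using False elim by blast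
  qed
  have gs: "game_space n = completion (clocks n)" by (simp add: game_space_def clocks_def)
  have "close_event n a b D \<subseteq> space (clocks n)" using close_event_iff[OF D] by blast
  from completion_AE_eq[OF S this ae] show ?thesis using that[OF S ae] gs by simp
qed

text \<open>
  Unless ring number \<open>m0\<close> comes after time \<open>a\<close> or ring number \<open>M\<close> before time \<open>b\<close>, all histories that are
  current during \<open>{a..b}\<close> have between \<open>m0\<close> and \<open>M\<close> interactions.
\<close>

lemma close_event_prob:
  assumes n: "2 \<le> n" and D: "0 \<le> D" and a: "0 < a"
  shows "measure (game_space n) (close_event n a b D) \<ge>
    1 - real m0 / (real n * a) - exp (real n * b) * (1 / 2) ^ M
      - measure_pmf.prob (replicate_pmf M (event_pmf n)) {es. \<exists>m. m0 \<le> m \<and> m \<le> M \<and> take m es \<notin> close_lists n D}"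
proof -
  interpret C: prob_space "clocks n" by (rule prob_space_clocks)
  have n1: "1 \<le> n" using n by simp
  obtain S where S: "S \<in> sets (clocks n)" "AE \<omega> in clocks n. \<omega> \<in> close_event n a b D \<longleftrightarrow> \<omega> \<in> S"
    "measure (game_space n) (close_event n a b D) = measure (clocks n) S"
    by (rule close_event_sets[OF n D less_imp_le[OF a], of b])
  let ?X = "{es. \<exists>m. m0 \<le> m \<and> m \<le> M \<and> take m es \<notin> close_lists n D}"
  let ?L = "set_pmf (replicate_pmf M (event_pmf n))"
  let ?A1 = "{\<omega>\<in>space (clocks n). a < arrival n m0 \<omega>}"
  let ?A2 = "{\<omega>\<in>space (clocks n). arrival n M \<omega> \<le> b}"
  let ?A3 = "{\<omega>\<in>space (clocks n). event_list n M \<omega> \<in> ?X \<inter> ?L}"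
  have A1: "?A1 \<in> sets (clocks n)" using measurable_arrival[OF n1, of m0] by simp
  have A2: "?A2 \<in> sets (clocks n)" using measurable_arrival[OF n1, of M] by simp
  have A3: "?A3 \<in> sets (clocks n)" by (rule event_list_sets[OF n])
  have "AE \<omega> in clocks n. \<omega> \<in> S \<union> (?A1 \<union> (?A2 \<union> ?A3))"
    using S(2) AE_regular[OF n1] AE_event_list_possible[OF n, of M] AE_space
  proof eventually_elim
    case (elim \<omega>)
    show ?case
    proof (rule ccontr)
      assume no: "\<omega> \<notin> S \<union> (?A1 \<union> (?A2 \<union> ?A3))"
      then have arr: "arrival n m0 \<omega> \<le> a" "b < arrival n M \<omega>" and list: "event_list n M \<omega> \<notin> ?X"
        using elim by auto
      note mono = regular_arrival_mono[OF elim(2)]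
      have "event_list n m \<omega> \<in> close_lists n D" if m: "arrival n m \<omega> \<le> b" "a < arrival n (Suc m) \<omega>" for m
      proof -
        have "arrival n m0 \<omega> < arrival n (Suc m) \<omega>" "arrival n m \<omega> < arrival n M \<omega>" using arr m by linarith+
        then have "m0 \<le> m" "m \<le> M"
          using strict_mono_less[OF mono, of m0 "Suc m"] strict_mono_less[OF mono, of m M] by linarith+
        then show ?thesis using list take_event_list[of m M n \<omega>] by auto
      qed
      then have "\<omega> \<in> close_event n a b D" using close_event_regular[OF D _ elim(2,4), of a b] a by simp
      then show False using elim(1) no by blast
    qed
  qed
  then have "C.prob (S \<union> (?A1 \<union> (?A2 \<union> ?A3))) = 1"
    by (subst C.prob_eq_1) (intro sets.Un S(1) A1 A2 A3, assumption)
  moreover have "C.prob (S \<union> (?A1 \<union> (?A2 \<union> ?A3))) \<le> C.prob S + (C.prob ?A1 + (C.prob ?A2 + C.prob ?A3))"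
  proof -
    have A23: "?A2 \<union> ?A3 \<in> sets (clocks n)" using A2 A3 by (rule sets.Un)
    have "?A1 \<union> (?A2 \<union> ?A3) \<in> sets (clocks n)" using A1 A23 by (rule sets.Un)
    from measure_Un_le[OF S(1) this] measure_Un_le[OF A1 A23]
      measure_Un_le[OF A2 A3] show ?thesis by linarith
  qed
  moreover have "C.prob ?A1 \<le> real m0 / (real n * a)"
    using emeasure_arrival_gt[OF n1 a, of m0] unfolding C.emeasure_eq_measure
    by (subst (asm) ennreal_le_iff) (use a in simp_all)
  moreover have "C.prob ?A2 \<le> exp (real n * b) * (1 / 2) ^ M"
    using emeasure_arrival_le[OF n1, of M b] unfolding C.emeasure_eq_measure
    by (subst (asm) ennreal_le_iff) simp_all
  moreover have "C.prob ?A3 = measure_pmf.prob (replicate_pmf M (event_pmf n)) ?X"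
    using event_list_sets(2)[OF n, of M ?X] unfolding C.emeasure_eq_measure by simp
  ultimately show ?thesis using S(3) by linarith
qed

section \<open>Stopped sequences of independent trials\<close>

type_synonym event = "nat \<times> nat \<times> (nat set \<Rightarrow> nat)"

lemma map_rev_replicate_pmf: "map_pmf rev (replicate_pmf m p) = replicate_pmf m p"
proof (induction m)
  case (Suc m)
  have "map_pmf rev (replicate_pmf (Suc m) p) = do {xs \<leftarrow> map_pmf rev (replicate_pmf m p); ys \<leftarrow> replicate_pmf 1 p; return_pmf (xs @ ys)}"
    by (simp add: map_bind_pmf bind_map_pmf replicate_pmf_1 bind_return_pmf bind_assoc_pmf)
       (subst bind_commute_pmf, rule refl)
  also have "\<dots> = replicate_pmf (m + 1) p"
    unfolding Suc.IH by (rule replicate_pmf_distrib[symmetric])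
  finally show ?case by simp
qed simp

lemma map_drop_replicate_pmf: "map_pmf (drop k) (replicate_pmf (k + m) p) = replicate_pmf m p"
proof (induction k)
  case (Suc k)
  have "map_pmf (drop (Suc k)) (replicate_pmf (Suc k + m) p) = map_pmf (drop k) (replicate_pmf (k + m) p)"
    by (simp add: map_pmf_def bind_assoc_pmf bind_return_pmf)
  then show ?case using Suc.IH by simp
qed (simp add: map_pmf_ident)

text \<open>
  Histories list the most recent trial first; no trial is added to a bad history. Stopping in this
  way turns an event of the form \<open>at some time a history was bad\<close> into a property of the final
  history, so that Markov's inequality replaces a maximal inequality.
\<close>

primrec stopped_pmf :: "('a list \<Rightarrow> bool) \<Rightarrow> 'a pmf \<Rightarrow> nat \<Rightarrow> 'a list pmf" where
  "stopped_pmf bad p 0 = return_pmf []"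
| "stopped_pmf bad p (Suc m) =
    bind_pmf (stopped_pmf bad p m) (\<lambda>h. if bad h then return_pmf h else map_pmf (\<lambda>e. e # h) p)"

primrec truncate_history :: "('a list \<Rightarrow> bool) \<Rightarrow> 'a list \<Rightarrow> 'a list" where
  "truncate_history bad [] = []"
| "truncate_history bad (e # h) =
    (if bad (truncate_history bad h) then truncate_history bad h else e # truncate_history bad h)"

lemma truncate_history_id: "\<not> bad (truncate_history bad h) \<Longrightarrow> truncate_history bad h = h"
  by (induction h) (auto split: if_splits)

lemma stopped_pmf_truncate: "stopped_pmf bad p m = map_pmf (truncate_history bad) (replicate_pmf m p)"
proof (induction m)
  case (Suc m)
  have "map_pmf (truncate_history bad) (replicate_pmf (Suc m) p)
      = bind_pmf (replicate_pmf m p) (\<lambda>h. bind_pmf p (\<lambda>e. return_pmf (truncate_history bad (e # h))))"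
    by (simp add: map_bind_pmf) (subst bind_commute_pmf, rule refl)
  also have "\<dots> = bind_pmf (replicate_pmf m p) (\<lambda>h. if bad (truncate_history bad h) then return_pmf (truncate_history bad h)
      else map_pmf (\<lambda>e. e # truncate_history bad h) p)"
    by (intro bind_pmf_cong refl) (simp add: map_pmf_def)
  also have "\<dots> = stopped_pmf bad p (Suc m)"
    by (simp add: Suc.IH bind_map_pmf)
  finally show ?case by simp
qed simp

lemma prob_replicate_le_stopped:
  "measure_pmf.prob (replicate_pmf m p) {h. Q h} \<le> measure_pmf.prob (stopped_pmf bad p m) {h. bad h \<or> Q h}"
proof -
  have "measure_pmf.prob (replicate_pmf m p) {h. Q h}
      \<le> measure_pmf.prob (replicate_pmf m p) (truncate_history bad -` {h. bad h \<or> Q h})"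
    using truncate_history_id[of bad] by (intro measure_pmf.finite_measure_mono) (auto, metis)
  then show ?thesis unfolding stopped_pmf_truncate measure_map_pmf .
qed

lemma set_stopped_pmf:
  assumes "h \<in> set_pmf (stopped_pmf bad p m)"
  shows "set h \<subseteq> set_pmf p" "length h \<le> m"
  using assms by (induction m arbitrary: h) (fastforce split: if_splits)+

lemma finite_set_stopped_pmf: "finite (set_pmf p) \<Longrightarrow> finite (set_pmf (stopped_pmf bad p m))"
  by (induction m) auto

lemma stopped_pmf_never: "stopped_pmf (\<lambda>_. False) p m = replicate_pmf m p"
proof (induction m)
  case (Suc m)
  show ?case by (simp add: Suc.IH map_pmf_def) (subst bind_commute_pmf, rule refl)
qed simp

text \<open>
  Optional stopping for supermartingales.
\<close>

lemma expectation_stopped_le: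
  fixes f :: "'a list \<Rightarrow> real"
  assumes p: "finite (set_pmf p)"
    and step: "\<And>h. set h \<subseteq> set_pmf p \<Longrightarrow> length h < m \<Longrightarrow> \<not> bad h \<Longrightarrow> measure_pmf.expectation p (\<lambda>e. f (e # h)) \<le> f h"
  shows "measure_pmf.expectation (stopped_pmf bad p m) f \<le> f []"
  using step
proof (induction m)
  case (Suc m)
  let ?q = "stopped_pmf bad p m"
  have fin: "finite (set_pmf ?q)" by (rule finite_set_stopped_pmf[OF p])
  have "measure_pmf.expectation (stopped_pmf bad p (Suc m)) f
      = measure_pmf.expectation ?q (\<lambda>h. measure_pmf.expectation (if bad h then return_pmf h else map_pmf (\<lambda>e. e # h) p) f)"
    unfolding stopped_pmf.simps by (subst pmf_expectation_bind[OF fin]) (use p in \<open>auto simp: integral_measure_pmf[OF fin]\<close>)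
  also have "\<dots> \<le> measure_pmf.expectation ?q f"
  proof (rule integral_mono_AE)
    show "AE h in ?q. measure_pmf.expectation (if bad h then return_pmf h else map_pmf (\<lambda>e. e # h) p) f \<le> f h"
    proof (rule AE_pmfI)
      fix h assume "h \<in> set_pmf ?q"
      then show "measure_pmf.expectation (if bad h then return_pmf h else map_pmf (\<lambda>e. e # h) p) f \<le> f h"
        using Suc.prems[of h] set_stopped_pmf[of h bad p m] by simp
    qed
  qed (use integrable_measure_pmf_finite[OF fin] in auto)
  also have "\<dots> \<le> f []" using Suc by simp
  finally show ?case .
qed simp

lemma markov_pmf:
  fixes f :: "'a \<Rightarrow> real"
  assumes "finite (set_pmf q)" "\<And>x. x \<in> set_pmf q \<Longrightarrow> 0 \<le> f x" "0 < c"
    and "\<And>x. x \<in> set_pmf q \<Longrightarrow> Q x \<Longrightarrow> c \<le> f x"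
  shows "measure_pmf.prob q {x. Q x} \<le> measure_pmf.expectation q f / c"
proof -
  have "measure_pmf.prob q {x. Q x} = measure_pmf.expectation q (indicator {x. Q x})" by simp
  also have "\<dots> \<le> measure_pmf.expectation q (\<lambda>x. f x / c)"
  proof (rule integral_mono_AE)
    show "AE x in q. indicator {x. Q x} x \<le> f x / c"
      by (rule AE_pmfI) (use assms in \<open>auto simp: indicator_def\<close>)
  qed (use integrable_measure_pmf_finite[OF assms(1)] in auto)
  also have "\<dots> = measure_pmf.expectation q f / c" by simp
  finally show ?thesis .
qed

lemma expectation_mono_pmf:
  fixes f g :: "'a \<Rightarrow> real"
  assumes "finite (set_pmf q)" "\<And>x. x \<in> set_pmf q \<Longrightarrow> f x \<le> g x"
  shows "measure_pmf.expectation q f \<le> measure_pmf.expectation q g"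
  using assms integrable_measure_pmf_finite[OF assms(1)]
  by (intro integral_mono_AE) (auto intro: AE_pmfI)

lemma expectation_bind_finite:
  fixes f :: "'b \<Rightarrow> real"
  assumes "finite (set_pmf q)" "\<And>x. x \<in> set_pmf q \<Longrightarrow> finite (set_pmf (r x))"
  shows "measure_pmf.expectation (bind_pmf q r) f = measure_pmf.expectation q (\<lambda>x. measure_pmf.expectation (r x) f)"
  using assms by (subst pmf_expectation_bind[OF assms(1)]) (auto simp: integral_measure_pmf[OF assms(1)])

section \<open>Words, inventions and agreements in a history\<close>

primrec history_vocab :: "event list \<Rightarrow> vocabularies" where
  "history_vocab [] = (\<lambda>_. {})"
| "history_vocab (e # h) = (case e of (v, w, c) \<Rightarrow> interact v w c (history_vocab h))"

declare history_vocab.simps(2) [simp del]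

lemma history_vocab_Cons: "history_vocab ((v, w, c) # h) = interact v w c (history_vocab h)"
  by (simp add: history_vocab.simps)

lemma history_vocab_eq: "history_vocab h = play (rev h) (\<lambda>_. {})"
  by (induction h) (auto simp: case_prod_unfold history_vocab.simps)

definition agrees :: "vocabularies \<Rightarrow> event \<Rightarrow> bool" where
  "agrees W = (\<lambda>(v, w, c). W v \<noteq> {} \<and> c (W v) \<in> W w)"

primrec agreements :: "event list \<Rightarrow> nat" where
  "agreements [] = 0"
| "agreements (e # h) = agreements h + of_bool (agrees (history_vocab h) e)"

primrec inventions :: "event list \<Rightarrow> nat" where
  "inventions [] = 0"
| "inventions (e # h) = inventions h + of_bool (history_vocab h (fst e) = {})"

lemma interact_silent:
  "W v = {} \<Longrightarrow> v \<noteq> w \<Longrightarrow> interact v w c W x = (if x = v then {v} else if x = w then insert v (W w) else W x)"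
  by (simp add: interact_def)

lemma interact_agree:
  "W v \<noteq> {} \<Longrightarrow> c (W v) \<in> W w \<Longrightarrow> interact v w c W x = (if x = v \<or> x = w then {c (W v)} else W x)"
  by (simp add: interact_def Let_def)

lemma interact_learn:
  "W v \<noteq> {} \<Longrightarrow> c (W v) \<notin> W w \<Longrightarrow> interact v w c W x = (if x = w then insert (c (W v)) (W w) else W x)"
  by (simp add: interact_def Let_def)

lemma interact_other: "x \<noteq> v \<Longrightarrow> x \<noteq> w \<Longrightarrow> interact v w c W x = W x"
  by (simp add: interact_def Let_def)

lemma sum_change_two:
  fixes g :: "nat set \<Rightarrow> real" and V :: "nat set"
  assumes "finite V" "v \<in> V" "w \<in> V" "v \<noteq> w" "\<And>x. x \<noteq> v \<Longrightarrow> x \<noteq> w \<Longrightarrow> W' x = W x"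
  shows "(\<Sum>x\<in>V. g (W' x)) = (\<Sum>x\<in>V. g (W x)) + (g (W' v) - g (W v)) + (g (W' w) - g (W w))"
proof -
  have s: "(\<Sum>x\<in>V. f x) = f v + (f w + (\<Sum>x\<in>V - {v} - {w}. f x))" for f :: "nat \<Rightarrow> real"
  proof -
    have "w \<in> V - {v}" "finite (V - {v})" using assms by blast+
    then show ?thesis using sum.remove[OF assms(1,2), of f] sum.remove[of "V - {v}" w f] by metis
  qed
  have "(\<Sum>x\<in>V - {v} - {w}. g (W' x)) = (\<Sum>x\<in>V - {v} - {w}. g (W x))"
    using assms(5) by (intro sum.cong) auto
  then show ?thesis unfolding s[of "\<lambda>x. g (W x)"] s[of "\<lambda>x. g (W' x)"] by linarith
qed

locale naming_game =
  fixes n :: nat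
  assumes two_le: "2 \<le> n"
begin

abbreviation "V \<equiv> {1..n}"
abbreviation "p \<equiv> event_pmf n"

definition valid :: "event list \<Rightarrow> bool" where
  "valid h \<longleftrightarrow> set h \<subseteq> set_pmf p"

lemma valid_Cons: "valid (e # h) \<longleftrightarrow> e \<in> set_pmf p \<and> valid h"
  by (auto simp: valid_def)

lemma mem_event: "(v, w, c) \<in> set_pmf p \<longleftrightarrow> v \<in> V \<and> w \<in> V \<and> v \<noteq> w \<and> c \<in> (\<Pi>\<^sub>E A \<in> Pow V - {{}}. A)"
  unfolding set_event_pmf[OF two_le] by auto

lemma choice_mem: "c \<in> (\<Pi>\<^sub>E A \<in> Pow V - {{}}. A) \<Longrightarrow> A \<subseteq> V \<Longrightarrow> A \<noteq> {} \<Longrightarrow> c A \<in> A"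
  by (auto simp: PiE_iff)

lemma finite_p: "finite (set_pmf p)"
  by (rule finite_set_event_pmf[OF two_le])

lemma history_vocab_subset: "valid h \<Longrightarrow> history_vocab h x \<subseteq> V"
proof (induction h arbitrary: x)
  case (Cons e h)
  obtain v w c where e: "e = (v, w, c)" by (cases e) auto
  let ?W = "history_vocab h"
  have IH: "?W y \<subseteq> V" for y using Cons by (simp add: valid_Cons)
  have ev: "v \<in> V" "c \<in> (\<Pi>\<^sub>E A \<in> Pow V - {{}}. A)" using Cons.prems by (simp_all only: valid_Cons e mem_event)
  have c: "c (?W v) \<in> V" if "?W v \<noteq> {}"
    using choice_mem[OF ev(2) IH that] IH by blast
  show ?case
    using IH[of v] IH[of w] IH[of x] c ev(1) unfolding e history_vocab_Cons interact_def Let_def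
    by auto
qed simp

lemma finite_history_vocab: "valid h \<Longrightarrow> finite (history_vocab h x)"
  using history_vocab_subset finite_subset by blast

text \<open>
  Words never come from vertices that have not spoken or listened yet. Consequently an invention
  always produces a new word.
\<close>

lemma word_has_inventor: "valid h \<Longrightarrow> u \<in> history_vocab h x \<Longrightarrow> history_vocab h u \<noteq> {}"
proof (induction h arbitrary: x u)
  case (Cons e h)
  obtain v w c where e: "e = (v, w, c)" by (cases e) auto
  let ?W = "history_vocab h"
  have vh: "valid h" using Cons.prems by (simp add: valid_Cons)
  have IH: "u \<in> ?W y \<Longrightarrow> ?W u \<noteq> {}" for u y using Cons vh by blast
  have ev: "c \<in> (\<Pi>\<^sub>E A \<in> Pow V - {{}}. A)" using Cons.prems by (simp only: valid_Cons e mem_event)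
  have c: "c (?W v) \<in> ?W v" if "?W v \<noteq> {}"
    using choice_mem[OF ev history_vocab_subset[OF vh] that] .
  show ?case
    using Cons.prems(2) IH[of u] IH[of u v] c unfolding e history_vocab_Cons interact_def Let_def
    by (auto split: if_splits)
qed simp

text \<open>
  The three kinds of interaction: the speaker invents a word, speaker and listener agree, or the
  listener learns a word.
\<close>

lemma event_cases:
  assumes "valid ((v, w, c) # h)"
  obtains (silent) "history_vocab h v = {}" "v \<notin> history_vocab h w"
      "history_vocab ((v, w, c) # h) v = {v}" "history_vocab ((v, w, c) # h) w = insert v (history_vocab h w)"
      "\<not> agrees (history_vocab h) (v, w, c)"
  | (agree) u where "u = c (history_vocab h v)" "u \<in> history_vocab h v" "u \<in> history_vocab h w"
      "history_vocab ((v, w, c) # h) v = {u}" "history_vocab ((v, w, c) # h) w = {u}"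
      "agrees (history_vocab h) (v, w, c)"
  | (learn) u where "u = c (history_vocab h v)" "u \<in> history_vocab h v" "u \<notin> history_vocab h w"
      "history_vocab ((v, w, c) # h) v = history_vocab h v" "history_vocab ((v, w, c) # h) w = insert u (history_vocab h w)"
      "\<not> agrees (history_vocab h) (v, w, c)"
proof -
  let ?W = "history_vocab h"
  have vh: "valid h" and ne: "v \<noteq> w" and ev: "c \<in> (\<Pi>\<^sub>E A \<in> Pow V - {{}}. A)"
    using assms unfolding valid_Cons mem_event by blast+
  show ?thesis
  proof (cases "?W v = {}")
    case True
    then have "v \<notin> ?W w" using word_has_inventor[OF vh, of v w] by blast
    then show ?thesis using True ne by (intro silent) (simp_all add: interact_silent agrees_def history_vocab_Cons)
  next
    case False
    then have c: "c (?W v) \<in> ?W v" using choice_mem[OF ev history_vocab_subset[OF vh]] by blast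
    show ?thesis
    proof (cases "c (?W v) \<in> ?W w")
      case True
      then show ?thesis using c False by (intro agree[of "c (?W v)"]) (simp_all add: interact_agree agrees_def history_vocab_Cons)
    next
      case F2: False
      then show ?thesis using c False ne by (intro learn[of "c (?W v)"]) (simp_all add: interact_learn agrees_def history_vocab_Cons)
    qed
  qed
qed

lemma sum_change_event:
  fixes g :: "nat set \<Rightarrow> real"
  assumes "valid ((v, w, c) # h)"
  shows "(\<Sum>x\<in>V. g (history_vocab ((v, w, c) # h) x)) = (\<Sum>x\<in>V. g (history_vocab h x))
    + (g (history_vocab ((v, w, c) # h) v) - g (history_vocab h v))
    + (g (history_vocab ((v, w, c) # h) w) - g (history_vocab h w))"
proof (rule sum_change_two)
  show "v \<in> V" "w \<in> V" "v \<noteq> w" using assms unfolding valid_Cons mem_event by blast+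
qed (simp_all add: interact_other history_vocab_Cons)

definition spoken :: "event list \<Rightarrow> real" where
  "spoken h = (\<Sum>x\<in>V. of_bool (history_vocab h x \<noteq> {}))"

lemma spoken_Cons:
  assumes "valid ((v, w, c) # h)"
  shows "spoken ((v, w, c) # h) = spoken h + of_bool (history_vocab h v = {}) + of_bool (history_vocab h w = {})"
  unfolding spoken_def sum_change_event[OF assms, of "\<lambda>A. of_bool (A \<noteq> {})"]
  using assms by (cases rule: event_cases) auto

lemma spoken_le: "0 \<le> spoken h" "spoken h \<le> real n"
proof -
  show "0 \<le> spoken h" unfolding spoken_def by (intro sum_nonneg) simp
  have "spoken h \<le> (\<Sum>x\<in>V. 1)" unfolding spoken_def by (intro sum_mono) simp
  then show "spoken h \<le> real n" by simp
qed

text \<open>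
  Each interaction adds at most one entry to the vocabularies, apart from the entry that the
  inventor adds to its own.
\<close>

lemma total_vocabulary: "valid h \<Longrightarrow> (\<Sum>x\<in>V. real (card (history_vocab h x))) \<le> real (length h) + spoken h"
proof (induction h)
  case (Cons e h)
  obtain v w c where e: "e = (v, w, c)" by (cases e) auto
  have val: "valid ((v, w, c) # h)" and vh: "valid h" using Cons.prems by (simp_all add: e valid_Cons)
  note IH = Cons.IH[OF vh]
  have fin: "finite (history_vocab h x)" for x by (rule finite_history_vocab[OF vh])
  have pos: "1 \<le> real (card (history_vocab h x))" if "u \<in> history_vocab h x" for u x
    using fin[of x] that card_gt_0_iff[of "history_vocab h x"] by force
  show ?case unfolding e using val
  proof (cases rule: event_cases)
    case silent
    then show "(\<Sum>x\<in>V. real (card (history_vocab ((v, w, c) # h) x))) \<le> real (length ((v, w, c) # h)) + spoken ((v, w, c) # h)"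
      unfolding spoken_Cons[OF val] sum_change_event[OF val, of "\<lambda>A. real (card A)"] using IH fin[of w]
      by (simp add: card_insert_if)
  next
    case (agree u)
    then show "(\<Sum>x\<in>V. real (card (history_vocab ((v, w, c) # h) x))) \<le> real (length ((v, w, c) # h)) + spoken ((v, w, c) # h)"
      unfolding spoken_Cons[OF val] sum_change_event[OF val, of "\<lambda>A. real (card A)"]
      using IH pos[of u v] pos[of u w] by auto
  next
    case (learn u)
    then show "(\<Sum>x\<in>V. real (card (history_vocab ((v, w, c) # h) x))) \<le> real (length ((v, w, c) # h)) + spoken ((v, w, c) # h)"
      unfolding spoken_Cons[OF val] sum_change_event[OF val, of "\<lambda>A. real (card A)"]
      using IH fin[of w] by (auto simp: card_insert_if)
  qed
qed (simp add: spoken_def)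

text \<open>
  The number of vertices that entered the game as speakers minus the number of those that entered as
  listeners.
\<close>

primrec spoken_excess :: "event list \<Rightarrow> real" where
  "spoken_excess [] = 0"
| "spoken_excess (e # h) = spoken_excess h + of_bool (history_vocab h (fst e) = {})
     - of_bool (history_vocab h (fst (snd e)) = {})"

lemma twice_inventions: "valid h \<Longrightarrow> 2 * real (inventions h) = spoken h + spoken_excess h"
proof (induction h)
  case (Cons e h)
  obtain v w c where e: "e = (v, w, c)" by (cases e) auto
  have val: "valid ((v, w, c) # h)" and vh: "valid h" using Cons.prems by (simp_all add: e valid_Cons)
  show ?case unfolding e spoken_Cons[OF val] using Cons.IH[OF vh] by simp
qed (simp add: spoken_def)

lemma words_le_inventions: "valid h \<Longrightarrow> card (\<Union>x\<in>V. history_vocab h x) \<le> inventions h"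
proof (induction h)
  case (Cons e h)
  obtain v w c where e: "e = (v, w, c)" by (cases e) auto
  have val: "valid ((v, w, c) # h)" and vh: "valid h" using Cons.prems by (simp_all add: e valid_Cons)
  have vw: "v \<in> V" "w \<in> V" using val unfolding valid_Cons mem_event by blast+
  let ?U = "\<Union>x\<in>V. history_vocab h x" and ?U' = "\<Union>x\<in>V. history_vocab ((v, w, c) # h) x"
  have fin: "finite ?U" using finite_history_vocab[OF vh] by simp
  note IH = Cons.IH[OF vh]
  have hU: "history_vocab h v \<subseteq> ?U" "history_vocab h w \<subseteq> ?U" using vw by (blast intro: UN_I)+
  have sub: "?U' \<subseteq> B" if B: "?U \<subseteq> B" "history_vocab ((v, w, c) # h) v \<subseteq> B"
      "history_vocab ((v, w, c) # h) w \<subseteq> B" for B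
  proof (rule UN_least)
    fix x assume x: "x \<in> V"
    show "history_vocab ((v, w, c) # h) x \<subseteq> B"
    proof (cases "x = v \<or> x = w")
      case True
      then show ?thesis using B(2,3) by (elim disjE) simp_all
    next
      case False
      then have "history_vocab ((v, w, c) # h) x = history_vocab h x"
        unfolding history_vocab_Cons by (intro interact_other) simp_all
      also have "\<dots> \<subseteq> ?U" using x by (rule UN_upper)
      finally show ?thesis using B(1) by (rule subset_trans)
    qed
  qed
  show ?case unfolding e using val
  proof (cases rule: event_cases)
    case silent
    have "?U' \<subseteq> insert v ?U"
    proof (rule sub)
      show "history_vocab ((v, w, c) # h) v \<subseteq> insert v ?U" unfolding silent(3) by simp
      show "history_vocab ((v, w, c) # h) w \<subseteq> insert v ?U" unfolding silent(4) using hU(2) by (rule Set.insert_mono)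
    qed (rule subset_insertI)
    then have "card ?U' \<le> card (insert v ?U)" by (rule card_mono[OF finite.insertI[OF fin]])
    also have "\<dots> \<le> Suc (card ?U)" by (rule card_insert_le_m1) simp_all
    finally show "card ?U' \<le> inventions ((v, w, c) # h)" using IH silent(1) by simp
  next
    case (agree u)
    have "?U' \<subseteq> ?U"
    proof (rule sub)
      have "{u} \<subseteq> ?U" using agree(2) hU(1) by blast
      then show "history_vocab ((v, w, c) # h) v \<subseteq> ?U" "history_vocab ((v, w, c) # h) w \<subseteq> ?U"
        unfolding agree(4,5) by assumption+
    qed (rule subset_refl)
    then have "card ?U' \<le> card ?U" by (rule card_mono[OF fin])
    then show "card ?U' \<le> inventions ((v, w, c) # h)" using IH by simp
  next
    case (learn u)
    have "?U' \<subseteq> ?U"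
    proof (rule sub)
      show "history_vocab ((v, w, c) # h) v \<subseteq> ?U" unfolding learn(4) by (rule hU(1))
      show "history_vocab ((v, w, c) # h) w \<subseteq> ?U" unfolding learn(5) using learn(2) hU by blast
    qed (rule subset_refl)
    then have "card ?U' \<le> card ?U" by (rule card_mono[OF fin])
    then show "card ?U' \<le> inventions ((v, w, c) # h)" using IH by simp
  qed
qed simp

text \<open>
  The inventors that still have their own word.
\<close>

definition keepers :: "event list \<Rightarrow> nat set" where
  "keepers h = {x\<in>V. x \<in> history_vocab h x}"

text \<open>
  Only the two participants of an agreement can lose their own word.
\<close>

lemma inventions_le_keepers: "valid h \<Longrightarrow> inventions h \<le> card (keepers h) + 2 * agreements h"
proof (induction h)
  case (Cons e h)
  obtain v w c where e: "e = (v, w, c)" by (cases e) auto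
  have val: "valid ((v, w, c) # h)" and vh: "valid h" using Cons.prems by (simp_all add: e valid_Cons)
  have vw: "v \<in> V" "w \<in> V" "v \<noteq> w" using val unfolding valid_Cons mem_event by blast+
  have fin: "finite (keepers h)" for h by (simp add: keepers_def)
  note IH = Cons.IH[OF vh]
  have oth: "x \<in> keepers ((v, w, c) # h) \<longleftrightarrow> x \<in> keepers h" if "x \<noteq> v" "x \<noteq> w" for x
    using that interact_other[of x v w c "history_vocab h"] by (simp add: keepers_def history_vocab_Cons)
  show ?case unfolding e using val
  proof (cases rule: event_cases)
    case silent
    have "insert v (keepers h) \<subseteq> keepers ((v, w, c) # h)"
    proof
      fix x assume "x \<in> insert v (keepers h)"
      then show "x \<in> keepers ((v, w, c) # h)"
        using silent(3,4) vw(1) oth[of x] unfolding keepers_def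
        by (cases "x = v"; cases "x = w") simp_all
    qed
    then have "card (insert v (keepers h)) \<le> card (keepers ((v, w, c) # h))" using fin by (intro card_mono)
    moreover have "v \<notin> keepers h" using silent by (simp add: keepers_def)
    ultimately show "inventions ((v, w, c) # h) \<le> card (keepers ((v, w, c) # h)) + 2 * agreements ((v, w, c) # h)"
      using IH silent(1,5) fin[of h] by simp
  next
    case (agree u)
    have "keepers h \<subseteq> keepers ((v, w, c) # h) \<union> {v, w}"
    proof
      fix x assume "x \<in> keepers h"
      then show "x \<in> keepers ((v, w, c) # h) \<union> {v, w}"
        using oth[of x] by (cases "x = v"; cases "x = w") simp_all
    qed
    then have "card (keepers h) \<le> card (keepers ((v, w, c) # h) \<union> {v, w})"
      by (rule card_mono[rotated]) (simp add: fin)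
    moreover have "card (keepers ((v, w, c) # h) \<union> {v, w}) \<le> card (keepers ((v, w, c) # h)) + card {v, w}"
      by (rule card_Un_le)
    moreover have "card {v, w} = 2" using vw by simp
    ultimately have le: "card (keepers h) \<le> card (keepers ((v, w, c) # h)) + 2" by linarith
    show "inventions ((v, w, c) # h) \<le> card (keepers ((v, w, c) # h)) + 2 * agreements ((v, w, c) # h)"
    proof -
      have "history_vocab h v \<noteq> {}" using agree(2) by blast
      then show ?thesis using IH agree(6) le by simp
    qed
  next
    case (learn u)
    have "keepers h \<subseteq> keepers ((v, w, c) # h)"
    proof
      fix x assume "x \<in> keepers h"
      then have x: "x \<in> V" "x \<in> history_vocab h x" unfolding keepers_def by blast+
      have "x \<in> history_vocab ((v, w, c) # h) x"
      proof (cases "x = v \<or> x = w")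
        case True
        then show ?thesis
        proof
          assume "x = v"
          then show ?thesis using x(2) learn(4) by simp
        next
          assume "x = w"
          then show ?thesis using x(2) learn(5) by simp
        qed
      next
        case False
        then have "history_vocab ((v, w, c) # h) x = history_vocab h x"
          unfolding history_vocab_Cons by (intro interact_other) blast+
        then show ?thesis using x(2) by (rule ssubst)
      qed
      then show "x \<in> keepers ((v, w, c) # h)" using x(1) unfolding keepers_def by blast
    qed
    then have "card (keepers h) \<le> card (keepers ((v, w, c) # h))" using fin by (intro card_mono)
    moreover have "history_vocab h v \<noteq> {}" using learn(2) by blast
    ultimately show "inventions ((v, w, c) # h) \<le> card (keepers ((v, w, c) # h)) + 2 * agreements ((v, w, c) # h)"
      using IH learn(6) by simp
  qed
qed simp

lemma inventions_le_words:
  assumes "valid h"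
  shows "inventions h \<le> card (\<Union>x\<in>V. history_vocab h x) + 2 * agreements h"
proof -
  have "keepers h \<subseteq> (\<Union>x\<in>V. history_vocab h x)" by (auto simp: keepers_def)
  then have "card (keepers h) \<le> card (\<Union>x\<in>V. history_vocab h x)"
    using finite_history_vocab[OF assms] by (intro card_mono) auto
  then show ?thesis using inventions_le_keepers[OF assms] by linarith
qed

end

section \<open>How many words are invented\<close>

text \<open>
  The chance that a speaker with vocabulary \<open>A\<close> says \<open>u\<close>; it is \<open>0\<close> for the empty
  vocabulary.
\<close>

definition word_weight :: "nat \<Rightarrow> nat set \<Rightarrow> real" where
  "word_weight u A = (if u \<in> A then 1 / real (card A) else 0)"

text \<open>
  A uniform choice function has independent uniform values.
\<close>

lemma uniform_choice_component:
  fixes n :: nat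
  assumes "A \<subseteq> {1..n}" "A \<noteq> {}"
  shows "map_pmf (\<lambda>c. c A) (pmf_of_set (\<Pi>\<^sub>E A \<in> Pow {1..n} - {{}}. A)) = pmf_of_set A"
proof -
  have fin: "finite B" if "B \<in> Pow {1..n} - {{}}" for B :: "nat set"
    using that finite_subset[of B "{1..n}"] finite_atLeastAtMost by blast
  have "(\<Pi>\<^sub>E A \<in> Pow {1..n} - {{}}. A) = PiE_dflt (Pow {1..n} - {{}}) undefined (\<lambda>A. A)"
    by (auto simp: PiE_dflt_def PiE_def extensional_def)
  moreover have "Pi_pmf (Pow {1..n} - {{}}) undefined (\<lambda>A. pmf_of_set A) = pmf_of_set (PiE_dflt (Pow {1..n} - {{}}) undefined (\<lambda>A. A))"
    by (rule Pi_pmf_of_set) (use fin in auto)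
  moreover have "map_pmf (\<lambda>c. c A) (Pi_pmf (Pow {1..n} - {{}}) undefined (\<lambda>A. pmf_of_set A)) = pmf_of_set A"
    by (subst Pi_pmf_component) (use assms in auto)
  ultimately show ?thesis by simp
qed

context naming_game
begin

abbreviation "E \<equiv> measure_pmf.expectation p"

definition choice_avg :: "((nat set \<Rightarrow> nat) \<Rightarrow> real) \<Rightarrow> real" where
  "choice_avg g = measure_pmf.expectation (pmf_of_set (\<Pi>\<^sub>E A \<in> Pow V - {{}}. A)) g"

lemma choice_avg_word:
  assumes "A \<subseteq> V" "A \<noteq> {}"
  shows "choice_avg (\<lambda>c. g (c A)) = (\<Sum>u\<in>A. g u) / real (card A)"
proof -
  have "finite A" using assms finite_subset by blast
  then have "measure_pmf.expectation (pmf_of_set A) g = (\<Sum>u\<in>A. g u) / real (card A)"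
    using assms by (intro integral_pmf_of_set) auto
  moreover have "choice_avg (\<lambda>c. g (c A)) = measure_pmf.expectation (map_pmf (\<lambda>c. c A) (pmf_of_set (\<Pi>\<^sub>E A \<in> Pow V - {{}}. A))) g"
    unfolding choice_avg_def by simp
  ultimately show ?thesis unfolding uniform_choice_component[OF assms] by simp
qed

lemma choice_avg_const [simp]: "choice_avg (\<lambda>_. a) = a"
  unfolding choice_avg_def by simp

lemma choice_avg_cmult: "choice_avg (\<lambda>c. g c * a) = choice_avg g * a"
  unfolding choice_avg_def by simp

lemma E_event: "E F = (\<Sum>v\<in>V. \<Sum>w\<in>V - {v}. choice_avg (\<lambda>c. F (v, w, c))) / (real n * (real n - 1))"
proof -
  let ?C = "\<Pi>\<^sub>E A \<in> Pow V - {{}}. A"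
  have neV: "V \<noteq> {}" using two_le by simp
  have ne: "V - {v} \<noteq> {}" for v
  proof -
    have "card {v} < card V" using two_le by simp
    then show ?thesis using card_mono[of "{v}" V] by (meson Diff_eq_empty_iff finite.emptyI finite_insert not_less)
  qed
  have finC: "finite (set_pmf (pmf_of_set ?C))"
    using finite_choices choices_nonempty by (simp add: set_pmf_of_set)
  have finV: "finite (set_pmf (pmf_of_set (V - {v})))" for v
    using ne by (simp add: set_pmf_of_set)
  have pair: "measure_pmf.expectation (pair_pmf (pmf_of_set (V - {v})) (pmf_of_set ?C)) G
      = (\<Sum>w\<in>V - {v}. choice_avg (\<lambda>c. G (w, c))) / (real n - 1)" if "v \<in> V" for v and G :: "nat \<times> (nat set \<Rightarrow> nat) \<Rightarrow> real"
  proof -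
    have "measure_pmf.expectation (pair_pmf (pmf_of_set (V - {v})) (pmf_of_set ?C)) G
        = measure_pmf.expectation (pmf_of_set (V - {v})) (\<lambda>w. measure_pmf.expectation (map_pmf (Pair w) (pmf_of_set ?C)) G)"
      unfolding pair_pmf_def map_pmf_def[symmetric]
      by (rule expectation_bind_finite) (use finV finC in auto)
    also have "\<dots> = measure_pmf.expectation (pmf_of_set (V - {v})) (\<lambda>w. choice_avg (\<lambda>c. G (w, c)))"
      unfolding choice_avg_def by simp
    also have "\<dots> = (\<Sum>w\<in>V - {v}. choice_avg (\<lambda>c. G (w, c))) / real (card (V - {v}))"
      by (rule integral_pmf_of_set) (use ne in simp_all)
    also have "real (card (V - {v})) = real n - 1"
      using that two_le by (simp add: of_nat_diff)
    finally show ?thesis .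
  qed
  have "E F = measure_pmf.expectation (pmf_of_set V) (\<lambda>v. measure_pmf.expectation (map_pmf (Pair v) (pair_pmf (pmf_of_set (V - {v})) (pmf_of_set ?C))) F)"
    unfolding event_pmf_def
  proof (rule expectation_bind_finite)
    show "finite (set_pmf (pmf_of_set V))" using neV by (simp add: set_pmf_of_set)
    show "finite (set_pmf (map_pmf (Pair v) (pair_pmf (pmf_of_set (V - {v})) (pmf_of_set ?C))))" for v
      using finV[of v] finC by simp
  qed
  also have "\<dots> = (\<Sum>v\<in>V. measure_pmf.expectation (map_pmf (Pair v) (pair_pmf (pmf_of_set (V - {v})) (pmf_of_set ?C))) F) / real (card V)"
    by (rule integral_pmf_of_set) (use neV in simp_all)
  also have "(\<Sum>v\<in>V. measure_pmf.expectation (map_pmf (Pair v) (pair_pmf (pmf_of_set (V - {v})) (pmf_of_set ?C))) F)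
      = (\<Sum>v\<in>V. (\<Sum>w\<in>V - {v}. choice_avg (\<lambda>c. F (v, w, c))) / (real n - 1))"
  proof (intro sum.cong refl)
    fix v assume "v \<in> V"
    from pair[OF this, of "\<lambda>m. F (v, m)"]
    show "measure_pmf.expectation (map_pmf (Pair v) (pair_pmf (pmf_of_set (V - {v})) (pmf_of_set ?C))) F
        = (\<Sum>w\<in>V - {v}. choice_avg (\<lambda>c. F (v, w, c))) / (real n - 1)"
      unfolding integral_map_pmf .
  qed
  also have "\<dots> / real (card V) = (\<Sum>v\<in>V. \<Sum>w\<in>V - {v}. choice_avg (\<lambda>c. F (v, w, c))) / (real n * (real n - 1))"
    by (simp add: sum_divide_distrib[symmetric] mult.commute)
  finally show ?thesis .
qed

lemma integrable_p [simp]: "integrable (measure_pmf p) (F :: _ \<Rightarrow> real)"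
  by (rule integrable_measure_pmf_finite[OF finite_p])

lemma E_mono:
  fixes F G :: "event \<Rightarrow> real"
  assumes "\<And>v w c. (v, w, c) \<in> set_pmf p \<Longrightarrow> F (v, w, c) \<le> G (v, w, c)"
  shows "E F \<le> E G"
proof (rule expectation_mono_pmf[OF finite_p])
  fix e assume e: "e \<in> set_pmf p"
  obtain v w c where "e = (v, w, c)" by (cases e) auto
  then show "F e \<le> G e" using assms e by blast
qed

lemma sum_other: "v \<in> V \<Longrightarrow> (\<Sum>w\<in>V - {v}. f w) = (\<Sum>w\<in>V. f w) - (f v :: real)"
  by (simp add: sum_diff1)

lemma sum_pairs_swap: "(\<Sum>v\<in>V. \<Sum>w\<in>V - {v}. f v w) = (\<Sum>w\<in>V. \<Sum>v\<in>V - {w}. (f v w :: real))"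
proof -
  have "(\<Sum>v\<in>V. \<Sum>w\<in>V - {v}. f v w) = (\<Sum>v\<in>V. \<Sum>w\<in>V. f v w) - (\<Sum>v\<in>V. f v v)"
    unfolding sum_subtractf[symmetric] by (intro sum.cong refl sum_other)
  also have "(\<Sum>v\<in>V. \<Sum>w\<in>V. f v w) = (\<Sum>w\<in>V. \<Sum>v\<in>V. f v w)" by (rule sum.swap)
  also have "\<dots> - (\<Sum>v\<in>V. f v v) = (\<Sum>w\<in>V. \<Sum>v\<in>V - {w}. f v w)"
    unfolding sum_subtractf[symmetric] by (intro sum.cong refl sum_other[symmetric])
  finally show ?thesis .
qed

lemma card_others: "v \<in> V \<Longrightarrow> real (card (V - {v})) = real n - 1"
  using two_le by (simp add: of_nat_diff)

lemma E_speaker: "E (\<lambda>e. g (fst e)) = (\<Sum>v\<in>V. g v) / real n"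
proof -
  have "(\<Sum>v\<in>V. \<Sum>w\<in>V - {v}. g v) = (\<Sum>v\<in>V. (real n - 1) * g v)"
    using card_others by (intro sum.cong refl) (simp only: sum_constant)
  also have "\<dots> = (\<Sum>v\<in>V. g v) * (real n - 1)" by (simp add: sum_distrib_left mult.commute)
  finally have "E (\<lambda>e. g (fst e)) = (\<Sum>v\<in>V. g v) * (real n - 1) / (real n * (real n - 1))"
    unfolding E_event by simp
  then show ?thesis using two_le by simp
qed

lemma E_listener: "E (\<lambda>e. g (fst (snd e))) = (\<Sum>w\<in>V. g w) / real n"
proof -
  have "(\<Sum>v\<in>V. \<Sum>w\<in>V - {v}. g w) = (\<Sum>w\<in>V. \<Sum>v\<in>V - {w}. g w)" by (rule sum_pairs_swap)
  then have "E (\<lambda>e. g (fst (snd e))) = E (\<lambda>e. g (fst e))" unfolding E_event by simp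
  then show ?thesis by (simp only: E_speaker)
qed

lemma spoken_Nil: "spoken [] = 0"
  by (simp add: spoken_def)

lemma unspoken_sum: "(\<Sum>x\<in>V. of_bool (history_vocab h x = {})) = real n - spoken h"
proof -
  have "(\<Sum>x\<in>V. of_bool (history_vocab h x = {})) + spoken h = (\<Sum>x\<in>V. 1)"
    unfolding spoken_def sum.distrib[symmetric] by (intro sum.cong refl) simp
  then show ?thesis by simp
qed

text \<open>
  Speaker and listener have the same distribution, so the excess is a martingale; its square grows by
  at most the number of vertices that enter.
\<close>

lemma drift_spoken_excess:
  assumes h: "valid h"
  shows "E (\<lambda>e. (spoken_excess (e # h))\<^sup>2 - spoken (e # h)) \<le> (spoken_excess h)\<^sup>2 - spoken h"
proof -
  let ?W = "history_vocab h" and ?Z = "spoken_excess h"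
  define g where "g x = 2 * ?Z * of_bool (?W x = {})" for x
  have "E (\<lambda>e. (spoken_excess (e # h))\<^sup>2 - spoken (e # h)) \<le> E (\<lambda>e. (?Z\<^sup>2 - spoken h) + (g (fst e) - g (fst (snd e))))"
  proof (rule E_mono)
    fix v w c assume e: "(v, w, c) \<in> set_pmf p"
    have val: "valid ((v, w, c) # h)" using e h by (simp add: valid_Cons)
    define s l where "s = (of_bool (?W v = {}) :: real)" and "l = (of_bool (?W w = {}) :: real)"
    have sl: "0 \<le> s * l" "s\<^sup>2 = s" "l\<^sup>2 = l" by (simp_all add: s_def l_def power2_eq_square)
    have "(?Z + s - l)\<^sup>2 = ?Z\<^sup>2 + 2 * ?Z * s - 2 * ?Z * l + s\<^sup>2 + l\<^sup>2 - 2 * (s * l)"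
      by (simp add: power2_eq_square algebra_simps)
    then have "(?Z + s - l)\<^sup>2 - (spoken h + s + l) \<le> ?Z\<^sup>2 - spoken h + (2 * ?Z * s - 2 * ?Z * l)"
      unfolding sl(2,3) using sl(1) by linarith
    then show "(spoken_excess ((v, w, c) # h))\<^sup>2 - spoken ((v, w, c) # h)
      \<le> (?Z\<^sup>2 - spoken h) + (g (fst (v, w, c)) - g (fst (snd (v, w, c))))"
      unfolding spoken_Cons[OF val] by (simp add: s_def l_def g_def)
  qed
  also have "\<dots> = (?Z\<^sup>2 - spoken h) + (E (\<lambda>e. g (fst e)) - E (\<lambda>e. g (fst (snd e))))"
    by simp
  also have "\<dots> = ?Z\<^sup>2 - spoken h" unfolding E_speaker E_listener by simp
  finally show ?thesis .
qed

text \<open>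
  Each vertex that has not entered does so at a ring with probability \<open>2 / n\<close>.
\<close>

lemma drift_unspoken:
  assumes h: "valid h"
  shows "E (\<lambda>e. (real n - spoken (e # h)) * exp (2 * real (length (e # h)) / real n))
    \<le> (real n - spoken h) * exp (2 * real (length h) / real n)"
proof -
  let ?W = "history_vocab h"
  define q where "q = exp (2 * real (length h) / real n)"
  define r where "r = exp (2 / real n)"
  define g where "g x = (of_bool (?W x = {}) :: real)" for x
  have gs: "(\<Sum>x\<in>V. g x) = real n - spoken h" unfolding g_def by (rule unspoken_sum)
  have ex: "exp (2 * real (length (e # h)) / real n) = q * r" for e :: event
    unfolding q_def r_def exp_add[symmetric] by (simp add: add_divide_distrib)
  have "E (\<lambda>e. (real n - spoken (e # h)) * exp (2 * real (length (e # h)) / real n))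
      \<le> E (\<lambda>e. ((real n - spoken h) - (g (fst e) + g (fst (snd e)))) * (q * r))"
  proof (rule E_mono)
    fix v w c assume e: "(v, w, c) \<in> set_pmf p"
    have val: "valid ((v, w, c) # h)" using e h by (simp add: valid_Cons)
    show "(real n - spoken ((v, w, c) # h)) * exp (2 * real (length ((v, w, c) # h)) / real n)
      \<le> ((real n - spoken h) - (g (fst (v, w, c)) + g (fst (snd (v, w, c))))) * (q * r)"
      unfolding ex spoken_Cons[OF val] by (simp add: g_def algebra_simps)
  qed
  also have "\<dots> = ((real n - spoken h) - (E (\<lambda>e. g (fst e)) + E (\<lambda>e. g (fst (snd e))))) * (q * r)"
    by simp
  also have "E (\<lambda>e. g (fst e)) = (real n - spoken h) / real n"
    unfolding E_speaker gs by (rule refl)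
  also have "E (\<lambda>e. g (fst (snd e))) = (real n - spoken h) / real n"
    unfolding E_listener gs by (rule refl)
  also have "((real n - spoken h) - ((real n - spoken h) / real n + (real n - spoken h) / real n)) * (q * r)
      = (real n - spoken h) * q * ((1 - 2 / real n) * r)"
    by (simp add: field_simps)
  also have "\<dots> \<le> (real n - spoken h) * q * 1"
  proof (rule mult_left_mono)
    have "1 - 2 / real n \<le> exp (- (2 / real n))" using exp_ge_add_one_self[of "- (2 / real n)"] by simp
    then have "(1 - 2 / real n) * r \<le> exp (- (2 / real n)) * r" by (rule mult_right_mono) (simp add: r_def)
    also have "\<dots> = 1" unfolding r_def exp_add[symmetric] by simp
    finally show "(1 - 2 / real n) * r \<le> 1" .
    show "0 \<le> (real n - spoken h) * q" using spoken_le(2)[of h] by (simp add: q_def)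
  qed
  finally show ?thesis by (simp add: q_def)
qed

text \<open>
  Twice the number of inventions is the number of vertices that have entered plus the excess of
  speakers over listeners. Chebyshev's inequality bounds the latter, Markov's inequality the number
  of vertices that have not entered.
\<close>

lemma inventions_concentration:
  assumes \<delta>: "0 < \<delta>"
  shows "measure_pmf.prob (replicate_pmf m p) {h. \<delta> * real n < \<bar>real (inventions h) - real n / 2\<bar>}
    \<le> 1 / (\<delta>\<^sup>2 * real n) + exp (- 2 * real m / real n) / \<delta>"
proof -
  let ?R = "replicate_pmf m p"
  have fin: "finite (set_pmf ?R)" by (rule finite_set_replicate_event_pmf[OF two_le])
  have val: "valid h" "length h = m" if "h \<in> set_pmf ?R" for h
    using that by (auto simp: set_replicate_pmf valid_def)
  have n: "0 < real n" using two_le by simp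
  have int: "integrable (measure_pmf ?R) (f :: _ \<Rightarrow> real)" for f by (rule integrable_measure_pmf_finite[OF fin])
  have "measure_pmf.expectation ?R (\<lambda>h. (spoken_excess h)\<^sup>2 - spoken h) \<le> (spoken_excess [])\<^sup>2 - spoken []"
    using expectation_stopped_le[OF finite_p, of m "\<lambda>_. False" "\<lambda>h. (spoken_excess h)\<^sup>2 - spoken h"] drift_spoken_excess
    unfolding stopped_pmf_never by (auto simp: valid_def)
  then have "measure_pmf.expectation ?R (\<lambda>h. (spoken_excess h)\<^sup>2) \<le> measure_pmf.expectation ?R spoken"
    by (simp add: int spoken_Nil)
  also have "\<dots> \<le> measure_pmf.expectation ?R (\<lambda>_. real n)"
    by (rule expectation_mono_pmf[OF fin]) (rule spoken_le(2))
  finally have Z2: "measure_pmf.expectation ?R (\<lambda>h. (spoken_excess h)\<^sup>2) \<le> real n" by simp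
  have PZ: "measure_pmf.prob ?R {h. \<delta> * real n < \<bar>spoken_excess h\<bar>} \<le> 1 / (\<delta>\<^sup>2 * real n)"
  proof -
    have "measure_pmf.prob ?R {h. \<delta> * real n < \<bar>spoken_excess h\<bar>} \<le> measure_pmf.expectation ?R (\<lambda>h. (spoken_excess h)\<^sup>2) / (\<delta> * real n)\<^sup>2"
    proof (rule markov_pmf[OF fin])
      show "0 < (\<delta> * real n)\<^sup>2" using \<delta> n by simp
      show "(\<delta> * real n)\<^sup>2 \<le> (spoken_excess h)\<^sup>2" if "\<delta> * real n < \<bar>spoken_excess h\<bar>" for h
        using power_mono[of "\<delta> * real n" "\<bar>spoken_excess h\<bar>" 2] that \<delta> n by simp
    qed simp
    also have "\<dots> \<le> real n / (\<delta> * real n)\<^sup>2" using Z2 by (rule divide_right_mono) simp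
    also have "\<dots> = 1 / (\<delta>\<^sup>2 * real n)" using n by (simp add: power2_eq_square)
    finally show ?thesis .
  qed
  have "measure_pmf.expectation ?R (\<lambda>h. (real n - spoken h) * exp (2 * real (length h) / real n)) \<le> (real n - spoken []) * exp (2 * real (length ([] :: event list)) / real n)"
    using expectation_stopped_le[OF finite_p, of m "\<lambda>_. False" "\<lambda>h. (real n - spoken h) * exp (2 * real (length h) / real n)"] drift_unspoken
    unfolding stopped_pmf_never by (auto simp: valid_def)
  moreover have "measure_pmf.expectation ?R (\<lambda>h. (real n - spoken h) * exp (2 * real (length h) / real n))
      = measure_pmf.expectation ?R (\<lambda>h. (real n - spoken h) * exp (2 * real m / real n))"
    by (rule integral_cong_AE) (auto intro!: AE_pmfI simp: val)
  ultimately have "measure_pmf.expectation ?R (\<lambda>h. real n - spoken h) * exp (2 * real m / real n) \<le> real n"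
    by (simp add: spoken_Nil)
  then have Ue: "measure_pmf.expectation ?R (\<lambda>h. real n - spoken h) \<le> real n * exp (- 2 * real m / real n)"
    by (simp add: exp_minus field_simps)
  have PU: "measure_pmf.prob ?R {h. \<delta> * real n < real n - spoken h} \<le> exp (- 2 * real m / real n) / \<delta>"
  proof -
    have "measure_pmf.prob ?R {h. \<delta> * real n < real n - spoken h} \<le> measure_pmf.expectation ?R (\<lambda>h. real n - spoken h) / (\<delta> * real n)"
      by (rule markov_pmf[OF fin]) (use spoken_le(2) \<delta> n in auto)
    also have "\<dots> \<le> real n * exp (- 2 * real m / real n) / (\<delta> * real n)"
      using Ue \<delta> n by (intro divide_right_mono) auto
    also have "\<dots> = exp (- 2 * real m / real n) / \<delta>" using n by simp
    finally show ?thesis .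
  qed
  have "measure_pmf.prob ?R {h. \<delta> * real n < \<bar>real (inventions h) - real n / 2\<bar>}
      \<le> measure_pmf.prob ?R ({h. \<delta> * real n < \<bar>spoken_excess h\<bar>} \<union> {h. \<delta> * real n < real n - spoken h})"
  proof (rule measure_pmf.finite_measure_mono_AE)
    show "AE h in ?R. h \<in> {h. \<delta> * real n < \<bar>real (inventions h) - real n / 2\<bar>} \<longrightarrow>
      h \<in> {h. \<delta> * real n < \<bar>spoken_excess h\<bar>} \<union> {h. \<delta> * real n < real n - spoken h}"
    proof (rule AE_pmfI)
      fix h assume "h \<in> set_pmf ?R"
      from twice_inventions[OF val(1)[OF this]] spoken_le(2)[of h]
      have "\<bar>real (inventions h) - real n / 2\<bar> \<le> max \<bar>spoken_excess h\<bar> (real n - spoken h)" by linarith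
      then show "h \<in> {h. \<delta> * real n < \<bar>real (inventions h) - real n / 2\<bar>} \<longrightarrow>
        h \<in> {h. \<delta> * real n < \<bar>spoken_excess h\<bar>} \<union> {h. \<delta> * real n < real n - spoken h}" by auto
    qed
  qed simp
  also have "\<dots> \<le> measure_pmf.prob ?R {h. \<delta> * real n < \<bar>spoken_excess h\<bar>} + measure_pmf.prob ?R {h. \<delta> * real n < real n - spoken h}"
    by (rule measure_Un_le) simp_all
  also have "\<dots> \<le> 1 / (\<delta>\<^sup>2 * real n) + exp (- 2 * real m / real n) / \<delta>" using PZ PU by (rule add_mono)
  finally show ?thesis .
qed

end

section \<open>Vocabulary sizes and the rate of agreements\<close>

text \<open>
  The tangent at \<open>y\<close> of the convex function \<open>1 / a\<close>.
\<close>

lemma one_sub_le_inverse: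
  assumes "0 < a" "0 < (y::real)" shows "2 / y - a / y\<^sup>2 \<le> 1 / a"
proof -
  have "0 \<le> (y - a)\<^sup>2 / (a * y\<^sup>2)" using assms by simp
  also have "\<dots> = 1 / a - (2 / y - a / y\<^sup>2)"
    using assms by (simp add: field_simps power2_eq_square)
  finally show ?thesis by simp
qed

lemma harm_le_ln: "harm k \<le> 1 + ln (real k + 1)"
proof -
  have "harm (Suc k) \<le> 1 + ln (real (Suc k))" for k
  proof (induction k)
    case 0
    show ?case by (simp add: harm_def)
  next
    case (Suc k)
    have "1 / real (Suc (Suc k)) \<le> ln (real (Suc (Suc k))) - ln (real (Suc k))"
    proof -
      have "ln (real (Suc k) / real (Suc (Suc k))) \<le> real (Suc k) / real (Suc (Suc k)) - 1"
        by (rule ln_le_minus_one) simp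
      moreover have "ln (real (Suc k) / real (Suc (Suc k))) = ln (real (Suc k)) - ln (real (Suc (Suc k)))"
        by (rule ln_divide_pos) simp_all
      moreover have "real (Suc k) / real (Suc (Suc k)) - 1 = - (1 / real (Suc (Suc k)))"
        by (simp add: field_simps)
      ultimately show ?thesis by linarith
    qed
    then show ?case using Suc.IH by (simp add: harm_Suc[of "Suc k"] inverse_eq_divide)
  qed
  then show ?thesis
  proof (cases k)
    case (Suc j)
    have "ln (real (Suc j)) \<le> ln (real (Suc j) + 1)" by (subst ln_le_cancel_iff) simp_all
    then show ?thesis using \<open>\<And>k. harm (Suc k) \<le> 1 + ln (real (Suc k))\<close>[of j] unfolding Suc by linarith
  qed (simp add: harm_def)
qed

context naming_game
begin

abbreviation vsize :: "event list \<Rightarrow> nat \<Rightarrow> real" where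
  "vsize h x \<equiv> real (card (history_vocab h x))"

definition holders :: "nat \<Rightarrow> event list \<Rightarrow> real" where
  "holders u h = (\<Sum>x\<in>V. of_bool (u \<in> history_vocab h x))"

definition word_rate :: "nat \<Rightarrow> event list \<Rightarrow> real" where
  "word_rate u h = (\<Sum>x\<in>V. word_weight u (history_vocab h x))"

text \<open>
  Before the word \<open>u\<close> is invented the potential is \<open>2\<close>, the largest value that its rate can take
  just after the invention. So an invention never increases the potential.
\<close>

definition word_potential :: "nat \<Rightarrow> event list \<Rightarrow> real" where
  "word_potential u h = (if history_vocab h u = {} then 2 else word_rate u h)"

text \<open>
  The mean of \<open>1 / (L + 1)\<close> for the vocabulary size \<open>L\<close> of the listener, divided by \<open>n\<close>, the number
  of rings per unit of time.
\<close>

definition exposure_step :: "event list \<Rightarrow> real" where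
  "exposure_step h = (\<Sum>x\<in>V. 1 / (vsize h x + 1)) / (real n)\<^sup>2"

primrec exposure :: "event list \<Rightarrow> real" where
  "exposure [] = 0"
| "exposure (e # h) = exposure h + exposure_step h"

definition exposure_excess :: "event list \<Rightarrow> real" where
  "exposure_excess h = exposure h - ln ((real (length h) + 2 * real n) / (2 * real n))"

lemma n_pos: "0 < real n" "0 < real n - 1"
  using two_le by simp_all

lemma vsize_pos: "valid h \<Longrightarrow> u \<in> history_vocab h x \<Longrightarrow> 1 \<le> vsize h x"
  using finite_history_vocab[of h x] card_gt_0_iff[of "history_vocab h x"] by force

lemma vsize_le: "valid h \<Longrightarrow> card (history_vocab h x) \<le> n"
  using card_mono[OF _ history_vocab_subset[of h x]] by simp

lemma vsize_growth:
  assumes "valid ((v, w, c) # h)"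
  shows "max (vsize ((v, w, c) # h) x) 1 \<le> max (vsize h x) 1 + of_bool (w = x)"
proof -
  have vh: "valid h" and ne: "v \<noteq> w" using assms unfolding valid_Cons mem_event by blast+
  have ins: "real (card (insert u (history_vocab h w))) \<le> vsize h w + 1" for u
    using finite_history_vocab[OF vh, of w] by (simp add: card_insert_if)
  have key: "max a 1 \<le> max b 1 + 1" if "a \<le> b + 1" for a b :: real
    using that by (simp add: max_def)
  consider "x = v" | "x = w" | "x \<noteq> v" "x \<noteq> w" by blast
  then show ?thesis
  proof cases
    case 1
    show ?thesis using assms by (cases rule: event_cases) (simp_all add: 1 ne[symmetric])
  next
    case 2
    show ?thesis using assms
    proof (cases rule: event_cases)
      case silent
      show ?thesis unfolding 2 silent(4) using key[OF ins[of v]] by (simp only: of_bool_eq refl)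
    next
      case (agree u)
      then show ?thesis using 2 by simp
    next
      case (learn u)
      show ?thesis unfolding 2 learn(5) using key[OF ins[of u]] by (simp only: of_bool_eq refl)
    qed
  next
    case 3
    then show ?thesis by (simp add: history_vocab_Cons interact_other)
  qed
qed

lemma exp_le_quadratic: "0 \<le> \<theta> \<Longrightarrow> \<theta> \<le> 1 \<Longrightarrow> exp \<theta> - 1 \<le> (1 + \<theta>) * \<theta>" for \<theta> :: real
  using exp_bound[of \<theta>] by (simp add: power2_eq_square algebra_simps)

text \<open>
  A vocabulary grows only when its owner listens, which has probability \<open>1 / n\<close>. The maximum with
  \<open>1\<close> absorbs the word that a vertex invents for itself.
\<close>

lemma drift_vsize:
  assumes h: "valid h" and \<theta>: "0 \<le> \<theta>" "\<theta> \<le> 1" and x: "x \<in> V"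
  shows "E (\<lambda>e. exp (\<theta> * max (vsize (e # h) x) 1 - (1 + \<theta>) * \<theta> * real (length (e # h)) / real n))
    \<le> exp (\<theta> * max (vsize h x) 1 - (1 + \<theta>) * \<theta> * real (length h) / real n)"
proof -
  define F where "F = exp (\<theta> * max (vsize h x) 1 - (1 + \<theta>) * \<theta> * real (length h) / real n)"
  define y where "y = (1 + \<theta>) * \<theta> / real n"
  define g where "g w = F * exp (- y) * (1 + of_bool (w = x) * (exp \<theta> - 1))" for w
  have "E (\<lambda>e. exp (\<theta> * max (vsize (e # h) x) 1 - (1 + \<theta>) * \<theta> * real (length (e # h)) / real n)) \<le> E (\<lambda>e. g (fst (snd e)))"
  proof (rule E_mono)
    fix v w c assume "(v, w, c) \<in> set_pmf p"
    then have val: "valid ((v, w, c) # h)" using h by (simp add: valid_Cons)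
    have "\<theta> * max (vsize ((v, w, c) # h) x) 1 \<le> \<theta> * (max (vsize h x) 1 + of_bool (w = x))"
      by (rule mult_left_mono[OF vsize_growth[OF val] \<theta>(1)])
    then have "exp (\<theta> * max (vsize ((v, w, c) # h) x) 1 - (1 + \<theta>) * \<theta> * real (length ((v, w, c) # h)) / real n)
        \<le> exp ((\<theta> * max (vsize h x) 1 - (1 + \<theta>) * \<theta> * real (length h) / real n) + (- y + \<theta> * of_bool (w = x)))"
      unfolding exp_le_cancel_iff y_def by (simp add: distrib_left add_divide_distrib)
    also have "\<dots> = F * (exp (- y) * exp (\<theta> * of_bool (w = x)))" unfolding F_def exp_add by (rule refl)
    also have "exp (\<theta> * of_bool (w = x)) = 1 + of_bool (w = x) * (exp \<theta> - 1)" by (cases "w = x") simp_all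
    finally show "exp (\<theta> * max (vsize ((v, w, c) # h) x) 1 - (1 + \<theta>) * \<theta> * real (length ((v, w, c) # h)) / real n)
        \<le> g (fst (snd (v, w, c)))" by (simp add: g_def mult.assoc)
  qed
  also have "\<dots> = (\<Sum>w\<in>V. g w) / real n" by (rule E_listener)
  also have "(\<Sum>w\<in>V. g w) = F * exp (- y) * (real n + (exp \<theta> - 1))"
  proof -
    have "(\<Sum>w\<in>V. of_bool (w = x) * (exp \<theta> - 1)) = (\<Sum>w\<in>V. if w = x then exp \<theta> - 1 else 0)"
      by (rule sum.cong) auto
    then have "(\<Sum>w\<in>V. 1 + of_bool (w = x) * (exp \<theta> - 1)) = real n + (exp \<theta> - 1)"
      using x by (simp add: sum.distrib)
    then show ?thesis unfolding g_def sum_distrib_left[symmetric] by simp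
  qed
  also have "F * exp (- y) * (real n + (exp \<theta> - 1)) / real n \<le> F * exp (- y) * (1 + y)"
  proof -
    have "(real n + (exp \<theta> - 1)) / real n \<le> 1 + y"
    proof -
      have "(exp \<theta> - 1) / real n \<le> y"
        unfolding y_def by (rule divide_right_mono[OF exp_le_quadratic[OF \<theta>]]) simp
      moreover have "(real n + (exp \<theta> - 1)) / real n = 1 + (exp \<theta> - 1) / real n"
        using n_pos by (simp add: add_divide_distrib)
      ultimately show ?thesis by simp
    qed
    then have "F * exp (- y) * ((real n + (exp \<theta> - 1)) / real n) \<le> F * exp (- y) * (1 + y)"
      by (rule mult_left_mono) (simp add: F_def)
    then show ?thesis by simp
  qed
  also have "\<dots> \<le> F * exp (- y) * exp y"
    by (rule mult_left_mono[OF exp_ge_add_one_self]) (simp add: F_def)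
  also have "\<dots> = F" by (simp add: exp_minus)
  finally show ?thesis by (simp add: F_def)
qed

lemma choice_avg_agrees:
  assumes h: "valid h"
  shows "choice_avg (\<lambda>c. of_bool (agrees (history_vocab h) (v, w, c)))
    = (\<Sum>u\<in>history_vocab h v. of_bool (u \<in> history_vocab h w)) / vsize h v"
proof (cases "history_vocab h v = {}")
  case False
  then have "(\<lambda>c. of_bool (agrees (history_vocab h) (v, w, c))) = (\<lambda>c. of_bool (c (history_vocab h v) \<in> history_vocab h w) :: real)"
    by (simp add: agrees_def)
  then show ?thesis using choice_avg_word[OF history_vocab_subset[OF h] False, of "\<lambda>u. of_bool (u \<in> history_vocab h w)"] by simp
qed (simp add: agrees_def)

text \<open>
  Conditionally on the word spoken, the listener knows it with probability at most the number of
  holders divided by \<open>n - 1\<close>.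
\<close>

lemma agreement_probability:
  assumes h: "valid h" and B: "\<And>u. u \<in> V \<Longrightarrow> holders u h \<le> B" "0 \<le> B"
  shows "E (\<lambda>e. of_bool (agrees (history_vocab h) e)) \<le> B / (real n - 1)"
proof -
  let ?W = "history_vocab h"
  have row: "(\<Sum>w\<in>V - {v}. choice_avg (\<lambda>c. of_bool (agrees ?W (v, w, c)))) \<le> B" for v
  proof -
    have "(\<Sum>w\<in>V - {v}. choice_avg (\<lambda>c. of_bool (agrees ?W (v, w, c))))
        \<le> (\<Sum>w\<in>V. (\<Sum>u\<in>?W v. of_bool (u \<in> ?W w)) / vsize h v)"
      unfolding choice_avg_agrees[OF h] by (intro sum_mono2 divide_nonneg_nonneg sum_nonneg) auto
    also have "\<dots> = (\<Sum>u\<in>?W v. holders u h) / vsize h v"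
      unfolding sum_divide_distrib[symmetric] holders_def by (subst sum.swap) simp
    also have "\<dots> \<le> (\<Sum>u\<in>?W v. B) / vsize h v"
      by (intro divide_right_mono sum_mono B(1)) (use history_vocab_subset[OF h, of v] in blast, simp)
    also have "\<dots> \<le> B" using B(2) by simp
    finally show ?thesis .
  qed
  have "E (\<lambda>e. of_bool (agrees ?W e)) \<le> (\<Sum>v\<in>V. B) / (real n * (real n - 1))"
    unfolding E_event using n_pos by (intro divide_right_mono sum_mono row) simp
  also have "\<dots> = B / (real n - 1)" using n_pos by simp
  finally show ?thesis .
qed

text \<open>
  The inequality between the harmonic and the arithmetic mean, together with
  \<open>total_vocabulary\<close>.
\<close>

lemma exposure_step_ge: "valid h \<Longrightarrow> 1 / (real (length h) + 2 * real n) \<le> exposure_step h"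
proof -
  assume h: "valid h"
  \<comment> \<open>\<open>y\<close> bounds the average of the vocabulary sizes plus one; the tangent is taken there.\<close>
  define y where "y = (real (length h) + 2 * real n) / real n"
  have y: "0 < y" unfolding y_def using n_pos by simp
  have total: "(\<Sum>x\<in>V. vsize h x + 1) \<le> real n * y"
  proof -
    have "(\<Sum>x\<in>V. vsize h x + 1) = (\<Sum>x\<in>V. vsize h x) + real n" by (simp add: sum.distrib)
    also have "\<dots> \<le> real (length h) + 2 * real n" using total_vocabulary[OF h] spoken_le(2)[of h] by linarith
    also have "\<dots> = real n * y" using n_pos by (simp add: y_def)
    finally show ?thesis .
  qed
  have "real n / y = real n * (2 / y) - (real n * y) / y\<^sup>2" using y by (simp add: power2_eq_square field_simps)
  also have "\<dots> \<le> real n * (2 / y) - (\<Sum>x\<in>V. vsize h x + 1) / y\<^sup>2"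
    using total by (intro diff_left_mono divide_right_mono) simp_all
  also have "\<dots> = (\<Sum>x\<in>V. 2 / y - (vsize h x + 1) / y\<^sup>2)"
    by (simp add: sum_subtractf sum_divide_distrib)
  also have "\<dots> \<le> (\<Sum>x\<in>V. 1 / (vsize h x + 1))"
    by (intro sum_mono one_sub_le_inverse y) simp
  finally have "real n / y / (real n)\<^sup>2 \<le> exposure_step h"
    unfolding exposure_step_def by (rule divide_right_mono) simp
  moreover have "real n / y / (real n)\<^sup>2 = 1 / (real (length h) + 2 * real n)"
    unfolding y_def using n_pos by (simp add: power2_eq_square)
  ultimately show ?thesis by simp
qed

text \<open>
  That the excess is nonnegative is what allows Markov's inequality to be applied to it, although the exposure and the
  subtracted logarithm are both large.
\<close>

lemma exposure_excess_nonneg: "valid h \<Longrightarrow> 0 \<le> exposure_excess h"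
proof (induction h)
  case Nil
  then show ?case using n_pos by (simp add: exposure_excess_def)
next
  case (Cons e h)
  then have h: "valid h" by (simp add: valid_Cons)
  let ?l = "real (length h) + 2 * real n"
  have l: "0 < ?l" using n_pos by simp
  have "ln ((?l + 1) / (2 * real n)) - ln (?l / (2 * real n)) = ln (1 + 1 / ?l)"
  proof -
    have "ln ((?l + 1) / (2 * real n)) - ln (?l / (2 * real n)) = ln ((?l + 1) / (2 * real n) / (?l / (2 * real n)))"
      using l n_pos by (intro ln_divide_pos[symmetric]) simp_all
    also have "(?l + 1) / (2 * real n) / (?l / (2 * real n)) = (?l + 1) / ?l"
      using n_pos by simp
    also have "\<dots> = 1 + 1 / ?l"
    proof -
      have "(L + 1) / L = 1 + 1 / L" if "0 < L" for L :: real using that by (simp add: field_simps)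
      then show ?thesis using l .
    qed
    finally show ?thesis .
  qed
  also have "\<dots> \<le> 1 / ?l" using l by (intro ln_add_one_self_le_self) simp
  also have "\<dots> \<le> exposure_step h" by (rule exposure_step_ge[OF h])
  finally have "ln ((?l + 1) / (2 * real n)) - ln (?l / (2 * real n)) \<le> exposure_step h" .
  moreover have "exposure_excess (e # h) = exposure h + exposure_step h - ln ((?l + 1) / (2 * real n))"
    unfolding exposure_excess_def exposure.simps by (simp add: add_ac)
  ultimately show ?case using Cons.IH[OF h] unfolding exposure_excess_def[of h] by linarith
qed

text \<open>
  Learning a word increases the harmonic number of the vocabulary size \<open>L\<close> by exactly
  \<open>1 / (L + 1)\<close>. An agreement resets two vocabularies and costs at most \<open>2 * harm n + 1\<close>.
\<close>

lemma harm_sum_growth: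
  assumes "valid ((v, w, c) # h)"
  shows "(\<Sum>x\<in>V. harm (card (history_vocab h x))) + 1 / (vsize h w + 1)
      - (2 * harm n + 1) * of_bool (agrees (history_vocab h) (v, w, c))
    \<le> (\<Sum>x\<in>V. harm (card (history_vocab ((v, w, c) # h) x)) :: real)"
proof -
  have vh: "valid h" using assms by (simp add: valid_Cons)
  have mono: "harm j \<le> (harm k :: real)" if "j \<le> k" for j k
    unfolding harm_def using that by (intro sum_mono2) auto
  have hi: "harm (card (history_vocab h x)) \<le> (harm n :: real)" for x by (rule mono[OF vsize_le[OF vh]])
  have ins: "harm (card (insert u (history_vocab h w))) = harm (card (history_vocab h w)) + 1 / (vsize h w + 1)"
    if "u \<notin> history_vocab h w" for u
    using that finite_history_vocab[OF vh, of w] by (simp add: harm_Suc inverse_eq_divide add.commute)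
  note s = sum_change_event[OF assms, of "\<lambda>A. harm (card A)"]
  show ?thesis using assms
  proof (cases rule: event_cases)
    case silent
    then show ?thesis unfolding s using ins[of v] by (simp add: harm_nonneg harm_expand)
  next
    case (agree u)
    have "1 / (vsize h w + 1) \<le> 1" by simp
    moreover have "(0::real) \<le> harm 1" by (rule harm_nonneg)
    moreover have "card {u} = 1" "of_bool (agrees (history_vocab h) (v, w, c)) = (1 :: real)" using agree(6) by simp_all
    moreover have "S + i - (2 * N + 1) * a \<le> S + (t - y) + (t - z)"
      if "i \<le> 1" "0 \<le> t" "a = 1" "y \<le> N" "z \<le> N" for S i N a t y z :: real
      using that by simp
    ultimately show ?thesis unfolding s agree(4,5) using hi[of v] hi[of w] by (simp only:)
  next
    case (learn u)
    then show ?thesis unfolding s using ins[of u] by simp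
  qed
qed

text \<open>
  The expected gain of the harmonic numbers compensates the increment of the exposure.
\<close>

lemma drift_exposure:
  assumes h: "valid h"
  shows "E (\<lambda>e. exposure (e # h) - (\<Sum>x\<in>V. harm (card (history_vocab (e # h) x))) / real n
      - (2 * harm n + 1) / real n * real (agreements (e # h)))
    \<le> exposure h - (\<Sum>x\<in>V. harm (card (history_vocab h x))) / real n - (2 * harm n + 1) / real n * real (agreements h)"
proof -
  define Hs where "Hs = (\<Sum>x\<in>V. harm (card (history_vocab h x)) :: real)"
  define a where "a = (2 * harm n + 1 :: real)"
  define g where "g w = 1 / (vsize h w + 1) / real n" for w
  have "E (\<lambda>e. exposure (e # h) - (\<Sum>x\<in>V. harm (card (history_vocab (e # h) x))) / real n - a / real n * real (agreements (e # h)))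
      \<le> E (\<lambda>e. (exposure h + exposure_step h - Hs / real n - a / real n * real (agreements h)) - g (fst (snd e)))"
  proof (rule E_mono)
    fix v w c assume "(v, w, c) \<in> set_pmf p"
    then have val: "valid ((v, w, c) # h)" using h by (simp add: valid_Cons)
    have "(Hs + 1 / (vsize h w + 1) - a * of_bool (agrees (history_vocab h) (v, w, c))) / real n
        \<le> (\<Sum>x\<in>V. harm (card (history_vocab ((v, w, c) # h) x))) / real n"
      using harm_sum_growth[OF val] unfolding Hs_def a_def by (rule divide_right_mono) simp
    then show "exposure ((v, w, c) # h) - (\<Sum>x\<in>V. harm (card (history_vocab ((v, w, c) # h) x))) / real n - a / real n * real (agreements ((v, w, c) # h))
      \<le> (exposure h + exposure_step h - Hs / real n - a / real n * real (agreements h)) - g (fst (snd (v, w, c)))"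
      by (simp add: g_def add_divide_distrib diff_divide_distrib distrib_left)
  qed
  also have "\<dots> = (exposure h + exposure_step h - Hs / real n - a / real n * real (agreements h)) - E (\<lambda>e. g (fst (snd e)))"
    by simp
  also have "E (\<lambda>e. g (fst (snd e))) = (\<Sum>w\<in>V. g w) / real n" by (rule E_listener)
  also have "(\<Sum>w\<in>V. g w) / real n = exposure_step h"
    unfolding g_def exposure_step_def sum_divide_distrib[symmetric] by (simp add: power2_eq_square)
  finally show ?thesis by (simp add: Hs_def a_def)
qed

text \<open>
  Concavity of the logarithm and \<open>total_vocabulary\<close>: the average of the harmonic numbers is at most
  the logarithm of the average size, up to a constant.
\<close>

lemma harm_average_le:
  assumes h: "valid h"
  shows "(\<Sum>x\<in>V. harm (card (history_vocab h x))) / real n \<le> 2 + ln ((real (length h) + 2 * real n) / (2 * real n))"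
proof -
  define y where "y = (real (length h) + 2 * real n) / real n"
  have y: "0 < y" unfolding y_def using n_pos by simp
  have "(\<Sum>x\<in>V. harm (card (history_vocab h x))) \<le> (\<Sum>x\<in>V. 1 + (ln y + ((vsize h x + 1) / y - 1)))"
  proof (rule sum_mono)
    fix x
    have "ln ((vsize h x + 1) / y) \<le> (vsize h x + 1) / y - 1" using y by (intro ln_le_minus_one divide_pos_pos) simp_all
    moreover have "ln ((vsize h x + 1) / y) = ln (vsize h x + 1) - ln y" using y by (intro ln_divide_pos) simp_all
    ultimately show "harm (card (history_vocab h x)) \<le> 1 + (ln y + ((vsize h x + 1) / y - 1))"
      using harm_le_ln[of "card (history_vocab h x)"] by linarith
  qed
  also have "\<dots> = real n * ln y + (\<Sum>x\<in>V. vsize h x + 1) / y"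
    by (simp add: sum.distrib sum_subtractf sum_divide_distrib[symmetric])
  also have "(\<Sum>x\<in>V. vsize h x + 1) / y \<le> real n"
  proof -
    have "(\<Sum>x\<in>V. vsize h x + 1) = (\<Sum>x\<in>V. vsize h x) + real n" by (simp add: sum.distrib)
    also have "\<dots> \<le> real (length h) + 2 * real n" using total_vocabulary[OF h] spoken_le(2)[of h] by linarith
    also have "\<dots> = real n * y" using n_pos by (simp add: y_def)
    finally show ?thesis using y by (simp add: field_simps)
  qed
  finally have "(\<Sum>x\<in>V. harm (card (history_vocab h x))) / real n \<le> ln y + 1"
    using n_pos by (simp add: field_simps)
  also have "ln y = ln 2 + ln ((real (length h) + 2 * real n) / (2 * real n))"
  proof -
    have "y = 2 * ((real (length h) + 2 * real n) / (2 * real n))" unfolding y_def using n_pos by (simp add: field_simps)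
    then show ?thesis using n_pos by (simp only:) (rule ln_mult_pos, simp_all)
  qed
  also have "ln (2::real) \<le> 1" using ln_le_minus_one[of 2] by simp
  finally show ?thesis by simp
qed

end

section \<open>How often a given word is spoken\<close>

lemma exp_le_quadratic_abs:
  assumes "\<bar>y\<bar> \<le> (1::real)" shows "exp y \<le> 1 + y + y\<^sup>2"
proof (cases "0 \<le> y")
  case True
  then show ?thesis using exp_bound[of y] assms by simp
next
  case False
  define z where "z = - y"
  have z: "0 < z" using False by (simp add: z_def)
  have "exp (- z) = 1 / exp z" by (simp add: exp_minus inverse_eq_divide)
  also have "\<dots> \<le> 1 / (1 + z)"
    using exp_ge_add_one_self[of z] z by (intro divide_left_mono) simp_all
  also have "\<dots> \<le> 1 - z + z\<^sup>2"
  proof -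
    have "(1 - z + z\<^sup>2) * (1 + z) = 1 + z ^ 3" by (simp add: power2_eq_square power3_eq_cube algebra_simps)
    then have "1 \<le> (1 - z + z\<^sup>2) * (1 + z)" using z by simp
    then show ?thesis using z by (simp add: divide_le_eq)
  qed
  finally show ?thesis by (simp add: z_def)
qed

text \<open>
  The lower bound on \<open>X\<close> makes the relative perturbation of the power at most \<open>\<eta>\<close>, so that the
  second order term is absorbed by \<open>\<eta> * \<bar>d\<bar>\<close>.
\<close>

lemma power_perturb:
  fixes X d \<eta> :: real
  assumes \<eta>: "0 < \<eta>" "\<eta> \<le> 1" and d: "\<bar>d\<bar> \<le> 2" and k: "1 \<le> k" and X: "2 * real k / \<eta> \<le> X"
  shows "(X + d) ^ k \<le> X ^ k * (1 + real k / X * (d + \<eta> * \<bar>d\<bar>))"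
proof -
  have kX: "2 * real k \<le> \<eta> * X" using X \<eta> by (simp add: field_simps)
  have "0 < 2 * real k / \<eta>" using \<eta> k by (intro divide_pos_pos) simp_all
  then have X0: "0 < X" using X by (rule less_le_trans)
  have "\<eta> * X \<le> X" using \<eta> X0 by simp
  then have X2: "2 \<le> X" using kX k by linarith
  define y where "y = real k * (d / X)"
  have "\<bar>y\<bar> = real k * \<bar>d\<bar> / X" using X0 by (simp add: y_def abs_mult)
  also have "\<dots> \<le> real k * 2 / X" using d X0 by (intro divide_right_mono mult_left_mono) simp_all
  also have "\<dots> \<le> \<eta>" using kX X0 by (simp add: field_simps)
  finally have y: "\<bar>y\<bar> \<le> \<eta>" .
  have "- 2 \<le> d" using d by simp
  then have "- X \<le> d" using X2 by linarith
  then have pos: "0 \<le> 1 + d / X" using X0 by (simp add: field_simps)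
  have "(X + d) ^ k = X ^ k * (1 + d / X) ^ k"
    unfolding power_mult_distrib[symmetric] using X0 by (simp add: distrib_left)
  also have "(1 + d / X) ^ k \<le> exp (d / X) ^ k"
    by (rule power_mono[OF exp_ge_add_one_self pos])
  also have "exp (d / X) ^ k = exp y" unfolding y_def by (rule exp_of_nat_mult[symmetric])
  also have "exp y \<le> 1 + y + y\<^sup>2" by (rule exp_le_quadratic_abs) (use y \<eta> in linarith)
  also have "y\<^sup>2 \<le> \<eta> * \<bar>y\<bar>"
  proof -
    have "y\<^sup>2 = \<bar>y\<bar> * \<bar>y\<bar>" by (simp add: power2_eq_square)
    also have "\<dots> \<le> \<eta> * \<bar>y\<bar>" by (rule mult_right_mono[OF y]) simp
    finally show ?thesis .
  qed
  also have "1 + y + \<eta> * \<bar>y\<bar> = 1 + real k / X * (d + \<eta> * \<bar>d\<bar>)"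
    using X0 by (simp add: y_def abs_mult distrib_left)
  finally show ?thesis using X0 by simp
qed

context naming_game
begin

lemma word_weight_nonneg: "0 \<le> word_weight u A"
  by (simp add: word_weight_def)

lemma word_rate_nonneg: "0 \<le> word_rate u h"
  unfolding word_rate_def by (intro sum_nonneg word_weight_nonneg)

lemma word_weight_le_1: "word_weight u A \<le> 1"
  by (cases "card A") (simp_all add: word_weight_def)

lemma word_rate_uninvented:
  assumes "valid h" "history_vocab h u = {}"
  shows "word_rate u h = 0"
  unfolding word_rate_def word_weight_def
  by (rule sum.neutral) (use word_has_inventor[OF assms(1), of u] assms(2) in auto)

lemma word_rate_le_potential: "valid h \<Longrightarrow> word_rate u h \<le> word_potential u h"
  unfolding word_potential_def using word_rate_uninvented[of h u] by simp

definition says :: "nat \<Rightarrow> event list \<Rightarrow> event \<Rightarrow> bool" where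
  "says u h = (\<lambda>(v, w, c). history_vocab h v \<noteq> {} \<and> c (history_vocab h v) = u)"

text \<open>
  A bound for the change of the rate of \<open>u\<close>. If \<open>u\<close> is spoken, an agreement increases at most two
  weights to \<open>1\<close>, and a listener who learns \<open>u\<close> contributes its new weight. If another word
  is spoken to a holder of \<open>u\<close>, the weight \<open>1 / L\<close> drops to \<open>1 / (L + 1)\<close> or disappears.
\<close>

definition rate_change :: "nat \<Rightarrow> event list \<Rightarrow> event \<Rightarrow> real" where
  "rate_change u h e = (let w = fst (snd e) in
    if says u h e then (if u \<in> history_vocab h w then 2 else 1 / (vsize h w + 1))
    else - of_bool (u \<in> history_vocab h w) / (vsize h w * (vsize h w + 1)))"

lemma word_rate_step:
  assumes val: "valid ((v, w, c) # h)" and u: "history_vocab h u \<noteq> {}"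
  shows "word_rate u ((v, w, c) # h) \<le> word_rate u h + rate_change u h (v, w, c)"
proof -
  let ?W = "history_vocab h"
  have h: "valid h" using val by (simp add: valid_Cons)
  have fin: "finite (?W w)" by (rule finite_history_vocab[OF h])
  note s = sum_change_event[OF val, of "word_weight u", folded word_rate_def]
  have shrink: "1 / (vsize h w + 1) - 1 / vsize h w = - (1 / (vsize h w * (vsize h w + 1)))" if "u \<in> ?W w"
    using vsize_pos[OF h that] by (simp add: field_simps)
  have learnt: "word_weight u (insert u' (?W w)) - word_weight u (?W w)
      \<le> - of_bool (u \<in> ?W w) / (vsize h w * (vsize h w + 1))" if "u' \<noteq> u" "u' \<notin> ?W w" for u'
  proof (cases "u \<in> ?W w")
    case True
    then have "word_weight u (insert u' (?W w)) = 1 / (vsize h w + 1)" "word_weight u (?W w) = 1 / vsize h w"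
      using that fin by (simp_all add: word_weight_def add.commute)
    then show ?thesis using shrink[OF True] True by simp
  next
    case False
    then show ?thesis using that by (simp add: word_weight_def)
  qed
  show ?thesis using val
  proof (cases rule: event_cases)
    case silent
    have ne: "v \<noteq> u" using silent(1) u by auto
    have "word_weight u {v} = 0" "word_weight u {} = 0" using ne by (simp_all add: word_weight_def)
    moreover have "rate_change u h (v, w, c) = - of_bool (u \<in> ?W w) / (vsize h w * (vsize h w + 1))"
      using silent(1) by (simp add: rate_change_def says_def)
    ultimately show ?thesis unfolding s silent(1,3,4) using learnt[OF ne silent(2)] by simp
  next
    case (agree u')
    have ne: "?W v \<noteq> {}" using agree(2) by blast
    show ?thesis
    proof (cases "u' = u")
      case True
      have "rate_change u h (v, w, c) = 2" using True agree(1,3) ne by (simp add: rate_change_def says_def)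
      moreover have "word_weight u {u'} \<le> 1" by (rule word_weight_le_1)
      ultimately show ?thesis unfolding s agree(4,5)
        using word_weight_nonneg[of u "?W v"] word_weight_nonneg[of u "?W w"] by linarith
    next
      case False
      have "rate_change u h (v, w, c) = - of_bool (u \<in> ?W w) / (vsize h w * (vsize h w + 1))"
        using False agree(1) by (simp add: rate_change_def says_def)
      moreover have "word_weight u {u'} = 0" using False by (simp add: word_weight_def)
      moreover have "- word_weight u (?W w) \<le> - of_bool (u \<in> ?W w) / (vsize h w * (vsize h w + 1))"
      proof (cases "u \<in> ?W w")
        case True
        have "0 \<le> 1 / (vsize h w + 1)" by simp
        then have "- (1 / vsize h w) \<le> - (1 / (vsize h w * (vsize h w + 1)))" using shrink[OF True] by linarith
        then show ?thesis using True by (simp add: word_weight_def)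
      qed (simp add: word_weight_def)
      ultimately show ?thesis unfolding s agree(4,5) using word_weight_nonneg[of u "?W v"] by linarith
    qed
  next
    case (learn u')
    have ne: "?W v \<noteq> {}" using learn(2) by blast
    show ?thesis
    proof (cases "u' = u")
      case True
      have "rate_change u h (v, w, c) = 1 / (vsize h w + 1)"
        using True learn(1,3) ne by (simp add: rate_change_def says_def)
      moreover have "word_weight u (?W w) = 0" "word_weight u (insert u' (?W w)) = 1 / (vsize h w + 1)"
        using True learn(3) fin by (simp_all add: word_weight_def add.commute)
      ultimately show ?thesis unfolding s learn(4,5) by simp
    next
      case False
      have "rate_change u h (v, w, c) = - of_bool (u \<in> ?W w) / (vsize h w * (vsize h w + 1))"
        using False learn(1) by (simp add: rate_change_def says_def)
      then show ?thesis unfolding s learn(4,5) using learnt[OF False learn(3)] by simp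
    qed
  qed
qed

lemma word_rate_invention:
  assumes val: "valid ((v, w, c) # h)" and u: "history_vocab h u = {}"
  shows "word_rate u ((v, w, c) # h) \<le> 2"
proof -
  let ?W = "history_vocab h"
  have h: "valid h" using val by (simp add: valid_Cons)
  have no: "u \<notin> ?W x" for x using word_has_inventor[OF h, of u x] u by blast
  then have no0: "word_weight u (?W x) = 0" for x by (simp add: word_weight_def)
  note s = sum_change_event[OF val, of "word_weight u", folded word_rate_def]
  have "word_weight u A \<le> 1" for A by (rule word_weight_le_1)
  then have "word_weight u A + word_weight u B \<le> 2" for A B by (smt (verit))
  then show ?thesis unfolding s no0 word_rate_uninvented[OF h u] by simp
qed

lemma choice_avg_says:
  assumes h: "valid h"
  shows "choice_avg (\<lambda>c. of_bool (says u h (v, w, c))) = word_weight u (history_vocab h v)"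
proof (cases "history_vocab h v = {}")
  case False
  have fin: "finite (history_vocab h v)" by (rule finite_history_vocab[OF h])
  have "(\<lambda>c. of_bool (says u h (v, w, c))) = (\<lambda>c. of_bool (c (history_vocab h v) = u) :: real)"
    using False by (simp add: says_def)
  moreover have "(\<Sum>x\<in>history_vocab h v. of_bool (x = u)) = (of_bool (u \<in> history_vocab h v) :: real)"
    using fin by (simp add: of_bool_def)
  ultimately show ?thesis
    using choice_avg_word[OF history_vocab_subset[OF h] False, of "\<lambda>x. of_bool (x = u)"]
    by (simp add: word_weight_def)
qed (simp add: says_def word_weight_def)

lemma E_says_le:
  assumes h: "valid h" and g: "\<And>w. 0 \<le> g w"
  shows "E (\<lambda>e. of_bool (says u h e) * g (fst (snd e))) \<le> word_rate u h * (\<Sum>w\<in>V. g w) / (real n * (real n - 1))"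
proof -
  have "E (\<lambda>e. of_bool (says u h e) * g (fst (snd e)))
      = (\<Sum>v\<in>V. \<Sum>w\<in>V - {v}. word_weight u (history_vocab h v) * g w) / (real n * (real n - 1))"
    unfolding E_event by (simp add: choice_avg_cmult choice_avg_says[OF h])
  also have "\<dots> \<le> (\<Sum>v\<in>V. \<Sum>w\<in>V. word_weight u (history_vocab h v) * g w) / (real n * (real n - 1))"
    using n_pos g word_weight_nonneg by (intro divide_right_mono sum_mono sum_mono2 mult_nonneg_nonneg) auto
  also have "(\<Sum>v\<in>V. \<Sum>w\<in>V. word_weight u (history_vocab h v) * g w) = word_rate u h * (\<Sum>w\<in>V. g w)"
    unfolding word_rate_def by (rule sum_product[symmetric])
  finally show ?thesis .
qed

end

text \<open>
  Parameters of the estimates: \<open>\<rho>\<close> bounds the rates of words, \<open>\<eta>\<close> is a small relative error,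
  \<open>\<kappa>\<close> an additive allowance for vocabulary sizes, \<open>\<sigma>\<close> bounds the excess of the exposure over
  a logarithm, and \<open>M\<close> is the number of interactions.
\<close>

locale controlled_game = naming_game +
  fixes \<rho> \<eta> \<kappa> \<sigma> :: real and M :: nat
  assumes eta: "0 < \<eta>" "\<eta> \<le> 1" and kappa: "2 \<le> \<kappa>" and rho: "0 < \<rho>" "\<rho> \<le> \<eta> * (real n - 1)"
    and eta_n: "1 \<le> \<eta> * (real n - 1)" and sigma: "0 < \<sigma>"
begin

text \<open>
  The argument counts interactions, so \<open>m / real n\<close> is the time at which they have happened.
\<close>

definition size_bound :: "real \<Rightarrow> real" where
  "size_bound m = (1 + \<eta>) * m / real n + \<kappa>"

definition bad :: "event list \<Rightarrow> bool" where
  "bad h \<longleftrightarrow> (\<exists>u\<in>V. \<rho> < word_potential u h) \<or> (\<exists>x\<in>V. size_bound (real (length h)) < vsize h x + 1)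
     \<or> \<sigma> < exposure_excess h"

lemma size_bound_mono: "a \<le> b \<Longrightarrow> size_bound a \<le> size_bound b"
  unfolding size_bound_def using eta n_pos by (intro add_right_mono divide_right_mono mult_left_mono) simp_all

lemma size_bound_ge: "0 \<le> m \<Longrightarrow> 2 \<le> size_bound m"
  unfolding size_bound_def using eta kappa n_pos by (simp add: add_increasing)

text \<open>
  Each holder of \<open>u\<close> contributes at least the inverse of the size bound to the rate of \<open>u\<close>.
\<close>

lemma holders_le:
  assumes h: "valid h" and nb: "\<not> bad h" and u: "u \<in> V"
  shows "holders u h \<le> \<rho> * size_bound (real (length h))"
proof -
  let ?K = "size_bound (real (length h))"
  have "holders u h \<le> (\<Sum>x\<in>V. word_weight u (history_vocab h x) * ?K)"
    unfolding holders_def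
  proof (rule sum_mono)
    fix x assume x: "x \<in> V"
    have "vsize h x \<le> ?K" using nb x unfolding bad_def by force
    show "of_bool (u \<in> history_vocab h x) \<le> word_weight u (history_vocab h x) * ?K"
    proof (cases "u \<in> history_vocab h x")
      case True
      have "0 < vsize h x" using vsize_pos[OF h True] by simp
      then have "1 \<le> 1 / vsize h x * ?K" using \<open>vsize h x \<le> ?K\<close> by (simp add: le_divide_eq)
      then show ?thesis using True by (simp add: word_weight_def)
    qed (simp add: word_weight_def)
  qed
  also have "\<dots> = word_rate u h * ?K" unfolding word_rate_def by (rule sum_distrib_right[symmetric])
  also have "\<dots> \<le> \<rho> * ?K"
  proof (rule mult_right_mono)
    show "word_rate u h \<le> \<rho>" using word_rate_le_potential[OF h, of u] nb u unfolding bad_def by force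
  qed (use size_bound_ge[of "real (length h)"] in simp)
  finally show ?thesis .
qed

text \<open>
  A bound for the relative growth of the rate of a word in one step: the gain from new holders, the gain
  from agreements, and the loss from other words that are learnt by the holders. The first and the
  last term nearly cancel.
\<close>

definition growth :: "event list \<Rightarrow> real" where
  "growth h = (1 + \<eta>)\<^sup>2 * exposure_step h + 8 * \<rho> * size_bound (real M) / (real n)\<^sup>2
     - (1 - \<eta>)\<^sup>2 / (real n * size_bound (real (length h)))"

lemma exposure_step_ge_size_bound:
  assumes nb: "\<not> bad h"
  shows "1 / (real n * size_bound (real (length h))) \<le> exposure_step h"
proof -
  let ?K = "size_bound (real (length h))"
  have K: "0 < ?K" using size_bound_ge[of "real (length h)"] by simp
  have "(\<Sum>x\<in>V. 1 / ?K) \<le> (\<Sum>x\<in>V. 1 / (vsize h x + 1))"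
    using nb K unfolding bad_def by (intro sum_mono divide_left_mono mult_pos_pos) force+
  then have "real n / ?K / (real n)\<^sup>2 \<le> exposure_step h"
    unfolding exposure_step_def by (intro divide_right_mono) simp_all
  then show ?thesis using n_pos K by (simp add: power2_eq_square mult.commute)
qed

lemma growth_nonneg:
  assumes nb: "\<not> bad h"
  shows "0 \<le> growth h"
proof -
  let ?K = "size_bound (real (length h))"
  have K: "0 < ?K" "0 < size_bound (real M)" using size_bound_ge[of "real (length h)"] size_bound_ge[of "real M"] by simp_all
  have "(1 - \<eta>)\<^sup>2 / (real n * ?K) = (1 - \<eta>)\<^sup>2 * (1 / (real n * ?K))" by simp
  also have "\<dots> \<le> (1 + \<eta>)\<^sup>2 * exposure_step h"
    using exposure_step_ge_size_bound[OF nb] eta K n_pos by (intro mult_mono power_mono) simp_all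
  finally have "(1 - \<eta>)\<^sup>2 / (real n * ?K) \<le> (1 + \<eta>)\<^sup>2 * exposure_step h" .
  moreover have "0 \<le> 8 * \<rho> * size_bound (real M) / (real n)\<^sup>2" using rho K by simp
  ultimately show ?thesis unfolding growth_def by linarith
qed

text \<open>
  In the expectation, \<open>X w\<close> is the gain if \<open>w\<close> hears \<open>u\<close>, and \<open>Y w\<close> is the loss if \<open>w\<close> hears another
  word; a fraction \<open>\<eta>\<close> is set aside for second order terms. The word \<open>u\<close> itself is heard with probability
  at most \<open>\<rho> / (n - 1) \<le> \<eta>\<close>, so the loss occurs almost always when a holder listens.
\<close>

lemma mean_rate_change:
  assumes h: "valid h" and nb: "\<not> bad h" and len: "length h \<le> M" and u: "u \<in> V"
  defines "X \<equiv> \<lambda>w. (1 + \<eta>) * (1 / (vsize h w + 1) + 2 * of_bool (u \<in> history_vocab h w))"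
    and "Y \<equiv> \<lambda>w. (1 - \<eta>) * (of_bool (u \<in> history_vocab h w) / (vsize h w * (vsize h w + 1)))"
  shows "E (\<lambda>e. of_bool (says u h e) * (X (fst (snd e)) + Y (fst (snd e))) - Y (fst (snd e))) \<le> word_rate u h * growth h"
proof -
  let ?R = "word_rate u h" and ?K = "size_bound (real (length h))"
  define nn where "nn = real n * (real n - 1)"
  have nn: "0 < nn" using n_pos by (simp add: nn_def)
  have K: "2 \<le> ?K" by (rule size_bound_ge) simp
  have R: "0 \<le> ?R" "?R \<le> \<eta> * (real n - 1)"
    using word_rate_nonneg word_rate_le_potential[OF h, of u] nb u rho unfolding bad_def by force+
  have Y0: "0 \<le> Y w" for w unfolding Y_def using eta by simp
  have X0: "0 \<le> X w" for w unfolding X_def using eta by simp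
  have "E (\<lambda>e. of_bool (says u h e) * (X (fst (snd e)) + Y (fst (snd e))) - Y (fst (snd e)))
      = E (\<lambda>e. of_bool (says u h e) * (X (fst (snd e)) + Y (fst (snd e)))) - E (\<lambda>e. Y (fst (snd e)))"
    by simp
  also have "\<dots> \<le> ?R * (\<Sum>w\<in>V. X w + Y w) / nn - (\<Sum>w\<in>V. Y w) / real n"
    using E_says_le[OF h, of "\<lambda>w. X w + Y w" u] X0 Y0 unfolding E_listener nn_def by (simp add: add_nonneg_nonneg)
  also have "(\<Sum>w\<in>V. Y w) / real n = (\<Sum>w\<in>V. Y w) * (real n - 1) / nn" using n_pos by (simp add: nn_def)
  also have "?R * (\<Sum>w\<in>V. X w + Y w) / nn - (\<Sum>w\<in>V. Y w) * (real n - 1) / nn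
      = (?R * (\<Sum>w\<in>V. X w) - (real n - 1 - ?R) * (\<Sum>w\<in>V. Y w)) / nn"
    by (simp add: sum.distrib diff_divide_distrib[symmetric] algebra_simps)
  also have "\<dots> \<le> (?R * ((1 + \<eta>) * ((real n)\<^sup>2 * exposure_step h + 2 * (\<rho> * ?K))) - (1 - \<eta>) * (real n - 1) * ((1 - \<eta>) * (?R / ?K))) / nn"
  proof (intro divide_right_mono diff_mono mult_left_mono R(1))
    have "(\<Sum>w\<in>V. X w) = (1 + \<eta>) * ((real n)\<^sup>2 * exposure_step h + 2 * holders u h)"
      unfolding X_def sum_distrib_left[symmetric] sum.distrib exposure_step_def holders_def using n_pos by simp
    also have "\<dots> \<le> (1 + \<eta>) * ((real n)\<^sup>2 * exposure_step h + 2 * (\<rho> * ?K))"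
      using holders_le[OF h nb u] eta by (intro mult_left_mono add_left_mono) simp_all
    finally show "(\<Sum>w\<in>V. X w) \<le> (1 + \<eta>) * ((real n)\<^sup>2 * exposure_step h + 2 * (\<rho> * ?K))" .
    show "(1 - \<eta>) * (real n - 1) * ((1 - \<eta>) * (?R / ?K)) \<le> (real n - 1 - ?R) * (\<Sum>w\<in>V. Y w)"
    proof (rule mult_mono)
      show "(1 - \<eta>) * (real n - 1) \<le> real n - 1 - ?R" using R(2) by (simp add: algebra_simps)
      then show "0 \<le> real n - 1 - ?R" using eta n_pos by (smt (verit) mult_nonneg_nonneg)
      show "0 \<le> (1 - \<eta>) * (?R / ?K)" using eta R K by simp
      have "?R / ?K = (\<Sum>w\<in>V. word_weight u (history_vocab h w) / ?K)"
        unfolding word_rate_def by (rule sum_divide_distrib)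
      also have "\<dots> \<le> (\<Sum>w\<in>V. of_bool (u \<in> history_vocab h w) / (vsize h w * (vsize h w + 1)))"
      proof (rule sum_mono)
        fix w assume w: "w \<in> V"
        have le: "vsize h w + 1 \<le> ?K" using nb w unfolding bad_def by force
        show "word_weight u (history_vocab h w) / ?K \<le> of_bool (u \<in> history_vocab h w) / (vsize h w * (vsize h w + 1))"
        proof (cases "u \<in> history_vocab h w")
          case True
          have "1 / (vsize h w * ?K) \<le> 1 / (vsize h w * (vsize h w + 1))"
            using vsize_pos[OF h True] le K by (intro divide_left_mono mult_left_mono mult_pos_pos) simp_all
          then show ?thesis using True by (simp add: word_weight_def)
        qed (simp add: word_weight_def)
      qed
      finally show "(1 - \<eta>) * (?R / ?K) \<le> (\<Sum>w\<in>V. Y w)"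
        unfolding Y_def sum_distrib_left[symmetric] using eta by (intro mult_left_mono) simp_all
    qed
  qed (use nn in simp)
  also have "\<dots> = ?R * ((1 + \<eta>) * ((real n)\<^sup>2 * exposure_step h) / nn + (1 + \<eta>) * (2 * (\<rho> * ?K)) / nn - (1 - \<eta>)\<^sup>2 / (real n * ?K))"
  proof -
    have "(1 - \<eta>) * (real n - 1) * ((1 - \<eta>) * (?R / ?K)) / nn = ?R * ((1 - \<eta>)\<^sup>2 / (real n * ?K))"
      using n_pos by (simp add: nn_def power2_eq_square mult_ac)
    then show ?thesis by (simp add: diff_divide_distrib add_divide_distrib distrib_left right_diff_distrib)
  qed
  also have "\<dots> \<le> ?R * growth h"
  proof (rule mult_left_mono[OF _ R(1)])
    have "0 \<le> exposure_step h" unfolding exposure_step_def by (intro divide_nonneg_nonneg sum_nonneg) simp_all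
    moreover have "(real n)\<^sup>2 / nn \<le> 1 + \<eta>"
    proof -
      have "(real n)\<^sup>2 / nn = real n / (real n - 1)" using n_pos by (simp add: nn_def power2_eq_square)
      also have "\<dots> \<le> 1 + \<eta>" using eta_n n_pos by (simp add: divide_le_eq algebra_simps)
      finally show ?thesis .
    qed
    ultimately have "(1 + \<eta>) * exposure_step h * ((real n)\<^sup>2 / nn) \<le> (1 + \<eta>) * exposure_step h * (1 + \<eta>)"
      using eta by (intro mult_left_mono) simp_all
    then have a: "(1 + \<eta>) * ((real n)\<^sup>2 * exposure_step h) / nn \<le> (1 + \<eta>)\<^sup>2 * exposure_step h"
      by (simp add: power2_eq_square mult_ac)
    have f1: "1 / nn \<le> 2 / (real n)\<^sup>2"
    proof -
      have "real n \<le> 2 * (real n - 1)" using two_le by simp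
      then have "real n * real n \<le> 2 * nn" unfolding nn_def using mult_left_mono[of "real n" "2 * (real n - 1)" "real n"] by simp
      then show ?thesis using nn n_pos by (simp add: field_simps power2_eq_square)
    qed
    have f2: "(1 + \<eta>) * (2 * (\<rho> * ?K)) \<le> 4 * (\<rho> * size_bound (real M))"
    proof -
      have "\<rho> * ?K \<le> \<rho> * size_bound (real M)" using rho len by (intro mult_left_mono size_bound_mono) simp_all
      moreover have "0 \<le> \<rho> * ?K" using rho K by simp
      ultimately have "(1 + \<eta>) * (2 * (\<rho> * ?K)) \<le> 2 * (2 * (\<rho> * size_bound (real M)))"
        using mult_mono[of "1 + \<eta>" 2 "2 * (\<rho> * ?K)" "2 * (\<rho> * size_bound (real M))"] eta by linarith
      then show ?thesis by linarith
    qed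
    have f3: "0 \<le> 4 * (\<rho> * size_bound (real M))" using rho size_bound_ge[of "real M"] by simp
    have f4: "0 \<le> 1 / nn" using nn by simp
    have "(1 + \<eta>) * (2 * (\<rho> * ?K)) * (1 / nn) \<le> 4 * (\<rho> * size_bound (real M)) * (2 / (real n)\<^sup>2)"
      by (rule mult_mono[OF f2 f1 f3 f4])
    then have b: "(1 + \<eta>) * (2 * (\<rho> * ?K)) / nn \<le> 8 * \<rho> * size_bound (real M) / (real n)\<^sup>2" by simp
    show "(1 + \<eta>) * ((real n)\<^sup>2 * exposure_step h) / nn + (1 + \<eta>) * (2 * (\<rho> * ?K)) / nn - (1 - \<eta>)\<^sup>2 / (real n * ?K) \<le> growth h"
      unfolding growth_def using a b by linarith
  qed
  finally show ?thesis .
qed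

text \<open>
  The constant \<open>c0\<close> keeps the base of the power so large that one interaction, which changes the rate by at
  most \<open>2\<close>, perturbs the power only to first order. The mean first order change is \<open>mean_rate_change\<close>.
\<close>

lemma drift_word_potential:
  assumes h: "valid h" and nb: "\<not> bad h" and len: "length h \<le> M" and u: "u \<in> V"
    and k: "1 \<le> k" and c0: "2 * real k / \<eta> \<le> c0"
  shows "E (\<lambda>e. (word_potential u (e # h) + c0) ^ k) \<le> (word_potential u h + c0) ^ k * (1 + real k * growth h)"
proof -
  let ?G = "growth h"
  have G: "0 \<le> ?G" by (rule growth_nonneg[OF nb])
  have "0 < 2 * real k / \<eta>" using eta k by (intro divide_pos_pos) simp_all
  then have c0': "0 < c0" using c0 by (rule less_le_trans)
  have pot0: "0 \<le> word_potential u h'" for h' using word_rate_nonneg[of u h'] by (simp add: word_potential_def)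
  show ?thesis
  proof (cases "history_vocab h u = {}")
    case True
    have "E (\<lambda>e. (word_potential u (e # h) + c0) ^ k) \<le> E (\<lambda>e. (2 + c0) ^ k)"
    proof (rule E_mono)
      fix v w c assume "(v, w, c) \<in> set_pmf p"
      then have val: "valid ((v, w, c) # h)" using h by (simp add: valid_Cons)
      have "word_potential u ((v, w, c) # h) \<le> 2"
        using word_rate_invention[OF val True] by (simp add: word_potential_def)
      then show "(word_potential u ((v, w, c) # h) + c0) ^ k \<le> (2 + c0) ^ k"
        using pot0 c0' by (intro power_mono add_right_mono add_nonneg_nonneg) simp_all
    qed
    also have "\<dots> = (2 + c0) ^ k * 1" by simp
    also have "\<dots> \<le> (2 + c0) ^ k * (1 + real k * ?G)"
      using c0' G by (intro mult_left_mono) simp_all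
    finally show ?thesis using True by (simp add: word_potential_def)
  next
    case False
    let ?R = "word_rate u h"
    define x where "x = ?R + c0"
    define X where "X = (\<lambda>w. (1 + \<eta>) * (1 / (vsize h w + 1) + 2 * of_bool (u \<in> history_vocab h w)))"
    define Y where "Y = (\<lambda>w. (1 - \<eta>) * (of_bool (u \<in> history_vocab h w) / (vsize h w * (vsize h w + 1))))"
    have R: "0 \<le> ?R" by (rule word_rate_nonneg)
    have x: "0 < x" "2 * real k / \<eta> \<le> x" using R c0 c0' by (simp_all add: x_def)
    have pot: "word_potential u h = ?R" using False by (simp add: word_potential_def)
    have "E (\<lambda>e. (word_potential u (e # h) + c0) ^ k)
      \<le> E (\<lambda>e. x ^ k * (1 + real k / x * (of_bool (says u h e) * (X (fst (snd e)) + Y (fst (snd e))) - Y (fst (snd e)))))"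
    proof (rule E_mono)
      fix v w c assume "(v, w, c) \<in> set_pmf p"
      then have val: "valid ((v, w, c) # h)" using h by (simp add: valid_Cons)
      let ?e = "(v, w, c)"
      define d where "d = rate_change u h ?e"
      \<comment> \<open>Once invented, \<open>u\<close> has a nonempty vocabulary forever, so the default value of the potential does not return.\<close>
      have inv: "history_vocab (?e # h) u \<noteq> {}"
        using val False
        by (cases rule: event_cases[consumes 1]) (auto simp: history_vocab_Cons interact_def Let_def)
      have vz: "1 \<le> vsize h w" if "u \<in> history_vocab h w" by (rule vsize_pos[OF h that])
      have le2: "1 / (vsize h w + 1) \<le> 2" by (simp add: divide_le_eq)
      have frac: "0 \<le> of_bool (u \<in> history_vocab h w) / (vsize h w * (vsize h w + 1))"
        "of_bool (u \<in> history_vocab h w) / (vsize h w * (vsize h w + 1)) \<le> 1"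
      proof -
        show "of_bool (u \<in> history_vocab h w) / (vsize h w * (vsize h w + 1)) \<le> 1"
        proof (cases "u \<in> history_vocab h w")
          case True
          have "1 * 1 \<le> vsize h w * (vsize h w + 1)" using vz[OF True] by (intro mult_mono) simp_all
          then show ?thesis using True by (simp add: divide_le_eq)
        qed simp
      qed simp
      have d2: "\<bar>d\<bar> \<le> 2" and dXY: "d + \<eta> * \<bar>d\<bar> \<le> of_bool (says u h ?e) * (X w + Y w) - Y w"
      proof -
        show "\<bar>d\<bar> \<le> 2"
          using frac le2 unfolding d_def rate_change_def by (simp add: Let_def)
        show "d + \<eta> * \<bar>d\<bar> \<le> of_bool (says u h ?e) * (X w + Y w) - Y w"
        proof (cases "says u h ?e")
          case True
          have d: "d = (if u \<in> history_vocab h w then 2 else 1 / (vsize h w + 1))"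
            using True by (simp add: d_def rate_change_def)
          then have "d \<le> 1 / (vsize h w + 1) + 2 * of_bool (u \<in> history_vocab h w)" by simp
          moreover have "0 \<le> d" unfolding d by simp
          ultimately have "(1 + \<eta>) * d \<le> X w" unfolding X_def using eta by (intro mult_left_mono) simp_all
          then show ?thesis using True \<open>0 \<le> d\<close> by (simp add: distrib_right)
        next
          case False
          define q where "q = of_bool (u \<in> history_vocab h w) / (vsize h w * (vsize h w + 1))"
          have "d = - q" using False by (simp add: d_def rate_change_def q_def)
          moreover have "Y w = (1 - \<eta>) * q" by (simp add: Y_def q_def)
          moreover have "0 \<le> q" using frac(1) by (simp add: q_def)
          ultimately have "d + \<eta> * \<bar>d\<bar> = - Y w" by (simp add: left_diff_distrib)
          then show ?thesis using False by simp
        qed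
      qed
      have "word_potential u (?e # h) \<le> ?R + d"
        using word_rate_step[OF val False] inv by (simp add: word_potential_def d_def)
      then have "(word_potential u (?e # h) + c0) ^ k \<le> (x + d) ^ k"
        using pot0[of "?e # h"] c0' by (intro power_mono) (simp_all add: x_def)
      also have "\<dots> \<le> x ^ k * (1 + real k / x * (d + \<eta> * \<bar>d\<bar>))"
        by (rule power_perturb[OF eta d2 k x(2)])
      also have "\<dots> \<le> x ^ k * (1 + real k / x * (of_bool (says u h ?e) * (X w + Y w) - Y w))"
        using dXY x(1) by (intro mult_left_mono add_left_mono) simp_all
      finally show "(word_potential u (?e # h) + c0) ^ k
        \<le> x ^ k * (1 + real k / x * (of_bool (says u h ?e) * (X (fst (snd ?e)) + Y (fst (snd ?e))) - Y (fst (snd ?e))))" by simp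
    qed
    also have "\<dots> = x ^ k * (1 + real k / x * E (\<lambda>e. of_bool (says u h e) * (X (fst (snd e)) + Y (fst (snd e))) - Y (fst (snd e))))"
      by simp
    also have "\<dots> \<le> x ^ k * (1 + real k / x * (?R * ?G))"
      using mean_rate_change[OF h nb len u] x(1) unfolding X_def Y_def
      by (intro mult_left_mono add_left_mono) simp_all
    also have "\<dots> \<le> x ^ k * (1 + real k * ?G)"
    proof -
      have "?R / x \<le> 1" using x(1) c0' by (simp add: x_def)
      then have "real k * ?G * (?R / x) \<le> real k * ?G * 1" using G by (intro mult_left_mono) simp_all
      then show ?thesis using x(1) by (intro mult_left_mono add_left_mono) (simp_all add: mult_ac)
    qed
    finally show ?thesis by (simp add: pot x_def)
  qed
qed

text \<open>
  A closed form bound for the sum of the growth rates along a history: the sum of the losses is at least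
  the telescoping sum of the logarithms of the size bounds.
\<close>

definition growth_total :: "event list \<Rightarrow> real" where
  "growth_total h = (1 + \<eta>)\<^sup>2 * exposure h + 8 * \<rho> * size_bound (real M) / (real n)\<^sup>2 * real (length h)
     - (1 - \<eta>)\<^sup>2 / (1 + \<eta>) * ln (size_bound (real (length h)) / \<kappa>)"

lemma growth_total_Nil: "growth_total [] = 0"
  using kappa by (simp add: growth_total_def size_bound_def)

lemma growth_total_step: "growth_total h + growth h \<le> growth_total (e # h)"
proof -
  let ?K = "size_bound (real (length h))" and ?K' = "size_bound (real (length (e # h)))"
  have K: "0 < ?K" "0 < ?K'" using size_bound_ge[of "real (length h)"] size_bound_ge[of "real (length (e # h))"] by simp_all
  have "?K' = ?K + (1 + \<eta>) / real n" by (simp add: size_bound_def add_divide_distrib distrib_left)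
  then have "?K' / ?K - 1 = (1 + \<eta>) / (real n * ?K)" using K by (simp add: add_divide_distrib)
  moreover have "ln (?K' / ?K) \<le> ?K' / ?K - 1" using K by (intro ln_le_minus_one divide_pos_pos)
  moreover have "ln (?K' / ?K) = ln (?K' / \<kappa>) - ln (?K / \<kappa>)"
    using K kappa by (simp add: ln_divide_pos)
  ultimately have "ln (?K' / \<kappa>) - ln (?K / \<kappa>) \<le> (1 + \<eta>) / (real n * ?K)" by simp
  then have "(1 - \<eta>)\<^sup>2 / (1 + \<eta>) * (ln (?K' / \<kappa>) - ln (?K / \<kappa>)) \<le> (1 - \<eta>)\<^sup>2 / (1 + \<eta>) * ((1 + \<eta>) / (real n * ?K))"
    using eta by (intro mult_left_mono) simp_all
  also have "\<dots> = (1 - \<eta>)\<^sup>2 / (real n * ?K)" using eta by simp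
  finally have ln_part: "(1 - \<eta>)\<^sup>2 / (1 + \<eta>) * ln (?K' / \<kappa>) - (1 - \<eta>)\<^sup>2 / (1 + \<eta>) * ln (?K / \<kappa>) \<le> (1 - \<eta>)\<^sup>2 / (real n * ?K)"
    unfolding right_diff_distrib .
  define A where "A = 8 * \<rho> * size_bound (real M) / (real n)\<^sup>2"
  have "A * real (length (e # h)) = A * real (length h) + A" by (simp add: distrib_left)
  moreover have "(1 + \<eta>)\<^sup>2 * exposure (e # h) = (1 + \<eta>)\<^sup>2 * exposure h + (1 + \<eta>)\<^sup>2 * exposure_step h"
    by (simp add: distrib_left)
  ultimately show ?thesis unfolding growth_total_def growth_def A_def[symmetric] using ln_part by linarith
qed

lemma drift_discounted_potential:
  assumes h: "valid h" and nb: "\<not> bad h" and len: "length h \<le> M" and u: "u \<in> V"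
    and k: "1 \<le> k" and c0: "2 * real k / \<eta> \<le> c0"
  shows "E (\<lambda>e. (word_potential u (e # h) + c0) ^ k * exp (- real k * growth_total (e # h)))
    \<le> (word_potential u h + c0) ^ k * exp (- real k * growth_total h)"
proof -
  let ?G = "growth h"
  have "0 < 2 * real k / \<eta>" using eta k by (intro divide_pos_pos) simp_all
  then have c0': "0 < c0" using c0 by (rule less_le_trans)
  have pot0: "0 \<le> word_potential u h' + c0" for h' using word_rate_nonneg[of u h'] c0' by (simp add: word_potential_def)
  define q where "q = exp (- real k * (growth_total h + ?G))"
  have "E (\<lambda>e. (word_potential u (e # h) + c0) ^ k * exp (- real k * growth_total (e # h)))
      \<le> E (\<lambda>e. (word_potential u (e # h) + c0) ^ k * q)"
  proof (rule E_mono)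
    fix v w c
    have "- real k * growth_total ((v, w, c) # h) \<le> - real k * (growth_total h + ?G)"
      using mult_left_mono[OF growth_total_step[of h "(v, w, c)"], of "real k"] by simp
    then have "exp (- real k * growth_total ((v, w, c) # h)) \<le> q" unfolding q_def exp_le_cancel_iff .
    then show "(word_potential u ((v, w, c) # h) + c0) ^ k * exp (- real k * growth_total ((v, w, c) # h))
      \<le> (word_potential u ((v, w, c) # h) + c0) ^ k * q"
      using pot0 by (intro mult_left_mono zero_le_power)
  qed
  also have "\<dots> = E (\<lambda>e. (word_potential u (e # h) + c0) ^ k) * q" by simp
  also have "\<dots> \<le> (word_potential u h + c0) ^ k * (1 + real k * ?G) * q"
    by (rule mult_right_mono[OF drift_word_potential[OF assms]]) (simp add: q_def)
  also have "\<dots> \<le> (word_potential u h + c0) ^ k * exp (real k * ?G) * q"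
    using pot0 by (intro mult_right_mono mult_left_mono exp_ge_add_one_self) (simp_all add: q_def)
  also have "\<dots> = (word_potential u h + c0) ^ k * (exp (real k * ?G) * exp (- real k * (growth_total h + ?G)))"
    by (simp add: q_def)
  also have "exp (real k * ?G) * exp (- real k * (growth_total h + ?G)) = exp (- real k * growth_total h)"
    unfolding exp_add[symmetric] by (simp add: algebra_simps)
  finally show ?thesis .
qed

text \<open>
  The logarithmic terms in the exposure and in the loss differ only by the factor \<open>1 + O(\<eta>)\<close>.
\<close>

lemma growth_total_le:
  assumes h: "valid h" and ex: "exposure_excess h \<le> \<sigma>" and len: "length h \<le> M"
    and M: "real M + 2 * real n \<le> 2 * (real n)\<^sup>2"
  shows "growth_total h \<le> 4 * \<sigma> + 8 * \<eta> * ln (real n) + 8 * \<rho> * size_bound (real M) / (real n)\<^sup>2 * real M + ln \<kappa>"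
proof -
  define t where "t = ln ((real (length h) + 2 * real n) / (2 * real n))"
  define c1 where "c1 = (1 - \<eta>)\<^sup>2 / (1 + \<eta>)"
  let ?K = "size_bound (real (length h))"
  have "1 \<le> (real (length h) + 2 * real n) / (2 * real n)" using n_pos by (simp add: field_simps)
  then have t0: "0 \<le> t" unfolding t_def by (rule ln_ge_zero)
  have "(real (length h) + 2 * real n) / (2 * real n) \<le> real n"
    using M len n_pos by (simp add: divide_le_eq power2_eq_square)
  then have tn: "t \<le> ln (real n)" unfolding t_def using n_pos by (subst ln_le_cancel_iff) simp_all
  have "(real (length h) + 2 * real n) / (2 * real n) \<le> ?K"
  proof -
    have "(real (length h) + 2 * real n) / (2 * real n) = real (length h) / real n / 2 + 1" using n_pos by (simp add: add_divide_distrib)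
    also have "real (length h) / real n / 2 \<le> (1 + \<eta>) * (real (length h) / real n)"
    proof -
      have "1 / 2 * (real (length h) / real n) \<le> (1 + \<eta>) * (real (length h) / real n)"
        using eta by (intro mult_right_mono) simp_all
      then show ?thesis by simp
    qed
    finally show ?thesis using kappa unfolding size_bound_def by simp
  qed
  then have "t \<le> ln ?K" unfolding t_def using n_pos size_bound_ge[of "real (length h)"] by (subst ln_le_cancel_iff) simp_all
  moreover have "ln (?K / \<kappa>) = ln ?K - ln \<kappa>" using size_bound_ge[of "real (length h)"] kappa by (intro ln_divide_pos) simp_all
  ultimately have lnK: "t - ln \<kappa> \<le> ln (?K / \<kappa>)" by simp
  have c1: "0 \<le> c1" "c1 \<le> 1"
  proof -
    show "0 \<le> c1" using eta by (simp add: c1_def)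
    have "(1 - \<eta>)\<^sup>2 \<le> 1 ^ 2" using eta by (intro power_mono) simp_all
    then show "c1 \<le> 1" using eta by (simp add: c1_def divide_le_eq)
  qed
  \<comment> \<open>The coefficient of the logarithm that remains after cancellation is small.\<close>
  have c1t: "(1 + \<eta>)\<^sup>2 - c1 \<le> 8 * \<eta>"
  proof -
    have "(1 + \<eta>)\<^sup>2 * (1 + \<eta>) - (1 - \<eta>)\<^sup>2 = \<eta> * (5 + 2 * \<eta> + \<eta> * \<eta>)" by (simp add: power2_eq_square algebra_simps)
    also have "\<dots> \<le> \<eta> * (8 * (1 + \<eta>))"
    proof (rule mult_left_mono)
      have "\<eta> * \<eta> \<le> 1 * 1" using eta by (intro mult_mono) simp_all
      then show "5 + 2 * \<eta> + \<eta> * \<eta> \<le> 8 * (1 + \<eta>)" using eta by simp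
    qed (use eta in simp)
    finally have "(1 + \<eta>)\<^sup>2 * (1 + \<eta>) - 8 * \<eta> * (1 + \<eta>) \<le> (1 - \<eta>)\<^sup>2" by (simp add: mult_ac)
    then have "((1 + \<eta>)\<^sup>2 - 8 * \<eta>) * (1 + \<eta>) \<le> (1 - \<eta>)\<^sup>2" by (simp only: left_diff_distrib)
    then have "(1 + \<eta>)\<^sup>2 - 8 * \<eta> \<le> c1" unfolding c1_def using eta by (subst le_divide_eq) simp_all
    then show ?thesis by simp
  qed
  have "(1 + \<eta>)\<^sup>2 \<le> 2\<^sup>2" using eta by (intro power_mono) simp_all
  moreover have exposure: "exposure h \<le> \<sigma> + t" using ex unfolding exposure_excess_def t_def by simp
  ultimately have "(1 + \<eta>)\<^sup>2 * exposure h \<le> (1 + \<eta>)\<^sup>2 * (\<sigma> + t)" by (intro mult_left_mono) simp_all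
  also have "\<dots> = (1 + \<eta>)\<^sup>2 * \<sigma> + (1 + \<eta>)\<^sup>2 * t" by (rule distrib_left)
  also have "(1 + \<eta>)\<^sup>2 * \<sigma> \<le> 4 * \<sigma>" using \<open>(1 + \<eta>)\<^sup>2 \<le> 2\<^sup>2\<close> sigma by (intro mult_right_mono) simp_all
  finally have a: "(1 + \<eta>)\<^sup>2 * exposure h \<le> 4 * \<sigma> + (1 + \<eta>)\<^sup>2 * t" by simp
  have b: "c1 * (t - ln \<kappa>) \<le> c1 * ln (?K / \<kappa>)" by (rule mult_left_mono[OF lnK c1(1)])
  have c: "((1 + \<eta>)\<^sup>2 - c1) * t \<le> 8 * \<eta> * ln (real n)"
  proof -
    have "((1 + \<eta>)\<^sup>2 - c1) * t \<le> 8 * \<eta> * t" by (rule mult_right_mono[OF c1t t0])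
    also have "\<dots> \<le> 8 * \<eta> * ln (real n)" using eta tn by (intro mult_left_mono) simp_all
    finally show ?thesis .
  qed
  have "0 \<le> ln \<kappa>" using kappa by (intro ln_ge_zero) simp
  then have d: "c1 * ln \<kappa> \<le> ln \<kappa>" using mult_right_mono[OF c1(2), of "ln \<kappa>"] by simp
  have "0 \<le> 8 * \<rho> * size_bound (real M) / (real n)\<^sup>2" using rho size_bound_ge[of "real M"] by simp
  then have e: "8 * \<rho> * size_bound (real M) / (real n)\<^sup>2 * real (length h) \<le> 8 * \<rho> * size_bound (real M) / (real n)\<^sup>2 * real M"
    using len by (intro mult_left_mono) simp_all
  have f1: "c1 * (t - ln \<kappa>) = c1 * t - c1 * ln \<kappa>" by (rule right_diff_distrib)
  have f2: "((1 + \<eta>)\<^sup>2 - c1) * t = (1 + \<eta>)\<^sup>2 * t - c1 * t" by (rule left_diff_distrib)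
  have g: "growth_total h = (1 + \<eta>)\<^sup>2 * exposure h
      + 8 * \<rho> * size_bound (real M) / (real n)\<^sup>2 * real (length h) - c1 * ln (?K / \<kappa>)"
    by (simp only: growth_total_def c1_def)
  show ?thesis unfolding g using a b[unfolded f1] c[unfolded f2] d e by linarith
qed

end

section \<open>The number of agreements\<close>

context controlled_game
begin

abbreviation "stopped \<equiv> stopped_pmf bad p M"

definition agreement_rate :: real where
  "agreement_rate = \<rho> * size_bound (real M) / (real n - 1)"

lemma finite_stopped: "finite (set_pmf stopped)"
  by (rule finite_set_stopped_pmf[OF finite_p])

lemma stopped_valid: "h \<in> set_pmf stopped \<Longrightarrow> valid h" "h \<in> set_pmf stopped \<Longrightarrow> length h \<le> M"
  using set_stopped_pmf[of h bad p M] by (auto simp: valid_def)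

lemma integrable_stopped [simp]: "integrable (measure_pmf stopped) (f :: _ \<Rightarrow> real)"
  by (rule integrable_measure_pmf_finite[OF finite_stopped])

text \<open>
  As long as the history is not bad, the number of holders of every word is bounded.
\<close>

lemma expected_agreements: "measure_pmf.expectation stopped (\<lambda>h. real (agreements h)) \<le> agreement_rate * real M"
proof -
  have rate0: "0 \<le> agreement_rate"
    unfolding agreement_rate_def using rho n_pos size_bound_ge[of "real M"] by simp
  have "measure_pmf.expectation stopped (\<lambda>h. real (agreements h) - agreement_rate * real (length h))
      \<le> real (agreements []) - agreement_rate * real (length ([] :: event list))"
  proof (rule expectation_stopped_le[OF finite_p])
    fix h assume h: "set h \<subseteq> set_pmf p" "length h < M" "\<not> bad h"
    have val: "valid h" using h(1) by (simp add: valid_def)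
    have "holders u h \<le> \<rho> * size_bound (real M)" if "u \<in> V" for u
    proof -
      have "\<rho> * size_bound (real (length h)) \<le> \<rho> * size_bound (real M)"
        using rho h(2) by (intro mult_left_mono size_bound_mono) simp_all
      then show ?thesis using holders_le[OF val h(3) that] by linarith
    qed
    then have "E (\<lambda>e. of_bool (agrees (history_vocab h) e)) \<le> agreement_rate"
      unfolding agreement_rate_def using rho size_bound_ge[of "real M"] by (intro agreement_probability[OF val]) simp_all
    then show "E (\<lambda>e. real (agreements (e # h)) - agreement_rate * real (length (e # h))) \<le> real (agreements h) - agreement_rate * real (length h)"
      by (simp add: distrib_left)
  qed
  then have "measure_pmf.expectation stopped (\<lambda>h. real (agreements h)) \<le> measure_pmf.expectation stopped (\<lambda>h. agreement_rate * real (length h))"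
    by simp
  also have "\<dots> \<le> measure_pmf.expectation stopped (\<lambda>h. agreement_rate * real M)"
    by (rule expectation_mono_pmf[OF finite_stopped]) (use rate0 stopped_valid(2) in \<open>simp add: mult_left_mono\<close>)
  finally show ?thesis by simp
qed

lemma large_vocabulary_unlikely:
  "measure_pmf.prob stopped {h. \<exists>x\<in>V. size_bound (real (length h)) < vsize h x + 1} \<le> real n * exp (\<eta> - \<eta> * (\<kappa> - 1))"
proof -
  have one: "measure_pmf.prob stopped {h. size_bound (real (length h)) < vsize h x + 1} \<le> exp (\<eta> - \<eta> * (\<kappa> - 1))" if x: "x \<in> V" for x
  proof -
    let ?f = "\<lambda>h. exp (\<eta> * max (vsize h x) 1 - (1 + \<eta>) * \<eta> * real (length h) / real n)"
    have "measure_pmf.prob stopped {h. size_bound (real (length h)) < vsize h x + 1} \<le> measure_pmf.expectation stopped ?f / exp (\<eta> * (\<kappa> - 1))"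
    proof (rule markov_pmf[OF finite_stopped])
      fix h assume "size_bound (real (length h)) < vsize h x + 1"
      then have "(1 + \<eta>) * real (length h) / real n + (\<kappa> - 1) \<le> max (vsize h x) 1" unfolding size_bound_def by simp
      then have "\<eta> * ((1 + \<eta>) * real (length h) / real n + (\<kappa> - 1)) \<le> \<eta> * max (vsize h x) 1"
        using eta by (intro mult_left_mono) simp_all
      then have "\<eta> * (\<kappa> - 1) \<le> \<eta> * max (vsize h x) 1 - (1 + \<eta>) * \<eta> * real (length h) / real n"
      proof -
        have "(1 + \<eta>) * \<eta> * real (length h) / real n = \<eta> * ((1 + \<eta>) * real (length h) / real n)" by simp
        then show ?thesis using \<open>\<eta> * ((1 + \<eta>) * real (length h) / real n + (\<kappa> - 1)) \<le> \<eta> * max (vsize h x) 1\<close>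
          unfolding distrib_left[of \<eta>] by linarith
      qed
      then show "exp (\<eta> * (\<kappa> - 1)) \<le> ?f h" by simp
    qed simp_all
    also have "measure_pmf.expectation stopped ?f \<le> ?f []"
      by (rule expectation_stopped_le[OF finite_p]) (rule drift_vsize, use eta x in \<open>auto simp: valid_def\<close>)
    also have "?f [] = exp \<eta>" by simp
    finally show ?thesis by (simp add: exp_diff divide_right_mono)
  qed
  have "{h. \<exists>x\<in>V. size_bound (real (length h)) < vsize h x + 1} = (\<Union>x\<in>V. {h. size_bound (real (length h)) < vsize h x + 1})" by blast
  then have "measure_pmf.prob stopped {h. \<exists>x\<in>V. size_bound (real (length h)) < vsize h x + 1}
      \<le> (\<Sum>x\<in>V. measure_pmf.prob stopped {h. size_bound (real (length h)) < vsize h x + 1})"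
    by (simp only:) (rule measure_pmf.finite_measure_subadditive_finite, simp_all)
  also have "\<dots> \<le> (\<Sum>x\<in>V. exp (\<eta> - \<eta> * (\<kappa> - 1)))" by (intro sum_mono one)
  finally show ?thesis by simp
qed

lemma large_exposure_unlikely:
  "measure_pmf.prob stopped {h. \<sigma> < exposure_excess h} \<le> (2 + (2 * harm n + 1) / real n * (agreement_rate * real M)) / \<sigma>"
proof -
  let ?a = "(2 * harm n + 1) / real n"
  let ?H = "\<lambda>h. (\<Sum>x\<in>V. harm (card (history_vocab h x))) / real n"
  let ?t = "\<lambda>h. ln ((real (length (h :: event list)) + 2 * real n) / (2 * real n))"
  have a0: "0 \<le> ?a" by (intro divide_nonneg_nonneg add_nonneg_nonneg mult_nonneg_nonneg harm_nonneg) simp_all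
  have "measure_pmf.expectation stopped (\<lambda>h. exposure h - ?H h - ?a * real (agreements h)) \<le> exposure [] - ?H [] - ?a * real (agreements [])"
    by (rule expectation_stopped_le[OF finite_p]) (rule drift_exposure, simp add: valid_def)
  also have "\<dots> = 0" by (simp add: harm_def)
  finally have ex: "measure_pmf.expectation stopped exposure - measure_pmf.expectation stopped ?H - ?a * measure_pmf.expectation stopped (\<lambda>h. real (agreements h)) \<le> 0"
    by simp
  have "measure_pmf.expectation stopped ?H \<le> measure_pmf.expectation stopped (\<lambda>h. 2 + ?t h)"
    by (rule expectation_mono_pmf[OF finite_stopped]) (rule harm_average_le[OF stopped_valid(1)])
  then have H: "measure_pmf.expectation stopped ?H \<le> 2 + measure_pmf.expectation stopped ?t" by simp
  have "measure_pmf.expectation stopped exposure_excess = measure_pmf.expectation stopped exposure - measure_pmf.expectation stopped ?t"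
    unfolding exposure_excess_def[abs_def] by simp
  also have "\<dots> \<le> 2 + ?a * measure_pmf.expectation stopped (\<lambda>h. real (agreements h))" using ex H by linarith
  also have "\<dots> \<le> 2 + ?a * (agreement_rate * real M)"
    by (intro add_left_mono mult_left_mono expected_agreements a0)
  finally have E: "measure_pmf.expectation stopped exposure_excess \<le> 2 + ?a * (agreement_rate * real M)" .
  have "measure_pmf.prob stopped {h. \<sigma> < exposure_excess h} \<le> measure_pmf.expectation stopped exposure_excess / \<sigma>"
    by (rule markov_pmf[OF finite_stopped]) (use sigma exposure_excess_nonneg[OF stopped_valid(1)] in simp_all)
  also have "\<dots> \<le> (2 + ?a * (agreement_rate * real M)) / \<sigma>"
    by (rule divide_right_mono[OF E]) (use sigma in simp)
  finally show ?thesis .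
qed

definition growth_cap :: real where
  "growth_cap = 4 * \<sigma> + 8 * \<eta> * ln (real n) + 8 * \<rho> * size_bound (real M) / (real n)\<^sup>2 * real M + ln \<kappa>"

text \<open>
  A high power \<open>k\<close> is needed because the bound is summed over all \<open>n\<close> words.
\<close>

lemma popular_word_unlikely:
  assumes M: "real M + 2 * real n \<le> 2 * (real n)\<^sup>2" and k: "1 \<le> k"
  shows "measure_pmf.prob stopped {h. (\<exists>u\<in>V. \<rho> < word_potential u h) \<and> exposure_excess h \<le> \<sigma>}
    \<le> real n * ((2 + 2 * real k / \<eta>) ^ k * exp (real k * growth_cap) / \<rho> ^ k)"
proof -
  define c0 where "c0 = 2 * real k / \<eta>"
  have c0: "0 < c0" unfolding c0_def using eta k by (intro divide_pos_pos) simp_all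
  have one: "measure_pmf.prob stopped {h. \<rho> < word_potential u h \<and> exposure_excess h \<le> \<sigma>}
      \<le> (2 + c0) ^ k * exp (real k * growth_cap) / \<rho> ^ k" if u: "u \<in> V" for u
  proof -
    let ?f = "\<lambda>h. (word_potential u h + c0) ^ k * exp (- real k * growth_total h)"
    have pot0: "0 \<le> word_potential u h + c0" for h using word_rate_nonneg[of u h] c0 by (simp add: word_potential_def)
    have thr: "0 < \<rho> ^ k * exp (- real k * growth_cap)" using rho by simp
    have "measure_pmf.prob stopped {h. \<rho> < word_potential u h \<and> exposure_excess h \<le> \<sigma>}
        \<le> measure_pmf.expectation stopped ?f / (\<rho> ^ k * exp (- real k * growth_cap))"
    proof (rule markov_pmf[OF finite_stopped _ thr])
      fix h
      show "0 \<le> ?f h" by (intro mult_nonneg_nonneg zero_le_power pot0) simp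
      assume h: "h \<in> set_pmf stopped" and ev: "\<rho> < word_potential u h \<and> exposure_excess h \<le> \<sigma>"
      have "growth_total h \<le> growth_cap"
        unfolding growth_cap_def using ev by (intro growth_total_le stopped_valid[OF h] M) simp
      then have "exp (- real k * growth_cap) \<le> exp (- real k * growth_total h)"
        by (simp add: mult_left_mono)
      moreover have "\<rho> ^ k \<le> (word_potential u h + c0) ^ k" using ev rho c0 by (intro power_mono) simp_all
      ultimately show "\<rho> ^ k * exp (- real k * growth_cap) \<le> ?f h"
        using pot0 by (intro mult_mono zero_le_power) simp_all
    qed
    also have "\<dots> \<le> ?f [] / (\<rho> ^ k * exp (- real k * growth_cap))"
    proof (rule divide_right_mono)
      show "measure_pmf.expectation stopped ?f \<le> ?f []"
      proof (rule expectation_stopped_le[OF finite_p])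
        fix h assume "set h \<subseteq> set_pmf p" "length h < M" "\<not> bad h"
        then show "E (\<lambda>e. ?f (e # h)) \<le> ?f h"
          by (intro drift_discounted_potential u k) (simp_all add: valid_def c0_def)
      qed
    qed (use thr in simp)
    also have "?f [] = (2 + c0) ^ k" by (simp add: growth_total_Nil word_potential_def)
    also have "(2 + c0) ^ k / (\<rho> ^ k * exp (- real k * growth_cap)) = (2 + c0) ^ k * exp (real k * growth_cap) / \<rho> ^ k"
      by (simp add: exp_minus divide_simps)
    finally show ?thesis .
  qed
  have "{h. (\<exists>u\<in>V. \<rho> < word_potential u h) \<and> exposure_excess h \<le> \<sigma>} = (\<Union>u\<in>V. {h. \<rho> < word_potential u h \<and> exposure_excess h \<le> \<sigma>})" by blast
  then have "measure_pmf.prob stopped {h. (\<exists>u\<in>V. \<rho> < word_potential u h) \<and> exposure_excess h \<le> \<sigma>}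
      \<le> (\<Sum>u\<in>V. measure_pmf.prob stopped {h. \<rho> < word_potential u h \<and> exposure_excess h \<le> \<sigma>})"
    by (simp only:) (rule measure_pmf.finite_measure_subadditive_finite, simp_all)
  also have "\<dots> \<le> (\<Sum>u\<in>V. (2 + c0) ^ k * exp (real k * growth_cap) / \<rho> ^ k)" by (intro sum_mono one)
  finally show ?thesis by (simp add: c0_def)
qed

text \<open>
  Either some estimate fails, or the expected number of agreements is small.
\<close>

lemma agreements_tail:
  assumes M: "real M + 2 * real n \<le> 2 * (real n)\<^sup>2" and k: "1 \<le> k" and \<alpha>: "0 < \<alpha>"
  shows "measure_pmf.prob (replicate_pmf M p) {h. \<alpha> < real (agreements h)}
    \<le> real n * ((2 + 2 * real k / \<eta>) ^ k * exp (real k * growth_cap) / \<rho> ^ k)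
      + real n * exp (\<eta> - \<eta> * (\<kappa> - 1))
      + (2 + (2 * harm n + 1) / real n * (agreement_rate * real M)) / \<sigma>
      + agreement_rate * real M / \<alpha>"
proof -
  let ?A = "{h. (\<exists>u\<in>V. \<rho> < word_potential u h) \<and> exposure_excess h \<le> \<sigma>}"
  let ?B = "{h. \<exists>x\<in>V. size_bound (real (length h)) < vsize h x + 1}"
  let ?C = "{h. \<sigma> < exposure_excess h}"
  let ?D = "{h. \<alpha> < real (agreements h)}"
  have "measure_pmf.prob (replicate_pmf M p) ?D \<le> measure_pmf.prob stopped {h. bad h \<or> \<alpha> < real (agreements h)}"
    by (rule prob_replicate_le_stopped)
  also have "\<dots> \<le> measure_pmf.prob stopped (?A \<union> (?B \<union> (?C \<union> ?D)))"
    by (rule measure_pmf.finite_measure_mono) (auto simp: bad_def)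
  also have "\<dots> \<le> measure_pmf.prob stopped ?A + (measure_pmf.prob stopped ?B + (measure_pmf.prob stopped ?C + measure_pmf.prob stopped ?D))"
    using measure_Un_le[of ?A "measure_pmf stopped" "?B \<union> (?C \<union> ?D)"] measure_Un_le[of ?B "measure_pmf stopped" "?C \<union> ?D"]
      measure_Un_le[of ?C "measure_pmf stopped" ?D] by simp
  finally have "measure_pmf.prob (replicate_pmf M p) ?D
    \<le> measure_pmf.prob stopped ?A + (measure_pmf.prob stopped ?B + (measure_pmf.prob stopped ?C + measure_pmf.prob stopped ?D))" .
  moreover have "measure_pmf.prob stopped ?D \<le> agreement_rate * real M / \<alpha>"
  proof -
    have "measure_pmf.prob stopped ?D \<le> measure_pmf.expectation stopped (\<lambda>h. real (agreements h)) / \<alpha>"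
      by (rule markov_pmf[OF finite_stopped]) (use \<alpha> in simp_all)
    also have "\<dots> \<le> agreement_rate * real M / \<alpha>"
      by (rule divide_right_mono[OF expected_agreements]) (use \<alpha> in simp)
    finally show ?thesis .
  qed
  ultimately show ?thesis
    using popular_word_unlikely[OF M k] large_vocabulary_unlikely large_exposure_unlikely by linarith
qed

end

section \<open>A lower bound for fixed parameters\<close>

lemma inventions_drop: "inventions (drop j h) \<le> inventions h"
proof (induction h arbitrary: j)
  case (Cons e h)
  show ?case
  proof (cases j)
    case (Suc i)
    then show ?thesis using Cons.IH[of i] by simp
  qed simp
qed simp

lemma agreements_drop: "agreements (drop j h) \<le> agreements h"
proof (induction h arbitrary: j)
  case (Cons e h)
  show ?case
  proof (cases j)
    case (Suc i)
    then show ?thesis using Cons.IH[of i] by simp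
  qed simp
qed simp

lemma word_count_rev: "word_count n (rev h) = card (\<Union>x\<in>{1..n}. history_vocab h x)"
  by (simp add: word_count_def history_vocab_eq)

context naming_game
begin

text \<open>
  Inventions and agreements only accumulate. So it suffices to know that the number of inventions
  is near \<open>n / 2\<close> after \<open>m0\<close> and after \<open>M\<close> interactions and that there are few agreements
  among the first \<open>M\<close> interactions.
\<close>

lemma far_lists_prob:
  assumes \<delta>: "0 < \<delta>" and m0: "m0 \<le> M"
  shows "measure_pmf.prob (replicate_pmf M p) {es. \<exists>m. m0 \<le> m \<and> m \<le> M \<and> take m es \<notin> close_lists n (\<delta> * real n)}
    \<le> 2 * (4 / (\<delta>\<^sup>2 * real n) + 2 * exp (- 2 * real m0 / real n) / \<delta>)
      + measure_pmf.prob (replicate_pmf M p) {h. \<delta> / 4 * real n < real (agreements h)}"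
proof -
  let ?R = "replicate_pmf M p"
  let ?far = "\<lambda>h. \<delta> / 2 * real n < \<bar>real (inventions h) - real n / 2\<bar>"
  let ?A = "{h. ?far h}" and ?B = "{h. ?far (drop (M - m0) h)}" and ?D = "{h. \<delta> / 4 * real n < real (agreements h)}"
  \<comment> \<open>The law of independent trials is invariant under reversal, so the list may be read with the most recent interaction first.\<close>
  have "measure_pmf.prob ?R {es. \<exists>m. m0 \<le> m \<and> m \<le> M \<and> take m es \<notin> close_lists n (\<delta> * real n)}
      = measure_pmf.prob ?R (rev -` {es. \<exists>m. m0 \<le> m \<and> m \<le> M \<and> take m es \<notin> close_lists n (\<delta> * real n)})"
    unfolding measure_map_pmf[symmetric] map_rev_replicate_pmf by (rule refl)
  also have "\<dots> \<le> measure_pmf.prob ?R (?A \<union> (?B \<union> ?D))"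
  proof (rule measure_pmf.finite_measure_mono_AE)
    show "AE h in ?R. h \<in> rev -` {es. \<exists>m. m0 \<le> m \<and> m \<le> M \<and> take m es \<notin> close_lists n (\<delta> * real n)} \<longrightarrow> h \<in> ?A \<union> (?B \<union> ?D)"
    proof (rule AE_pmfI, rule impI, rule ccontr)
      fix h assume hR: "h \<in> set_pmf ?R" and no: "h \<notin> ?A \<union> (?B \<union> ?D)"
        and far: "h \<in> rev -` {es. \<exists>m. m0 \<le> m \<and> m \<le> M \<and> take m es \<notin> close_lists n (\<delta> * real n)}"
      have h: "valid h" "length h = M" using hR by (auto simp: set_replicate_pmf valid_def)
      obtain m where m: "m0 \<le> m" "m \<le> M" "take m (rev h) \<notin> close_lists n (\<delta> * real n)" using far by auto
      define g where "g = drop (M - m) h"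
      have g: "take m (rev h) = rev g" using m(2) h(2) by (simp add: g_def take_rev)
      have vg: "valid g" using h(1) unfolding g_def valid_def by (meson set_drop_subset subset_trans)
      have "drop (M - m0) h = drop (m - m0) g" using m unfolding g_def drop_drop by simp
      then have "inventions (drop (M - m0) h) \<le> inventions g" by (simp add: inventions_drop)
      moreover have "inventions g \<le> inventions h" "agreements g \<le> agreements h"
        unfolding g_def by (rule inventions_drop, rule agreements_drop)
      moreover have "word_count n (rev g) \<le> inventions g" "inventions g \<le> word_count n (rev g) + 2 * agreements g"
        unfolding word_count_rev by (rule words_le_inventions[OF vg], rule inventions_le_words[OF vg])
      ultimately have "real (inventions (drop (M - m0) h)) - 2 * real (agreements h) \<le> real (word_count n (rev g))"
        "real (word_count n (rev g)) \<le> real (inventions h)" by linarith+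
      moreover have "\<bar>real (inventions h) - real n / 2\<bar> \<le> \<delta> / 2 * real n"
        "\<bar>real (inventions (drop (M - m0) h)) - real n / 2\<bar> \<le> \<delta> / 2 * real n"
        "real (agreements h) \<le> \<delta> / 4 * real n" using no by simp_all
      moreover have "0 \<le> \<delta> * real n" using \<delta> by simp
      ultimately have "\<bar>real (word_count n (rev g)) - real n / 2\<bar> \<le> \<delta> * real n" by linarith
      then show False using m(3) unfolding g close_lists_def by simp
    qed
  qed simp
  also have "\<dots> \<le> measure_pmf.prob ?R ?A + (measure_pmf.prob ?R ?B + measure_pmf.prob ?R ?D)"
    using measure_Un_le[of ?A "measure_pmf ?R" "?B \<union> ?D"] measure_Un_le[of ?B "measure_pmf ?R" ?D] by simp
  finally have le: "measure_pmf.prob ?R {es. \<exists>m. m0 \<le> m \<and> m \<le> M \<and> take m es \<notin> close_lists n (\<delta> * real n)}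
    \<le> measure_pmf.prob ?R ?A + (measure_pmf.prob ?R ?B + measure_pmf.prob ?R ?D)" .
  have conc: "measure_pmf.prob (replicate_pmf m p) {h. ?far h} \<le> 4 / (\<delta>\<^sup>2 * real n) + 2 * exp (- 2 * real m0 / real n) / \<delta>"
    if "m0 \<le> m" for m
  proof -
    have "measure_pmf.prob (replicate_pmf m p) {h. ?far h} \<le> 1 / ((\<delta> / 2)\<^sup>2 * real n) + exp (- 2 * real m / real n) / (\<delta> / 2)"
      using \<delta> by (intro inventions_concentration) simp
    also have "1 / ((\<delta> / 2)\<^sup>2 * real n) = 4 / (\<delta>\<^sup>2 * real n)" by (simp add: power2_eq_square)
    also have "exp (- 2 * real m / real n) / (\<delta> / 2) \<le> 2 * exp (- 2 * real m0 / real n) / \<delta>"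
    proof -
      have "exp (- 2 * real m / real n) \<le> exp (- 2 * real m0 / real n)" using that n_pos by (simp add: divide_right_mono)
      then show ?thesis using \<delta> by (simp add: divide_right_mono)
    qed
    finally show ?thesis by simp
  qed
  have "measure_pmf.prob ?R ?B = measure_pmf.prob (map_pmf (drop (M - m0)) ?R) {h. ?far h}"
    unfolding measure_map_pmf by (simp add: vimage_def)
  also have "map_pmf (drop (M - m0)) ?R = replicate_pmf m0 p"
    using map_drop_replicate_pmf[of "M - m0" m0 p] m0 by simp
  finally have "measure_pmf.prob ?R ?B \<le> 4 / (\<delta>\<^sup>2 * real n) + 2 * exp (- 2 * real m0 / real n) / \<delta>"
    using conc[of m0] by simp
  moreover have "X \<le> 2 * c + D" if "X \<le> A + (B + D)" "A \<le> c" "B \<le> c" for X A B D c :: real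
    using that by linarith
  ultimately show ?thesis using le conc[OF m0] by blast
qed

end

lemma close_event_mono:
  assumes "0 \<le> D" "a' \<le> a" "b \<le> b'"
  shows "close_event n a' b' D \<subseteq> close_event n a b D"
proof
  fix \<omega> assume "\<omega> \<in> close_event n a' b' D"
  then show "\<omega> \<in> close_event n a b D"
    unfolding close_event_iff[OF assms(1)] using assms(2,3) by (meson atLeastAtMost_iff order_trans)
qed

lemma close_event_lower_bound:
  assumes n: "2 \<le> n" and \<delta>: "0 < \<delta>" and a: "0 < a" and m0: "m0 \<le> M"
    and eta: "0 < \<eta>" "\<eta> \<le> 1" and kappa: "2 \<le> \<kappa>" and rho: "0 < \<rho>" "\<rho> \<le> \<eta> * (real n - 1)"
    and eta_n: "1 \<le> \<eta> * (real n - 1)" and sigma: "0 < \<sigma>"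
    and M: "real M + 2 * real n \<le> 2 * (real n)\<^sup>2" and k: "1 \<le> k"
    and Q: "\<rho> * ((1 + \<eta>) * real M / real n + \<kappa>) * real M \<le> Q"
  shows "1 - real m0 / (real n * a) - exp (real n * b) * (1 / 2) ^ M
      - 2 * (4 / (\<delta>\<^sup>2 * real n) + 2 * exp (- 2 * real m0 / real n) / \<delta>)
      - (real n * ((2 + 2 * real k / \<eta>) ^ k * exp (real k * (4 * \<sigma> + 8 * \<eta> * ln (real n) + 8 * Q / (real n)\<^sup>2 + ln \<kappa>)) / \<rho> ^ k)
      + real n * exp (\<eta> - \<eta> * (\<kappa> - 1))
      + (2 + (2 * (1 + ln (real n + 1)) + 1) / real n * (Q / (real n - 1))) / \<sigma>
      + Q / (real n - 1) / (\<delta> / 4 * real n))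
    \<le> measure (game_space n) (close_event n a b (\<delta> * real n))"
proof -
  interpret controlled_game n \<rho> \<eta> \<kappa> \<sigma> M
    by unfold_locales (use n eta kappa rho eta_n sigma in auto)
  have Q': "\<rho> * size_bound (real M) * real M \<le> Q" using Q by (simp add: size_bound_def)
  have Q0: "0 \<le> \<rho> * size_bound (real M) * real M" using rho size_bound_ge[of "real M"] by simp
  have "growth_cap = 4 * \<sigma> + 8 * \<eta> * ln (real n) + 8 * (\<rho> * size_bound (real M) * real M) / (real n)\<^sup>2 + ln \<kappa>"
    by (simp add: growth_cap_def)
  also have "\<dots> \<le> 4 * \<sigma> + 8 * \<eta> * ln (real n) + 8 * Q / (real n)\<^sup>2 + ln \<kappa>"
    using Q' by (intro add_mono divide_right_mono mult_left_mono order_refl) simp_all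
  finally have g: "growth_cap \<le> 4 * \<sigma> + 8 * \<eta> * ln (real n) + 8 * Q / (real n)\<^sup>2 + ln \<kappa>" .
  have t1: "real n * ((2 + 2 * real k / \<eta>) ^ k * exp (real k * growth_cap) / \<rho> ^ k)
      \<le> real n * ((2 + 2 * real k / \<eta>) ^ k * exp (real k * (4 * \<sigma> + 8 * \<eta> * ln (real n) + 8 * Q / (real n)\<^sup>2 + ln \<kappa>)) / \<rho> ^ k)"
  proof -
    have "real k * growth_cap \<le> real k * (4 * \<sigma> + 8 * \<eta> * ln (real n) + 8 * Q / (real n)\<^sup>2 + ln \<kappa>)"
      by (rule mult_left_mono[OF g]) simp
    then show ?thesis using eta rho by (intro mult_left_mono divide_right_mono) simp_all
  qed
  have ar: "agreement_rate * real M = \<rho> * size_bound (real M) * real M / (real n - 1)"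
    by (simp add: agreement_rate_def)
  then have arQ: "agreement_rate * real M \<le> Q / (real n - 1)" "0 \<le> agreement_rate * real M"
    using Q' Q0 n_pos by (simp_all add: divide_right_mono)
  have t3: "(2 + (2 * harm n + 1) / real n * (agreement_rate * real M)) / \<sigma>
      \<le> (2 + (2 * (1 + ln (real n + 1)) + 1) / real n * (Q / (real n - 1))) / \<sigma>"
  proof (intro divide_right_mono add_left_mono mult_mono arQ)
    show "2 * harm n + 1 \<le> 2 * (1 + ln (real n + 1)) + 1" using harm_le_ln[of n] by simp
    have "0 \<le> ln (real n + 1)" by (rule ln_ge_zero) simp
    then show "0 \<le> (2 * (1 + ln (real n + 1)) + 1) / real n" by simp
  qed (use sigma in simp_all)
  have t4: "agreement_rate * real M / (\<delta> / 4 * real n) \<le> Q / (real n - 1) / (\<delta> / 4 * real n)"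
    using arQ(1) \<delta> by (intro divide_right_mono) simp_all
  have al: "0 < \<delta> / 4 * real n" using \<delta> n_pos by simp
  show ?thesis
    using close_event_prob[OF n _ a, of "\<delta> * real n" m0 b M] far_lists_prob[OF \<delta> m0]
      agreements_tail[OF M k al] t1 t3 t4 \<delta> by simp
qed

section \<open>Choice of the parameters\<close>

context
  fixes e \<eta> K \<delta> :: real
  assumes e: "0 < e" "e \<le> 1 / 4" and eta: "\<eta> = e / 192" and delta: "0 < \<delta>" and K: "0 < K"
begin

lemma eta_pos: "0 < \<eta>"
  using e eta by simp

text \<open>
  A bound for the product of \<open>M\<close>, the rate bound and the size bound when \<open>M\<close> is at most
  \<open>3 * x powr (3/2 - e)\<close>. It is of order \<open>x powr (2 - 7/4 * e)\<close>, so the expected number of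
  agreements is \<open>o(x)\<close>.
\<close>

definition agreement_budget :: "real \<Rightarrow> real" where
  "agreement_budget x = x powr (e / 4) * (6 * x powr (1 / 2 - e) + 3 / \<eta> * ln x) * (3 * x powr (3 / 2 - e))"

lemma scale_conditions:
  shows "eventually (\<lambda>n. 2 \<le> 3 / \<eta> * ln (real n)) sequentially"
    and "eventually (\<lambda>n. real n powr (e / 4) \<le> \<eta> * (real n - 1)) sequentially"
    and "eventually (\<lambda>n. 1 \<le> \<eta> * (real n - 1)) sequentially"
    and "eventually (\<lambda>n. 3 * real n powr (3 / 2 - e) + 2 * real n \<le> 2 * (real n)\<^sup>2) sequentially"
    and "eventually (\<lambda>n. real n * sqrt (ln (real n)) + 1 \<le> 2 * real n powr (3 / 2 - e)) sequentially"
    and "eventually (\<lambda>n. 1 \<le> real n powr (3 / 2 - e)) sequentially"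
    and "eventually (\<lambda>n. 8 * agreement_budget (real n) / (real n)\<^sup>2 \<le> 1) sequentially"
  unfolding agreement_budget_def using e eta_pos by real_asymp+

lemma error_terms_vanish:
  shows "(\<lambda>n. (real n * sqrt (ln (real n)) + 1) / (real n * (1 / 2 * ln (real n)))) \<longlonglongrightarrow> 0"
    and "(\<lambda>n. exp (- (1 / 3) * real n powr (3 / 2 - e))) \<longlonglongrightarrow> 0"
    and "(\<lambda>n. 2 * (4 / (\<delta>\<^sup>2 * real n) + 2 * exp (- 2 * sqrt (ln (real n))) / \<delta>)) \<longlonglongrightarrow> 0"
    and "(\<lambda>n. exp (- 2 * ln (real n) + K * ln (3 / \<eta> * ln (real n)))) \<longlonglongrightarrow> 0"
    and "(\<lambda>n. real n * exp (\<eta> - \<eta> * (3 / \<eta> * ln (real n) - 1))) \<longlonglongrightarrow> 0"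
    and "(\<lambda>n. (2 + (2 * (1 + ln (real n + 1)) + 1) / real n * (agreement_budget (real n) / (real n - 1))) / (\<eta> * ln (real n))) \<longlonglongrightarrow> 0"
    and "(\<lambda>n. agreement_budget (real n) / (real n - 1) / (\<delta> / 4 * real n)) \<longlonglongrightarrow> 0"
proof -
  show "(\<lambda>n. (real n * sqrt (ln (real n)) + 1) / (real n * (1 / 2 * ln (real n)))) \<longlonglongrightarrow> 0" by real_asymp
  show "(\<lambda>n. exp (- (1 / 3) * real n powr (3 / 2 - e))) \<longlonglongrightarrow> 0" using e by real_asymp
  show "(\<lambda>n. 2 * (4 / (\<delta>\<^sup>2 * real n) + 2 * exp (- 2 * sqrt (ln (real n))) / \<delta>)) \<longlonglongrightarrow> 0" using delta by real_asymp
  show "(\<lambda>n. exp (- 2 * ln (real n) + K * ln (3 / \<eta> * ln (real n)))) \<longlonglongrightarrow> 0" using eta_pos K by real_asymp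
  show "(\<lambda>n. real n * exp (\<eta> - \<eta> * (3 / \<eta> * ln (real n) - 1))) \<longlonglongrightarrow> 0" using eta_pos by real_asymp
  show "(\<lambda>n. (2 + (2 * (1 + ln (real n + 1)) + 1) / real n * (agreement_budget (real n) / (real n - 1))) / (\<eta> * ln (real n))) \<longlonglongrightarrow> 0"
    unfolding agreement_budget_def using e eta_pos by real_asymp
  show "(\<lambda>n. agreement_budget (real n) / (real n - 1) / (\<delta> / 4 * real n)) \<longlonglongrightarrow> 0"
    unfolding agreement_budget_def using e eta_pos delta by real_asymp
qed

end

lemma nat_ceiling_le: "0 \<le> y \<Longrightarrow> real (nat \<lceil>y\<rceil>) \<le> y + 1"
  by linarith

text \<open>
  With \<open>e / 192\<close> for \<open>\<eta>\<close>, the potential of a word grows at most like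
  \<open>n powr (e / 16)\<close> up to lower order factors, much less than the bound \<open>n powr (e / 4)\<close>; the power \<open>k \<ge> 16 / e\<close> then
  makes the probability of exceeding this bound smaller than \<open>n powr (- 2)\<close>, after summation over all words, up to
  logarithmic factors.
\<close>

lemma close_event_prob_tendsto:
  fixes e \<delta> :: real
  assumes e: "0 < e" "e \<le> 1 / 4" and \<delta>: "0 < \<delta>"
  shows "\<exists>err. err \<longlonglongrightarrow> 0 \<and> eventually (\<lambda>n. 1 - err n
    \<le> measure (game_space n) (close_event n (1 / 2 * ln (real n)) (real n powr (1 / 2 - e)) (\<delta> * real n))) sequentially"
proof -
  \<comment> \<open>The exponent of the growth of a potential is \<open>12 * \<eta> = e / 16\<close>.\<close>
  define \<eta> where "\<eta> = e / 192"
  define k where "k = nat \<lceil>16 / e\<rceil>"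
  have \<eta>: "0 < \<eta>" "\<eta> \<le> 1" using e by (simp_all add: \<eta>_def)
  have ke: "16 \<le> real k * e"
  proof -
    have "16 / e \<le> real k" unfolding k_def by (rule real_nat_ceiling_ge)
    then show ?thesis using e by (simp add: divide_le_eq)
  qed
  then have k: "1 \<le> k" by (cases k) simp_all
  define C where "C = (2 + 2 * real k / \<eta>) ^ k * exp (real k)"
  have C: "0 \<le> C" unfolding C_def using \<eta> by simp
  let ?Q = "\<lambda>n. agreement_budget e \<eta> (real n)"
  have par: "e > 0" "e \<le> 1 / 4" "\<eta> = e / 192" "\<delta> > 0" "0 < real k" using e \<delta> k by (simp_all add: \<eta>_def)
  note van = error_terms_vanish[OF par] and cond = scale_conditions[OF par]
  define t1 where "t1 n = (real n * sqrt (ln (real n)) + 1) / (real n * (1 / 2 * ln (real n)))" for n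
  define t2 where "t2 n = exp (- (1 / 3) * real n powr (3 / 2 - e))" for n
  define t3 where "t3 n = 2 * (4 / (\<delta>\<^sup>2 * real n) + 2 * exp (- 2 * sqrt (ln (real n))) / \<delta>)" for n
  define t4 where "t4 n = C * exp (- 2 * ln (real n) + real k * ln (3 / \<eta> * ln (real n)))" for n
  define t5 where "t5 n = real n * exp (\<eta> - \<eta> * (3 / \<eta> * ln (real n) - 1))" for n
  define t6 where "t6 n = (2 + (2 * (1 + ln (real n + 1)) + 1) / real n * (?Q n / (real n - 1))) / (\<eta> * ln (real n))" for n
  define t7 where "t7 n = ?Q n / (real n - 1) / (\<delta> / 4 * real n)" for n
  define err where "err n = t1 n + t2 n + t3 n + (t4 n + t5 n + t6 n + t7 n)" for n
  have "err \<longlonglongrightarrow> 0 + 0 + 0 + (C * 0 + 0 + 0 + 0)"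
    unfolding err_def t1_def t2_def t3_def t4_def t5_def t6_def t7_def
    by (intro tendsto_add tendsto_mult_left van)
  then have lim: "err \<longlonglongrightarrow> 0" by simp
  have "eventually (\<lambda>n. 1 - err n
    \<le> measure (game_space n) (close_event n (1 / 2 * ln (real n)) (real n powr (1 / 2 - e)) (\<delta> * real n))) sequentially"
    using cond eventually_ge_at_top[of 2]
  proof eventually_elim
    case (elim n)
    define x where "x = real n"
    \<comment> \<open>A given vocabulary is too large with probability of order \<open>exp (- \<eta> * \<kappa>) = x powr (- 3)\<close>.\<close>
    define \<kappa> where "\<kappa> = 3 / \<eta> * ln x"
    \<comment> \<open>About \<open>x powr (3/2 - e)\<close> rings are expected by the final time; \<open>M\<close> is twice this number.\<close>
    define M where "M = nat \<lceil>2 * x powr (3 / 2 - e)\<rceil>"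
    \<comment> \<open>Enough rings for almost all vertices to enter, but far fewer than \<open>x * ln x / 2\<close>.\<close>
    define m0 where "m0 = nat \<lceil>x * sqrt (ln x)\<rceil>"
    have x: "2 \<le> x" using elim(8) by (simp add: x_def)
    have lnx: "0 < ln x" using x by simp
    have \<kappa>: "2 \<le> \<kappa>" using elim(1) by (simp add: \<kappa>_def x_def)
    have M: "2 * x powr (3 / 2 - e) \<le> real M" "real M \<le> 3 * x powr (3 / 2 - e)"
    proof -
      show "2 * x powr (3 / 2 - e) \<le> real M" unfolding M_def by (rule real_nat_ceiling_ge)
      have "real M \<le> 2 * x powr (3 / 2 - e) + 1" unfolding M_def by (intro nat_ceiling_le) simp
      then show "real M \<le> 3 * x powr (3 / 2 - e)" using elim(6) by (simp add: x_def)
    qed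
    have m0: "x * sqrt (ln x) \<le> real m0" "real m0 \<le> x * sqrt (ln x) + 1"
    proof -
      show "x * sqrt (ln x) \<le> real m0" unfolding m0_def by (rule real_nat_ceiling_ge)
      show "real m0 \<le> x * sqrt (ln x) + 1" unfolding m0_def using x lnx by (intro nat_ceiling_le) simp
    qed
    have m0M: "m0 \<le> M" using m0(2) M(1) elim(5) unfolding x_def by linarith
    have Q: "x powr (e / 4) * ((1 + \<eta>) * real M / x + \<kappa>) * real M \<le> ?Q n"
      unfolding agreement_budget_def[OF par] x_def[symmetric] \<kappa>_def[symmetric]
    proof (intro mult_mono add_mono M(2) order_refl)
      have "(1 + \<eta>) * real M \<le> 2 * (3 * x powr (3 / 2 - e))" using \<eta> M by (intro mult_mono) simp_all
      then have "(1 + \<eta>) * real M / x \<le> 2 * (3 * x powr (3 / 2 - e)) / x" using x by (intro divide_right_mono) simp_all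
      also have "\<dots> = 6 * x powr (1 / 2 - e)"
      proof -
        have "x powr (3 / 2 - e) = x powr (1 / 2 - e) * x powr 1" unfolding powr_add[symmetric] by simp
        then show ?thesis using x by simp
      qed
      finally show "(1 + \<eta>) * real M / x \<le> 6 * x powr (1 / 2 - e)" .
    qed (use \<eta> \<kappa> x in simp_all)
    have bound: "1 - real m0 / (x * (1 / 2 * ln x)) - exp (x * x powr (1 / 2 - e)) * (1 / 2) ^ M
      - 2 * (4 / (\<delta>\<^sup>2 * x) + 2 * exp (- 2 * real m0 / x) / \<delta>)
      - (x * ((2 + 2 * real k / \<eta>) ^ k * exp (real k * (4 * (\<eta> * ln x) + 8 * \<eta> * ln x + 8 * ?Q n / x\<^sup>2 + ln \<kappa>)) / (x powr (e / 4)) ^ k)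
      + x * exp (\<eta> - \<eta> * (\<kappa> - 1))
      + (2 + (2 * (1 + ln (x + 1)) + 1) / x * (?Q n / (x - 1))) / (\<eta> * ln x)
      + ?Q n / (x - 1) / (\<delta> / 4 * x))
      \<le> measure (game_space n) (close_event n (1 / 2 * ln x) (x powr (1 / 2 - e)) (\<delta> * x))"
      unfolding x_def
    proof (rule close_event_lower_bound)
      show "2 \<le> n" by (rule elim(8))
      show "real M + 2 * real n \<le> 2 * (real n)\<^sup>2" using elim(4) M(2) by (simp add: x_def)
      show "0 < 1 / 2 * ln (real n)" using lnx by (simp add: x_def)
      show "0 < \<eta> * ln (real n)" using lnx \<eta> by (simp add: x_def)
      show "real n powr (e / 4) * ((1 + \<eta>) * real M / real n + \<kappa>) * real M \<le> ?Q n" using Q by (simp add: x_def)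
      show "0 < real n powr (e / 4)" using x by (simp add: x_def)
    qed (use \<delta> m0M \<eta> \<kappa> elim(2,3) k in simp_all)
    have b1: "real m0 / (x * (1 / 2 * ln x)) \<le> t1 n"
      unfolding t1_def x_def[symmetric] using m0(2) x lnx by (intro divide_right_mono) simp_all
    have b2: "exp (x * x powr (1 / 2 - e)) * (1 / 2) ^ M \<le> t2 n"
    proof -
      let ?y = "x powr (3 / 2 - e)"
      have "x * x powr (1 / 2 - e) = x powr 1 * x powr (1 / 2 - e)" using x by simp
      also have "\<dots> = ?y" unfolding powr_add[symmetric] by simp
      finally have xy: "x * x powr (1 / 2 - e) = ?y" .
      have "(1 / 2 :: real) = exp (- ln 2)" by (simp add: exp_minus)
      then have "(1 / 2 :: real) ^ M = exp (real M * - ln 2)" by (simp only: exp_of_nat_mult)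
      also have "\<dots> \<le> exp (- (4 / 3) * ?y)"
      proof -
        \<comment> \<open>Since \<open>2 * ln 2 > 1\<close>, the power of \<open>1 / 2\<close> dominates the exponential.\<close>
        have "2 * ?y * (2 / 3) \<le> real M * ln 2"
          using M(1) ln2_ge_two_thirds by (intro mult_mono) simp_all
        then show ?thesis by simp
      qed
      finally have "exp (x * x powr (1 / 2 - e)) * (1 / 2) ^ M \<le> exp ?y * exp (- (4 / 3) * ?y)"
        unfolding xy by (rule mult_left_mono) simp
      also have "\<dots> = t2 n" unfolding t2_def x_def[symmetric] exp_add[symmetric] by simp
      finally show ?thesis .
    qed
    have b3: "2 * (4 / (\<delta>\<^sup>2 * x) + 2 * exp (- 2 * real m0 / x) / \<delta>) \<le> t3 n"
    proof -
      have "sqrt (ln x) \<le> real m0 / x" using m0(1) x by (simp add: le_divide_eq mult.commute)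
      then have "- 2 * real m0 / x \<le> - 2 * sqrt (ln x)" by simp
      then have "exp (- 2 * real m0 / x) \<le> exp (- 2 * sqrt (ln x))" by (subst exp_le_cancel_iff)
      then show ?thesis unfolding t3_def x_def[symmetric] using \<delta> by (intro mult_left_mono add_left_mono divide_right_mono) simp_all
    qed
    have b4: "x * ((2 + 2 * real k / \<eta>) ^ k * exp (real k * (4 * (\<eta> * ln x) + 8 * \<eta> * ln x + 8 * ?Q n / x\<^sup>2 + ln \<kappa>)) / (x powr (e / 4)) ^ k) \<le> t4 n"
    proof -
      have "8 * ?Q n / x\<^sup>2 \<le> 1" using elim(7) by (simp add: x_def)
      then have "4 * (\<eta> * ln x) + 8 * \<eta> * ln x + 8 * ?Q n / x\<^sup>2 + ln \<kappa> \<le> e / 16 * ln x + 1 + ln \<kappa>"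
        by (simp add: \<eta>_def)
      then have le: "exp (real k * (4 * (\<eta> * ln x) + 8 * \<eta> * ln x + 8 * ?Q n / x\<^sup>2 + ln \<kappa>)) \<le> exp (real k * (e / 16 * ln x + 1 + ln \<kappa>))"
        by (subst exp_le_cancel_iff) (rule mult_left_mono, simp_all)
      have rk: "(x powr (e / 4)) ^ k = exp (real k * (e / 4 * ln x))"
        using x by (simp add: powr_def exp_of_nat_mult[symmetric])
      have xe: "x = exp (ln x)" using x by simp
      have "x * ((2 + 2 * real k / \<eta>) ^ k * exp (real k * (4 * (\<eta> * ln x) + 8 * \<eta> * ln x + 8 * ?Q n / x\<^sup>2 + ln \<kappa>)) / (x powr (e / 4)) ^ k)
        \<le> x * ((2 + 2 * real k / \<eta>) ^ k * exp (real k * (e / 16 * ln x + 1 + ln \<kappa>)) / (x powr (e / 4)) ^ k)"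
        using x \<eta> le by (intro mult_left_mono divide_right_mono) simp_all
      also have "\<dots> = (2 + 2 * real k / \<eta>) ^ k * (exp (ln x) * exp (real k * (e / 16 * ln x + 1 + ln \<kappa>)) / exp (real k * (e / 4 * ln x)))"
        unfolding rk using x by simp
      also have "exp (ln x) * exp (real k * (e / 16 * ln x + 1 + ln \<kappa>)) / exp (real k * (e / 4 * ln x))
          = exp (real k + (ln x - real k * e * (3 / 16) * ln x + real k * ln \<kappa>))"
        unfolding exp_add[symmetric] exp_diff[symmetric] by (simp add: algebra_simps)
      also have "\<dots> \<le> exp (real k + (- 2 * ln x + real k * ln \<kappa>))"
      proof -
        have "3 * ln x \<le> real k * e * (3 / 16) * ln x"
        proof (rule mult_right_mono)
          show "3 \<le> real k * e * (3 / 16)" using ke by linarith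
        qed (use lnx in simp)
        then show ?thesis by simp
      qed
      also have "(2 + 2 * real k / \<eta>) ^ k * exp (real k + (- 2 * ln x + real k * ln \<kappa>)) = t4 n"
        unfolding t4_def C_def x_def[symmetric] \<kappa>_def[symmetric] exp_add by (simp add: mult.assoc)
      finally show ?thesis using \<eta> by (simp add: mult_left_mono)
    qed
    have b5: "x * exp (\<eta> - \<eta> * (\<kappa> - 1)) = t5 n" unfolding t5_def \<kappa>_def x_def by (rule refl)
    have b6: "(2 + (2 * (1 + ln (x + 1)) + 1) / x * (?Q n / (x - 1))) / (\<eta> * ln x) = t6 n" unfolding t6_def x_def by (rule refl)
    have b7: "?Q n / (x - 1) / (\<delta> / 4 * x) = t7 n" unfolding t7_def x_def by (rule refl)
    show ?case using bound[unfolded b5 b6 b7] b1 b2 b3 b4 unfolding err_def x_def[symmetric] by linarith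
  qed
  then show ?thesis using lim by blast
qed

text \<open>
  It suffices to treat small \<open>\<epsilon>\<close>, because the interval \<open>{a n..b n}\<close> shrinks as \<open>\<epsilon>\<close> grows.
\<close>

theorem theorem1:
  fixes \<epsilon> \<delta> :: real and a b :: "nat \<Rightarrow> real"
  assumes "\<epsilon> > 0" and "\<delta> > 0"
  defines "a \<equiv> \<lambda>n. (1/2 + \<epsilon>) * ln (real n)"
    and "b \<equiv> \<lambda>n. real n powr (1/2 - \<epsilon>)"
  shows "(\<lambda>n. measure (game_space n)
            {\<omega> \<in> space (game_space n).
               (SUP t \<in> {a n..b n}. ennreal \<bar>real (card (words n \<omega> t)) - real n / 2\<bar>)
                 \<le> ennreal (\<delta> * real n)})
         \<longlonglongrightarrow> 1"
proof -
  define e where "e = min \<epsilon> (1 / 4)"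
  have e: "0 < e" "e \<le> 1 / 4" "e \<le> \<epsilon>" using assms(1) by (simp_all add: e_def)
  obtain err where err: "err \<longlonglongrightarrow> 0"
    "eventually (\<lambda>n. 1 - err n
      \<le> measure (game_space n) (close_event n (1 / 2 * ln (real n)) (real n powr (1 / 2 - e)) (\<delta> * real n))) sequentially"
    using close_event_prob_tendsto[OF e(1,2) assms(2)] by blast
  have prob: "prob_space (game_space n)" for n
    using prob_space.prob_space_completion[OF prob_space_clocks] by (simp add: game_space_def clocks_def)
  have "(\<lambda>n. measure (game_space n) (close_event n (a n) (b n) (\<delta> * real n))) \<longlonglongrightarrow> 1"
  proof (rule tendsto_sandwich)
    have "(\<lambda>n. 1 - err n) \<longlonglongrightarrow> 1 - 0" by (intro tendsto_diff tendsto_const err(1))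
    then show "(\<lambda>n. 1 - err n) \<longlonglongrightarrow> 1" by simp
    show "(\<lambda>_. 1 :: real) \<longlonglongrightarrow> 1" by simp
    show "eventually (\<lambda>n. measure (game_space n) (close_event n (a n) (b n) (\<delta> * real n)) \<le> 1) sequentially"
      using prob_space.prob_le_1[OF prob] by simp
    show "eventually (\<lambda>n. 1 - err n \<le> measure (game_space n) (close_event n (a n) (b n) (\<delta> * real n))) sequentially"
      using err(2) eventually_ge_at_top[of 2]
    proof eventually_elim
      case (elim n)
      interpret P: prob_space "game_space n" by (rule prob)
      have ln: "0 \<le> ln (real n)" using elim(2) by (intro ln_ge_zero) simp
      have D: "0 \<le> \<delta> * real n" using assms(2) by simp
      have "1 / 2 * ln (real n) \<le> a n" unfolding a_def using ln assms(1) by (intro mult_right_mono) simp_all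
      moreover have "b n \<le> real n powr (1 / 2 - e)" unfolding b_def using e(3) elim(2) by (intro powr_mono) simp_all
      ultimately have sub: "close_event n (1 / 2 * ln (real n)) (real n powr (1 / 2 - e)) (\<delta> * real n) \<subseteq> close_event n (a n) (b n) (\<delta> * real n)"
        by (rule close_event_mono[OF D])
      have "0 \<le> a n" unfolding a_def using ln assms(1) by simp
      then have "close_event n (a n) (b n) (\<delta> * real n) \<in> sets (game_space n)"
        using close_event_sets[OF elim(2) D, of "a n" "b n"] by blast
      then have "measure (game_space n) (close_event n (1 / 2 * ln (real n)) (real n powr (1 / 2 - e)) (\<delta> * real n))
          \<le> measure (game_space n) (close_event n (a n) (b n) (\<delta> * real n))"
        by (rule P.finite_measure_mono[OF sub])
      then show ?case using elim(1) by linarith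
    qed
  qed
  then show ?thesis unfolding close_event_def .
qed

end
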